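(* Let $D\subset\mathbb{C}$ be the open unit disk and let $\sigma\in L^\infty(D)$ be complex-valued with $\operatorname{supp}(\sigma-1)$ a compact subset of $D$ and $\varsigma_-\le\operatorname{Re}(\sigma)\le\varsigma_+$ almost everywhere in $D$ for some constants $\varsigma_-,\varsigma_+>0$. Let $\Upsilon(\sigma)$ be the relative Neumann-to-Dirichlet map on $\partial D$, and let $P_\diamond,Q_M,F_M,G_M$ be the operators defined in the context. Then for every $s>\frac12$ there is a constant $C=C(s,\sigma)>0$, independent of $M$, such that for all $M\in\mathbb{N}$ $$\|\Upsilon(\sigma)-P_\diamond Q_M\Upsilon(\sigma)F_MG_M\|_{\mathscr{L}(H^s_\diamond,L^2_\diamond)}\le C\left(\tfrac12+M\right)^{-s}.$$
   Context: $\mathbb{N}=\{1,2,\dots\}$. $\mathscr{L}(X,Y)$ denotes the bounded linear operators from $X$ to $Y$. Periodic Sobolev spaces: let $f_n(\theta)=e^{\mathrm{i}n\theta}$, $n\in\mathbb{Z}$. For a $2\pi$-periodic distribution $g$ on $\mathbb{R}$, $\hat g(n)=\frac1{2\pi}\langle g,f_{-n}\rangle$ are its Fourier coefficients ($\hat g(n)=\frac1{2\pi}\int_{-\pi}^{\pi}g(\theta)e^{-\mathrm{i}n\theta}d\theta$ for functions). With $\underline n=\max\{1,|n|\}$, $H^s$ ($s\in\mathbb{R}$) is the Hilbert space of $2\pi$-periodic distributions with $\|g\|_s=(2\pi\sum_{n\in\mathbb{Z}}\underline n^{2s}|\hat g(n)|^2)^{1/2}<\infty$; $H^s_\diamond=\{g\in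 H^s:\hat g(0)=0\}$; $L^2=H^0$, $L^2_\diamond=H^0_\diamond$. $H^s$ is identified with $H^s(\partial D)$ via $\theta\leftrightarrow e^{\mathrm{i}\theta}$. For $s>\frac12$ elements of $H^s$ are identified with continuous $2\pi$-periodic functions. $P_\diamond g=\sum_{n\ne0}\hat g(n)f_n$ is the orthogonal projection of $H^s$ onto $H^s_\diamond$. Relative Neumann-to-Dirichlet map: for $f\in H^s_\diamond(\partial D)$ let $u$ be the solution, unique up to an additive constant, of $\nabla\cdot(\sigma\nabla u)=0$ in $D$, $\partial u/\partial\nu=f$ on $\partial D$ ($\nu$ the exterior unit normal). $\Lambda(\sigma):H^s_\diamond(\partial D)\to H^{s+1}_\diamond(\partial D)$ maps $f$ to $u|_{\partial D}$, with the constant chosen so that the trace has zero mean. Put $\Upsilon(\sigma)=\Lambda(\sigma)-\Lambda(1)$. Because $\sigma=1$ near $\partial D$, it is known that $\Upsilon(\sigma)$ is bounded (extends boundedly) from $H^t_\diamond$ to $H^r_\diamond$ for all $t,r\in\mathbb{R}$. Discretization operators: for $|m|\le M$ let $\theta_m=\frac{2\pi m}{2M+1}$ and $\phi_m(\theta)=\frac1{2M+1}\sum_{n=-M}^Me^{\mathrm{i}n(\theta-\theta_m)}$. For $g\in H^s$, $s>\frac12$, $$Q_Mg=\sum_{|m|\le M}g(\theta_m)\phi_m,\quad F_Mg=\frac{2\pi}{2M+1}\sum_{|m|\le M}g(\theta_m)\delta_{\theta_m},\quad G_Mg=g-\frac1{2M+1}\sum_{|m|\le M}g(\theta_m),$$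 where $\delta_{\theta_m}$ is the $2\pi$-periodized Dirac delta at $\theta_m$ (which belongs to $H^t$ for all $t<-\frac12$). $F_MG_M$ maps $H^s$ into $H^t_\diamond$ for $s>\frac12$, $t<-\frac12$. *)

theory Defs
  imports "HOL-Analysis.Analysis"
begin

section \<open>Periodic distributions and periodic Sobolev spaces\<close>

definition per_test :: "(real \<Rightarrow> complex) set" where
  "per_test = {\<phi>. (\<forall>\<theta>. \<phi> (\<theta> + 2 * pi) = \<phi> \<theta>) \<and>
     (\<forall>k \<theta>. (((\<lambda>h t. vector_derivative h (at t)) ^^ k) \<phi>) differentiable (at \<theta>))}"

definition sup_deriv :: "nat \<Rightarrow> (real \<Rightarrow> complex) \<Rightarrow> real" where
  "sup_deriv k \<phi> = (SUP \<theta>. norm (((\<lambda>h t. vector_derivative h (at t)) ^^ k) \<phi> \<theta>))"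

text \<open>A periodic distribution is a continuous complex-linear functional on \<^term>\<open>per_test\<close>. As functions
  in HOL are total, it takes the value 0 outside \<^term>\<open>per_test\<close>; so two distributions are equal iff
  they agree on \<^term>\<open>per_test\<close>.\<close>

type_synonym functional = "(real \<Rightarrow> complex) \<Rightarrow> complex"

definition pdist :: "functional set" where
  "pdist = {g. (\<forall>\<phi>\<in>per_test. \<forall>\<psi>\<in>per_test. \<forall>a b.
                  g (\<lambda>\<theta>. a * \<phi> \<theta> + b * \<psi> \<theta>) = a * g \<phi> + b * g \<psi>) \<and>
               (\<exists>C N. \<forall>\<phi>\<in>per_test. norm (g \<phi>) \<le> C * (\<Sum>k\<le>N. sup_deriv k \<phi>)) \<and>
               (\<forall>\<phi>. \<phi> \<notin> per_test \<longrightarrow> g \<phi> = 0)}"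

definition dist_of :: "(real \<Rightarrow> complex) \<Rightarrow> functional" where
  "dist_of h = (\<lambda>\<phi>. if \<phi> \<in> per_test then LINT \<theta>|lebesgue_on {-pi..pi}. h \<theta> * \<phi> \<theta> else 0)"

text \<open>The \<open>2\<pi>\<close>-periodized Dirac delta: a single evaluation, since the test functions are periodic.\<close>

definition dirac :: "real \<Rightarrow> functional" where
  "dirac a = (\<lambda>\<phi>. if \<phi> \<in> per_test then \<phi> a else 0)"

definition fmode :: "int \<Rightarrow> real \<Rightarrow> complex" where
  "fmode n \<theta> = exp (\<i> * of_int n * of_real \<theta>)"

definition fcoeff :: "functional \<Rightarrow> int \<Rightarrow> complex" where
  "fcoeff g n = g (fmode (- n)) / (2 * pi)"

definition sob_weight :: "real \<Rightarrow> int \<Rightarrow> real" where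
  "sob_weight s n = real_of_int (max 1 \<bar>n\<bar>) powr (2 * s)"

definition Hs :: "real \<Rightarrow> functional set" where
  "Hs s = {g \<in> pdist. (\<lambda>n. sob_weight s n * (norm (fcoeff g n))\<^sup>2) summable_on UNIV}"

definition Hs_norm :: "real \<Rightarrow> functional \<Rightarrow> real" where
  "Hs_norm s g = sqrt (2 * pi * (\<Sum>\<^sub>\<infinity>n\<in>UNIV. sob_weight s n * (norm (fcoeff g n))\<^sup>2))"

definition Hs0 :: "real \<Rightarrow> functional set" where
  "Hs0 s = {g \<in> Hs s. fcoeff g 0 = 0}"

text \<open>\<open>bops s r\<close> is the set of bounded linear operators from \<open>H\<^sup>s\<close> to \<open>H\<^sup>r\<close>, both restricted to zero mean
  (the values outside the domain are unconstrained), and \<open>op_norm s r\<close> its operator norm.\<close>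

definition bops :: "real \<Rightarrow> real \<Rightarrow> (functional \<Rightarrow> functional) set" where
  "bops s r = {A. (\<forall>g\<in>Hs0 s. A g \<in> Hs0 r) \<and>
     (\<forall>g\<in>Hs0 s. \<forall>h\<in>Hs0 s. \<forall>a b.
        A (\<lambda>\<phi>. a * g \<phi> + b * h \<phi>) = (\<lambda>\<phi>. a * A g \<phi> + b * A h \<phi>)) \<and>
     (\<exists>C. \<forall>g\<in>Hs0 s. Hs_norm r (A g) \<le> C * Hs_norm s g)}"

definition op_norm :: "real \<Rightarrow> real \<Rightarrow> (functional \<Rightarrow> functional) \<Rightarrow> real" where
  "op_norm s r A = (SUP g\<in>{g \<in> Hs0 s. Hs_norm s g \<le> 1}. Hs_norm r (A g))"

section \<open>Sobolev functions on the unit disk\<close>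

abbreviation disk :: "complex set" where
  "disk \<equiv> ball 0 1"

definition px :: "(complex \<Rightarrow> complex) \<Rightarrow> complex \<Rightarrow> complex" where
  "px v z = frechet_derivative v (at z) 1"

definition py :: "(complex \<Rightarrow> complex) \<Rightarrow> complex \<Rightarrow> complex" where
  "py v z = frechet_derivative v (at z) \<i>"

primrec Ck_plane :: "nat \<Rightarrow> (complex \<Rightarrow> complex) \<Rightarrow> bool" where
  "Ck_plane 0 v \<longleftrightarrow> continuous_on UNIV v"
| "Ck_plane (Suc k) v \<longleftrightarrow> (\<forall>z. v differentiable (at z)) \<and> Ck_plane k (px v) \<and> Ck_plane k (py v)"

text \<open>Real-smooth functions on the plane; their restrictions to the closed unit disk are exactly the
  functions that are smooth up to the boundary.\<close>

definition smooth_plane :: "(complex \<Rightarrow> complex) \<Rightarrow> bool" where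
  "smooth_plane v \<longleftrightarrow> (\<forall>k. Ck_plane k v)"

definition disk_test :: "(complex \<Rightarrow> complex) set" where
  "disk_test = {\<phi>. smooth_plane \<phi> \<and> compact (closure {z. \<phi> z \<noteq> 0}) \<and> closure {z. \<phi> z \<noteq> 0} \<subseteq> disk}"

definition sq_integrable :: "'a measure \<Rightarrow> ('a \<Rightarrow> complex) \<Rightarrow> bool" where
  "sq_integrable M u \<longleftrightarrow> u \<in> borel_measurable M \<and> integrable M (\<lambda>x. (norm (u x))\<^sup>2)"

definition L2_tendsto :: "'a measure \<Rightarrow> (nat \<Rightarrow> 'a \<Rightarrow> complex) \<Rightarrow> ('a \<Rightarrow> complex) \<Rightarrow> bool" where
  "L2_tendsto M v u \<longleftrightarrow> (\<lambda>k. LINT x|M. (norm (v k x - u x))\<^sup>2) \<longlonglongrightarrow> 0"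

text \<open>\<open>u\<close> is in the Sobolev space \<open>H\<^sup>1\<close> of the disk and has the weak partial derivatives \<open>p\<close>, \<open>q\<close>.\<close>

definition H1_disk :: "(complex \<Rightarrow> complex) \<Rightarrow> (complex \<Rightarrow> complex) \<Rightarrow> (complex \<Rightarrow> complex) \<Rightarrow> bool" where
  "H1_disk u p q \<longleftrightarrow>
     sq_integrable (lebesgue_on disk) u \<and>
     sq_integrable (lebesgue_on disk) p \<and> sq_integrable (lebesgue_on disk) q \<and>
     (\<forall>\<phi>\<in>disk_test.
        (LINT z|lebesgue_on disk. u z * px \<phi> z) = - (LINT z|lebesgue_on disk. p z * \<phi> z) \<and>
        (LINT z|lebesgue_on disk. u z * py \<phi> z) = - (LINT z|lebesgue_on disk. q z * \<phi> z))"

text \<open>The trace: the continuous extension to \<open>H\<^sup>1\<close> of the restriction to the unit circle of functions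
  smooth up to the boundary. It is stated as a relation between \<open>u\<close> (with weak partial derivatives
  \<open>p\<close>, \<open>q\<close>) and a square-integrable \<open>h\<close> on \<open>[-\<pi>, \<pi>]\<close>, the latter determined up to a null set.\<close>

definition has_trace ::
  "(complex \<Rightarrow> complex) \<Rightarrow> (complex \<Rightarrow> complex) \<Rightarrow> (complex \<Rightarrow> complex) \<Rightarrow> (real \<Rightarrow> complex) \<Rightarrow> bool" where
  "has_trace u p q h \<longleftrightarrow>
     sq_integrable (lebesgue_on {-pi..pi}) h \<and>
     (\<exists>v. (\<forall>k. smooth_plane (v k)) \<and>
        L2_tendsto (lebesgue_on disk) v u \<and>
        L2_tendsto (lebesgue_on disk) (\<lambda>k. px (v k)) p \<and>
        L2_tendsto (lebesgue_on disk) (\<lambda>k. py (v k)) q \<and>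
        L2_tendsto (lebesgue_on {-pi..pi}) (\<lambda>k \<theta>. v k (cis \<theta>)) h)"

section \<open>The relative Neumann-to-Dirichlet map\<close>

text \<open>Support of a function on \<open>S\<close> that is only defined up to null sets.\<close>

definition ess_supp :: "complex set \<Rightarrow> (complex \<Rightarrow> complex) \<Rightarrow> complex set" where
  "ess_supp S g = {z \<in> S. \<forall>U. open U \<and> z \<in> U \<longrightarrow> \<not> (AE w in lebesgue_on (S \<inter> U). g w = 0)}"

definition Linf :: "complex set \<Rightarrow> (complex \<Rightarrow> complex) \<Rightarrow> bool" where
  "Linf S g \<longleftrightarrow> g \<in> borel_measurable (lebesgue_on S) \<and> (\<exists>B. AE z in lebesgue_on S. norm (g z) \<le> B)"

text \<open>Weak form of \<open>div (\<sigma> grad u) = 0\<close> in the disk with Neumann data \<open>f\<close>, i.e.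
  \<open>\<integral> \<sigma> grad u \<cdot> grad v = \<langle>f, v\<rangle>\<close>, where \<open>p\<close>, \<open>q\<close> are the weak partial derivatives of \<open>u\<close>. As \<open>v\<close> is smooth up to
  the boundary, the (bilinear) boundary pairing makes sense for every periodic distribution \<open>f\<close>;
  these \<open>v\<close> are dense in \<open>H\<^sup>1\<close>.\<close>

definition neumann_sol ::
  "(complex \<Rightarrow> complex) \<Rightarrow> functional \<Rightarrow>
   (complex \<Rightarrow> complex) \<Rightarrow> (complex \<Rightarrow> complex) \<Rightarrow> (complex \<Rightarrow> complex) \<Rightarrow> bool" where
  "neumann_sol \<sigma> f u p q \<longleftrightarrow> H1_disk u p q \<and>
     (\<forall>v. smooth_plane v \<longrightarrow>
        (LINT z|lebesgue_on disk. \<sigma> z * (p z * px v z + q z * py v z)) = f (\<lambda>\<theta>. v (cis \<theta>)))"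

text \<open>The Neumann-to-Dirichlet map, for Neumann data in \<open>Hs0 (-1/2)\<close>, the natural space for solutions
  in \<open>H\<^sup>1\<close>.\<close>

definition ND :: "(complex \<Rightarrow> complex) \<Rightarrow> functional \<Rightarrow> functional" where
  "ND \<sigma> f = (THE g. \<exists>u p q h. neumann_sol \<sigma> f u p q \<and> has_trace u p q h \<and>
               (LINT \<theta>|lebesgue_on {-pi..pi}. h \<theta>) = 0 \<and> g = dist_of h)"

text \<open>The difference of the maps for \<open>\<sigma>\<close> and 1, extended from \<open>Hs0 (-1/2)\<close> to the operator that is bounded
  from \<open>Hs0 t\<close> to \<open>Hs0 r\<close> for all \<open>t\<close>, \<open>r\<close>. The last clause fixes the junk value outside the union of all
  \<open>Hs0 t\<close>.\<close>

definition relND :: "(complex \<Rightarrow> complex) \<Rightarrow> functional \<Rightarrow> functional" where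
  "relND \<sigma> = (THE U. (\<forall>f\<in>Hs0 (-1/2). U f = (\<lambda>\<phi>. ND \<sigma> f \<phi> - ND (\<lambda>_. 1) f \<phi>)) \<and>
                     (\<forall>t r. U \<in> bops t r) \<and>
                     (\<forall>f. f \<notin> (\<Union>t. Hs0 t) \<longrightarrow> U f = (\<lambda>_. 0)))"

section \<open>Discretization operators\<close>

text \<open>The identification of elements of \<open>Hs s\<close>, \<open>s > 1/2\<close>, with continuous periodic functions.\<close>

definition cont_rep :: "functional \<Rightarrow> real \<Rightarrow> complex" where
  "cont_rep g = (THE h. continuous_on UNIV h \<and> (\<forall>\<theta>. h (\<theta> + 2 * pi) = h \<theta>) \<and> dist_of h = g)"

definition Pdiam :: "functional \<Rightarrow> functional" where
  "Pdiam g = (\<lambda>\<phi>. \<Sum>\<^sub>\<infinity>n\<in>-{0}. fcoeff g n * dist_of (fmode n) \<phi>)"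

definition node :: "nat \<Rightarrow> int \<Rightarrow> real" where
  "node M m = 2 * pi * of_int m / (2 * real M + 1)"

definition dirichlet_basis :: "nat \<Rightarrow> int \<Rightarrow> real \<Rightarrow> complex" where
  "dirichlet_basis M m \<theta> =
     1 / (2 * of_nat M + 1) * (\<Sum>n\<in>{- int M..int M}. exp (\<i> * of_int n * of_real (\<theta> - node M m)))"

definition QM :: "nat \<Rightarrow> functional \<Rightarrow> functional" where
  "QM M g = dist_of (\<lambda>\<theta>. \<Sum>m\<in>{- int M..int M}. cont_rep g (node M m) * dirichlet_basis M m \<theta>)"

definition FM :: "nat \<Rightarrow> functional \<Rightarrow> functional" where
  "FM M g = (\<lambda>\<phi>. of_real (2 * pi / (2 * real M + 1)) *
     (\<Sum>m\<in>{- int M..int M}. cont_rep g (node M m) * dirac (node M m) \<phi>))"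

definition GM :: "nat \<Rightarrow> functional \<Rightarrow> functional" where
  "GM M g = (\<lambda>\<phi>. g \<phi> -
     dist_of (\<lambda>_. 1 / (2 * of_nat M + 1) * (\<Sum>m\<in>{- int M..int M}. cont_rep g (node M m))) \<phi>)"

end

(*
The Neumann-to-Dirichlet maps come from a Lax-Milgram iteration on functions smooth up to the boundary, whose
gradients converge in L^2; the energy of a trace is controlled by the Dirichlet principle, that is, by Green's
formula against z^n and its conjugate. Testing the two weak equations with the harmonic function h_n that extends
f_{-n} gives

  2 pi |n| (Upsilon f)^(n) = integral over D of (1 - sigma) grad u . grad h_n,

and on the support of sigma - 1, which lies in a disk of radius rho < 1, grad h_n is of order |n| rho^|n|. As the maps
are symmetric, the matrix of Upsilon in the Fourier basis therefore decays exponentially in both indices. This defines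
the bounded extension between all H^t and H^r, and reduces the estimate to aliasing: the n-th coefficients of
F_M G_M g and Q_M g are, for |n| <= M, sums of the coefficients of g over n + (2M+1)Z (with the class of 0 removed for
F_M G_M). The error of F_M G_M in the low modes is O((1/2+M)^(-s)) by the Cauchy-Schwarz inequality, and all other
contributions are exponentially small in M thanks to the decay of the matrix.
*)
theory Submission
  imports Defs
begin

section \<open>Square-integrable functions\<close>

text \<open>\<open>ND\<close> and \<open>relND\<close> are definite descriptions, so nothing can be
  computed before existence and uniqueness are proved. As \<open>has_trace\<close> asks for one
  sequence of smooth functions that converges together with its gradients and boundary values,
  existence has to deliver such a sequence; this is why the iteration stays within smooth functions,
  uses near-minimizers in place of Riesz representatives, and converges geometrically. Identities
  for smooth functions then pass to solutions along that sequence. All forms are bilinear, not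
  sesquilinear: for complex \<sigma> this keeps them symmetric, and conjugates appear only where a
  norm is needed. In the error estimate the obstacle is that \<open>FM M (GM M g)\<close> is a
  combination of Dirac deltas, whose Fourier coefficients are periodic in the index. In general it
  lies outside \<open>Hs0 (-1/2)\<close> and is close to g only in the modes |n| <= M. Its high
  modes are merely bounded, and only the smoothing by the matrix makes their contribution
  small.\<close>

lemma LIMSEQ_zero_bounded:
  fixes f :: "nat \<Rightarrow> 'a::real_normed_vector"
  assumes "g \<longlonglongrightarrow> 0" and "\<And>k. norm (f k) \<le> g k"
  shows "f \<longlonglongrightarrow> 0"
  using Lim_null_comparison[of f g sequentially] assms by simp

text \<open>Evaluating the parabola at its vertex \<open>t = - x / e\<close> gives the bound; for
  \<open>e = 0\<close> a line bounded below must be constant. It yields the Cauchy-Schwarz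
  inequality and, in \<open>Riesz_approximation\<close>, the approximate Euler equation of a
  near-minimizer.\<close>

lemma quadratic_lower_bound:
  fixes d x e :: real
  assumes "\<And>t. - d \<le> t * x + t\<^sup>2 * e / 2" and "0 \<le> e" "0 \<le> d"
  shows "x\<^sup>2 \<le> 2 * d * e"
proof (cases "e = 0")
  case True
  have "x = 0"
  proof (rule ccontr)
    assume "x \<noteq> 0"
    then have "- d \<le> - (d + 1)"
      using assms(1)[of "- (d + 1) / x"] True by simp
    then show False by simp
  qed
  then show ?thesis using True by simp
next
  case False
  then have e: "e > 0" using assms by simp
  have "- d \<le> - (x\<^sup>2 / (2 * e))"
    using assms(1)[of "- x / e"] e by (simp add: field_simps power2_eq_square)
  then show ?thesis using e by (simp add: field_simps)
qed

text \<open>The Bochner integral of a non-integrable function is 0, so this behaves like a norm only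
  together with \<open>sq_integrable\<close>; hence that hypothesis in the triangle and
  Cauchy-Schwarz inequalities.\<close>

definition l2norm :: "'a measure \<Rightarrow> ('a \<Rightarrow> complex) \<Rightarrow> real" where
  "l2norm M u = sqrt (LINT x|M. (norm (u x))\<^sup>2)"

lemma l2norm_nonneg [simp]: "0 \<le> l2norm M u"
  by (simp add: l2norm_def)

lemma l2norm_square: "(l2norm M u)\<^sup>2 = (LINT x|M. (norm (u x))\<^sup>2)"
  by (simp add: l2norm_def)

lemma sq_integrableD: "sq_integrable M u \<Longrightarrow> integrable M (\<lambda>x. (norm (u x))\<^sup>2)"
  by (simp add: sq_integrable_def)

lemma norm_add_square_le: "(norm (a + b :: complex))\<^sup>2 \<le> 2 * (norm a)\<^sup>2 + 2 * (norm b)\<^sup>2"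
proof -
  have "(norm (a + b))\<^sup>2 \<le> (norm a + norm b)\<^sup>2"
    by (simp add: norm_triangle_ineq power_mono)
  also have "\<dots> \<le> 2 * (norm a)\<^sup>2 + 2 * (norm b)\<^sup>2"
    using sum_squares_ge_zero[of "norm a - norm b" 0] by (simp add: power2_eq_square algebra_simps)
  finally show ?thesis .
qed

lemma sq_integrable_add:
  assumes "sq_integrable M u" "sq_integrable M v"
  shows "sq_integrable M (\<lambda>x. u x + v x)"
proof -
  have [measurable]: "u \<in> borel_measurable M" "v \<in> borel_measurable M"
    using assms by (auto simp: sq_integrable_def)
  have "integrable M (\<lambda>x. 2 * (norm (u x))\<^sup>2 + 2 * (norm (v x))\<^sup>2)"
    using assms by (auto simp: sq_integrable_def)
  then have "integrable M (\<lambda>x. (norm (u x + v x))\<^sup>2)"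
    by (rule Bochner_Integration.integrable_bound) (auto intro!: AE_I2 order_trans[OF norm_add_square_le])
  then show ?thesis by (simp add: sq_integrable_def)
qed

lemma sq_integrable_cmult:
  assumes "sq_integrable M u"
  shows "sq_integrable M (\<lambda>x. c * u x)"
  using assms by (auto simp: sq_integrable_def norm_mult power_mult_distrib)

lemma sq_integrable_uminus: "sq_integrable M u \<Longrightarrow> sq_integrable M (\<lambda>x. - u x)"
  using sq_integrable_cmult[of M u "-1"] by simp

lemma sq_integrable_diff:
  "sq_integrable M u \<Longrightarrow> sq_integrable M v \<Longrightarrow> sq_integrable M (\<lambda>x. u x - v x)"
  using sq_integrable_add[of M u "\<lambda>x. - v x"] sq_integrable_uminus[of M v] by simp

lemma sq_integrable_cnj: "sq_integrable M u \<Longrightarrow> sq_integrable M (\<lambda>x. cnj (u x))"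
  by (auto simp: sq_integrable_def intro: borel_measurable_continuous_on[OF continuous_on_cnj[OF continuous_on_id]])

lemma l2norm_cnj [simp]: "l2norm M (\<lambda>x. cnj (u x)) = l2norm M u"
  by (simp add: l2norm_def)

lemma l2norm_cmult: "l2norm M (\<lambda>x. c * u x) = norm c * l2norm M u"
  by (simp add: l2norm_def norm_mult power_mult_distrib real_sqrt_mult)

lemma l2norm_minus_commute: "l2norm M (\<lambda>x. u x - v x) = l2norm M (\<lambda>x. v x - u x)"
  by (simp add: l2norm_def norm_minus_commute)

lemma sq_integrable_mult_integrable:
  assumes "sq_integrable M u" "sq_integrable M v"
  shows "integrable M (\<lambda>x. u x * v x)"
proof -
  have [measurable]: "u \<in> borel_measurable M" "v \<in> borel_measurable M"
    using assms by (auto simp: sq_integrable_def)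
  have b: "norm (a * b) \<le> (norm a)\<^sup>2 + (norm b)\<^sup>2" for a b :: complex
    using sum_squares_bound[of "norm a" "norm b"] mult_nonneg_nonneg[OF norm_ge_zero norm_ge_zero, of a b]
    unfolding norm_mult by linarith
  have "integrable M (\<lambda>x. (norm (u x))\<^sup>2 + (norm (v x))\<^sup>2)"
    using assms by (auto simp: sq_integrable_def)
  then show ?thesis
    by (rule Bochner_Integration.integrable_bound) (auto intro!: AE_I2 order_trans[OF b])
qed

lemma l2norm_Cauchy_Schwarz_norm:
  assumes "sq_integrable M u" "sq_integrable M v"
  shows "(LINT x|M. norm (u x) * norm (v x)) \<le> l2norm M u * l2norm M v"
proof -
  define a where "a = (LINT x|M. (norm (u x))\<^sup>2)"
  define b where "b = (LINT x|M. (norm (v x))\<^sup>2)"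
  define c where "c = (LINT x|M. norm (u x) * norm (v x))"
  have iu: "integrable M (\<lambda>x. (norm (u x))\<^sup>2)" and iv: "integrable M (\<lambda>x. (norm (v x))\<^sup>2)"
    using assms by (auto simp: sq_integrable_def)
  have iuv: "integrable M (\<lambda>x. norm (u x) * norm (v x))"
    using integrable_norm[OF sq_integrable_mult_integrable[OF assms]] by (simp add: norm_mult)
  \<comment> \<open>The nonnegative integral of the square of |u| - t |v| is written in the shape of
    \<open>quadratic_lower_bound\<close>, with \<open>- 2 * c\<close> as the slope and
    \<open>2 * b\<close> as the curvature.\<close>
  have "- a \<le> t * (- 2 * c) + t\<^sup>2 * (2 * b) / 2" for t
  proof -
    have "0 \<le> (LINT x|M. (norm (u x) - t * norm (v x))\<^sup>2)" by simp
    also have "\<dots> = (LINT x|M. (norm (u x))\<^sup>2 - 2 * t * (norm (u x) * norm (v x)) + t\<^sup>2 * (norm (v x))\<^sup>2)"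
      by (intro Bochner_Integration.integral_cong) (auto simp: power2_eq_square algebra_simps)
    also have "\<dots> = a - 2 * t * c + t\<^sup>2 * b"
      using iu iv iuv by (simp add: a_def b_def c_def)
    finally show ?thesis by simp
  qed
  then have "(- 2 * c)\<^sup>2 \<le> 2 * a * (2 * b)"
    by (rule quadratic_lower_bound) (auto simp: a_def b_def)
  then have "c\<^sup>2 \<le> a * b" by (simp add: power2_eq_square)
  then have "c \<le> sqrt (a * b)" by (rule real_le_rsqrt)
  then show ?thesis by (simp add: l2norm_def a_def b_def c_def real_sqrt_mult)
qed

lemma l2norm_Cauchy_Schwarz:
  assumes "sq_integrable M u" "sq_integrable M v"
  shows "norm (LINT x|M. u x * v x) \<le> l2norm M u * l2norm M v"
proof -
  have "norm (LINT x|M. u x * v x) \<le> (LINT x|M. norm (u x * v x))" by simp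
  also have "\<dots> \<le> l2norm M u * l2norm M v"
    using l2norm_Cauchy_Schwarz_norm[OF assms] by (simp add: norm_mult)
  finally show ?thesis .
qed

lemma l2norm_triangle:
  assumes "sq_integrable M u" "sq_integrable M v"
  shows "l2norm M (\<lambda>x. u x + v x) \<le> l2norm M u + l2norm M v"
proof -
  have iu: "integrable M (\<lambda>x. (norm (u x))\<^sup>2)" and iv: "integrable M (\<lambda>x. (norm (v x))\<^sup>2)"
    and iw: "integrable M (\<lambda>x. (norm (u x + v x))\<^sup>2)"
    using assms sq_integrable_add[OF assms] by (auto simp: sq_integrable_def)
  have iuv: "integrable M (\<lambda>x. norm (u x) * norm (v x))"
    using integrable_norm[OF sq_integrable_mult_integrable[OF assms]] by (simp add: norm_mult)
  have "(LINT x|M. (norm (u x + v x))\<^sup>2)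
      \<le> (LINT x|M. (norm (u x))\<^sup>2 + 2 * (norm (u x) * norm (v x)) + (norm (v x))\<^sup>2)"
  proof (rule integral_mono)
    fix x
    have "(norm (u x + v x))\<^sup>2 \<le> (norm (u x) + norm (v x))\<^sup>2"
      by (simp add: norm_triangle_ineq power_mono)
    then show "(norm (u x + v x))\<^sup>2 \<le> (norm (u x))\<^sup>2 + 2 * (norm (u x) * norm (v x)) + (norm (v x))\<^sup>2"
      by (simp add: power2_eq_square algebra_simps)
  qed (use iu iv iuv iw in auto)
  also have "\<dots> = (l2norm M u)\<^sup>2 + 2 * (LINT x|M. norm (u x) * norm (v x)) + (l2norm M v)\<^sup>2"
    using iu iv iuv by (simp add: l2norm_square)
  also have "\<dots> \<le> (l2norm M u + l2norm M v)\<^sup>2"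
    using l2norm_Cauchy_Schwarz_norm[OF assms] by (simp add: power2_eq_square algebra_simps)
  finally have "(LINT x|M. (norm (u x + v x))\<^sup>2) \<le> (l2norm M u + l2norm M v)\<^sup>2" .
  then show ?thesis
    unfolding l2norm_def[of M "\<lambda>x. u x + v x"] by (intro real_le_lsqrt) auto
qed

lemma L2_tendsto_iff_l2norm: "L2_tendsto M v u \<longleftrightarrow> (\<lambda>k. l2norm M (\<lambda>x. v k x - u x)) \<longlonglongrightarrow> 0"
proof
  assume "L2_tendsto M v u"
  then show "(\<lambda>k. l2norm M (\<lambda>x. v k x - u x)) \<longlonglongrightarrow> 0"
    unfolding L2_tendsto_def l2norm_def using tendsto_real_sqrt by fastforce
next
  assume "(\<lambda>k. l2norm M (\<lambda>x. v k x - u x)) \<longlonglongrightarrow> 0"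
  then have "(\<lambda>k. (l2norm M (\<lambda>x. v k x - u x))\<^sup>2) \<longlonglongrightarrow> 0\<^sup>2" by (rule tendsto_power)
  then show "L2_tendsto M v u" by (simp add: L2_tendsto_def l2norm_square)
qed

lemma sq_integrable_bounded_mult:
  assumes "sq_integrable M u" and [measurable]: "s \<in> borel_measurable M"
    and "AE x in M. norm (s x) \<le> B"
  shows "sq_integrable M (\<lambda>x. s x * u x)"
proof -
  have [measurable]: "u \<in> borel_measurable M" using assms(1) by (auto simp: sq_integrable_def)
  have "integrable M (\<lambda>x. B\<^sup>2 * (norm (u x))\<^sup>2)"
    using assms by (auto simp: sq_integrable_def)
  then have "integrable M (\<lambda>x. (norm (s x * u x))\<^sup>2)"
    by (rule Bochner_Integration.integrable_bound)
      (use assms(3) in \<open>auto simp: norm_mult power_mult_distrib intro!: mult_right_mono power_mono\<close>)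
  then show ?thesis by (simp add: sq_integrable_def)
qed

lemma l2norm_bounded_mult:
  assumes "sq_integrable M u" and [measurable]: "s \<in> borel_measurable M"
    and "AE x in M. norm (s x) \<le> B" and "0 \<le> B"
  shows "l2norm M (\<lambda>x. s x * u x) \<le> B * l2norm M u"
proof -
  have "(LINT x|M. (norm (s x * u x))\<^sup>2) \<le> (LINT x|M. B\<^sup>2 * (norm (u x))\<^sup>2)"
  proof (rule integral_mono_AE)
    show "integrable M (\<lambda>x. (norm (s x * u x))\<^sup>2)"
      using sq_integrable_bounded_mult[OF assms(1-3)] by (simp add: sq_integrable_def)
    show "integrable M (\<lambda>x. B\<^sup>2 * (norm (u x))\<^sup>2)"
      using assms by (auto simp: sq_integrable_def)
    show "AE x in M. (norm (s x * u x))\<^sup>2 \<le> B\<^sup>2 * (norm (u x))\<^sup>2"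
      using assms(3) by (auto simp: norm_mult power_mult_distrib intro!: mult_right_mono power_mono)
  qed
  also have "\<dots> = (B * l2norm M u)\<^sup>2" by (simp add: power_mult_distrib l2norm_square)
  finally have "(LINT x|M. (norm (s x * u x))\<^sup>2) \<le> (B * l2norm M u)\<^sup>2" .
  then show ?thesis
    unfolding l2norm_def[of M "\<lambda>x. s x * u x"] by (intro real_le_lsqrt) (use assms in auto)
qed

lemma L2_tendsto_integral_mult:
  assumes "\<And>k. sq_integrable M (f k)" "\<And>k. sq_integrable M (g k)" "sq_integrable M f'" "sq_integrable M g'"
    and "L2_tendsto M f f'" "L2_tendsto M g g'"
  shows "(\<lambda>k. LINT x|M. f k x * g k x) \<longlonglongrightarrow> (LINT x|M. f' x * g' x)"
proof -
  define a where "a k = l2norm M (\<lambda>x. f k x - f' x)" for k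
  define b where "b k = l2norm M (\<lambda>x. g k x - g' x)" for k
  have a: "a \<longlonglongrightarrow> 0" and b: "b \<longlonglongrightarrow> 0"
    using assms unfolding L2_tendsto_iff_l2norm a_def b_def by auto
  have df: "sq_integrable M (\<lambda>x. f k x - f' x)" and dg: "sq_integrable M (\<lambda>x. g k x - g' x)" for k
    using assms sq_integrable_diff by blast+
  have "norm ((LINT x|M. f k x * g k x) - (LINT x|M. f' x * g' x))
        \<le> a k * b k + a k * l2norm M g' + l2norm M f' * b k" for k
  proof -
    have i: "integrable M (\<lambda>x. (f k x - f' x) * (g k x - g' x))"
        "integrable M (\<lambda>x. (f k x - f' x) * g' x)" "integrable M (\<lambda>x. f' x * (g k x - g' x))"
      "integrable M (\<lambda>x. f k x * g k x)" "integrable M (\<lambda>x. f' x * g' x)"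
      by (intro sq_integrable_mult_integrable df dg assms)+
    have e: "(LINT x|M. f k x * g k x) - (LINT x|M. f' x * g' x) = (LINT x|M. f k x * g k x - f' x * g' x)"
      using i by simp
    \<comment> \<open>Expanding around the limits leaves only the fixed norms of \<open>f'\<close>
      and \<open>g'\<close>, so no uniform bound on \<open>f k\<close> or \<open>g k\<close> has to
      be found.\<close>
    have e2: "\<dots> = (LINT x|M. ((f k x - f' x) * (g k x - g' x) + (f k x - f' x) * g' x) + f' x * (g k x - g' x))"
      by (intro Bochner_Integration.integral_cong) (auto simp: algebra_simps)
    have e3: "\<dots> = (LINT x|M. (f k x - f' x) * (g k x - g' x)) + (LINT x|M. (f k x - f' x) * g' x)
        + (LINT x|M. f' x * (g k x - g' x))"
      using i(1-3) by simp
    have "norm ((LINT x|M. f k x * g k x) - (LINT x|M. f' x * g' x))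
        \<le> norm (LINT x|M. (f k x - f' x) * (g k x - g' x))
        + norm (LINT x|M. (f k x - f' x) * g' x) + norm (LINT x|M. f' x * (g k x - g' x))"
      unfolding e e2 e3 by (rule order_trans[OF norm_triangle_ineq]) (simp add: norm_triangle_ineq)
    also have "\<dots> \<le> a k * b k + a k * l2norm M g' + l2norm M f' * b k"
      unfolding a_def b_def by (intro add_mono l2norm_Cauchy_Schwarz df dg assms)
    finally show ?thesis .
  qed
  moreover have "(\<lambda>k. a k * b k + a k * l2norm M g' + l2norm M f' * b k) \<longlonglongrightarrow> 0"
    using a b by (auto intro!: tendsto_eq_intros)
  ultimately have "(\<lambda>k. (LINT x|M. f k x * g k x) - (LINT x|M. f' x * g' x)) \<longlonglongrightarrow> 0"
    by (rule LIMSEQ_zero_bounded[rotated])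
  then show ?thesis by (simp add: LIM_zero_iff)
qed

lemma L2_tendsto_const: "L2_tendsto M (\<lambda>_. u) u"
  by (simp add: L2_tendsto_def)

lemma L2_tendsto_bounded_mult:
  assumes "\<And>k. sq_integrable M (f k)" "sq_integrable M f'" "L2_tendsto M f f'"
    and "s \<in> borel_measurable M" "AE x in M. norm (s x) \<le> B"
  shows "L2_tendsto M (\<lambda>k x. s x * f k x) (\<lambda>x. s x * f' x)"
proof -
  \<comment> \<open>The sign of \<open>B\<close> is unknown, since the almost-everywhere bound is
    void on a null space; \<open>l2norm_bounded_mult\<close> asks for a nonnegative
    constant.\<close>
  have B: "AE x in M. norm (s x) \<le> \<bar>B\<bar>" using assms(5) by auto
  have "l2norm M (\<lambda>x. s x * f k x - s x * f' x) \<le> \<bar>B\<bar> * l2norm M (\<lambda>x. f k x - f' x)" for k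
    using l2norm_bounded_mult[OF sq_integrable_diff[OF assms(1)[of k] assms(2)] assms(4) B]
    by (simp add: right_diff_distrib)
  moreover have "(\<lambda>k. \<bar>B\<bar> * l2norm M (\<lambda>x. f k x - f' x)) \<longlonglongrightarrow> 0"
    using assms(3) unfolding L2_tendsto_iff_l2norm by (auto intro!: tendsto_eq_intros)
  ultimately show ?thesis
    unfolding L2_tendsto_iff_l2norm by (auto intro: LIMSEQ_zero_bounded)
qed

lemma L2_tendsto_l2norm:
  assumes "\<And>k. sq_integrable M (f k)" "sq_integrable M f'" "L2_tendsto M f f'"
  shows "(\<lambda>k. l2norm M (f k)) \<longlonglongrightarrow> l2norm M f'"
proof -
  have "norm (l2norm M (f k) - l2norm M f') \<le> l2norm M (\<lambda>x. f k x - f' x)" for k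
    using l2norm_triangle[OF sq_integrable_diff[OF assms(1)[of k] assms(2)] assms(2)]
      l2norm_triangle[OF sq_integrable_diff[OF assms(2) assms(1)[of k]] assms(1)[of k]]
    by (simp add: l2norm_minus_commute[of M f'])
  then have "(\<lambda>k. l2norm M (f k) - l2norm M f') \<longlonglongrightarrow> 0"
    using assms(3) unfolding L2_tendsto_iff_l2norm by (auto intro: LIMSEQ_zero_bounded)
  then show ?thesis by (simp add: LIM_zero_iff)
qed

lemma L2_tendsto_lincomb:
  assumes "\<And>k. sq_integrable M (f k)" "sq_integrable M f'" "L2_tendsto M f f'"
    and "\<And>k. sq_integrable M (g k)" "sq_integrable M g'" "L2_tendsto M g g'"
  shows "L2_tendsto M (\<lambda>k x. a * f k x + b * g k x) (\<lambda>x. a * f' x + b * g' x)"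
proof -
  have df: "sq_integrable M (\<lambda>x. a * (f k x - f' x))" and dg: "sq_integrable M (\<lambda>x. b * (g k x - g' x))" for k
    using assms sq_integrable_diff sq_integrable_cmult by blast+
  have "l2norm M (\<lambda>x. a * f k x + b * g k x - (a * f' x + b * g' x))
      \<le> norm a * l2norm M (\<lambda>x. f k x - f' x) + norm b * l2norm M (\<lambda>x. g k x - g' x)" for k
    using l2norm_triangle[OF df[of k] dg[of k]] unfolding l2norm_cmult by (simp add: algebra_simps)
  moreover have "(\<lambda>k. norm a * l2norm M (\<lambda>x. f k x - f' x) + norm b * l2norm M (\<lambda>x. g k x - g' x)) \<longlonglongrightarrow> 0"
    using assms(3,6) unfolding L2_tendsto_iff_l2norm by (auto intro!: tendsto_eq_intros)
  ultimately show ?thesis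
    unfolding L2_tendsto_iff_l2norm by (auto intro: LIMSEQ_zero_bounded)
qed

lemma sq_integrable_const: "finite_measure M \<Longrightarrow> sq_integrable M (\<lambda>_. c)"
  by (simp add: sq_integrable_def finite_measure.integrable_const)

lemma sq_integrable_integrable: "finite_measure M \<Longrightarrow> sq_integrable M u \<Longrightarrow> integrable M u"
  using sq_integrable_mult_integrable[of M u "\<lambda>_. 1"] sq_integrable_const by fastforce

text \<open>A Riesz-Fischer argument: on a finite space the L^2 increments are also geometrically
  small in L^1, so the series of increments converges absolutely almost everywhere; Fatou's lemma
  then turns the pointwise limit into an L^2 limit. The geometric rate, which the iteration
  provides, saves the passage to a subsequence.\<close>

lemma l2norm_geometric_complete:
  assumes M: "finite_measure M" and f: "\<And>k. sq_integrable M (f k)"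
    and step: "\<And>k. l2norm M (\<lambda>x. f (Suc k) x - f k x) \<le> C * q ^ k" and q: "0 \<le> q" "q < 1"
  obtains u where "sq_integrable M u" "L2_tendsto M f u"
proof -
  interpret finite_measure M by fact
  have C: "0 \<le> C" using order_trans[OF l2norm_nonneg step[of 0]] by simp
  have meas [measurable]: "f k \<in> borel_measurable M" for k using f by (simp add: sq_integrable_def)
  have df: "sq_integrable M (\<lambda>x. f i x - f j x)" for i j using f sq_integrable_diff by blast
  define K where "K = l2norm M (\<lambda>_. 1)"
  have L1: "(LINT x|M. norm (f (Suc k) x - f k x)) \<le> K * C * q ^ k" for k
  proof -
    have "(LINT x|M. norm (f (Suc k) x - f k x)) \<le> l2norm M (\<lambda>x. f (Suc k) x - f k x) * K"
      using l2norm_Cauchy_Schwarz_norm[OF df sq_integrable_const[OF M, of 1]] by (simp add: K_def)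
    also have "\<dots> \<le> (C * q ^ k) * K" by (intro mult_right_mono step) (simp add: K_def)
    finally show ?thesis by (simp add: mult_ac)
  qed
  have "AE x in M. summable (\<lambda>k. norm (f (Suc k) x - f k x))"
  proof -
    have "(\<Sum>k. \<integral>\<^sup>+x. ennreal (norm (f (Suc k) x - f k x)) \<partial>M) \<le> (\<Sum>k. ennreal (K * C * q ^ k))"
    proof (intro suminf_le)
      fix k
      have "(\<integral>\<^sup>+x. ennreal (norm (f (Suc k) x - f k x)) \<partial>M) = ennreal (LINT x|M. norm (f (Suc k) x - f k x))"
        using sq_integrable_integrable[OF M df] by (intro nn_integral_eq_integral) auto
      also have "\<dots> \<le> ennreal (K * C * q ^ k)" using L1 by (simp add: ennreal_leI)
      finally show "(\<integral>\<^sup>+x. ennreal (norm (f (Suc k) x - f k x)) \<partial>M) \<le> ennreal (K * C * q ^ k)" .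
    qed auto
    also have "\<dots> < \<infinity>"
      using q C by (subst suminf_ennreal2) (auto simp: K_def intro!: summable_mult)
    finally have "(\<integral>\<^sup>+x. (\<Sum>k. ennreal (norm (f (Suc k) x - f k x))) \<partial>M) < \<infinity>"
      by (subst nn_integral_suminf) auto
    then have "AE x in M. (\<Sum>k. ennreal (norm (f (Suc k) x - f k x))) \<noteq> \<infinity>"
      by (intro nn_integral_noteq_infinite) auto
    then show ?thesis
    proof eventually_elim
      case (elim x)
      then show ?case by (intro summable_suminf_not_top) auto
    qed
  qed
  then have AE: "AE x in M. (\<lambda>k. f k x) \<longlonglongrightarrow> lim (\<lambda>k. f k x)"
  proof eventually_elim
    case (elim x)
    then have "summable (\<lambda>k. f (Suc k) x - f k x)" by (rule summable_norm_cancel)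
    then have "convergent (\<lambda>n. \<Sum>k<n. f (Suc k) x - f k x)" by (simp add: summable_iff_convergent)
    then have "convergent (\<lambda>n. f n x - f 0 x)" by (simp add: sum_lessThan_telescope[of "\<lambda>k. f k x"])
    then have "convergent (\<lambda>n. (f n x - f 0 x) + f 0 x)" by (intro convergent_add convergent_const)
    then show ?case by (simp add: convergent_LIMSEQ_iff)
  qed
  \<comment> \<open>\<open>lim\<close> is total, so \<open>u\<close> is defined everywhere and
    measurable; off a null set it is the true limit.\<close>
  define u where "u x = lim (\<lambda>k. f k x)" for x
  have [measurable]: "u \<in> borel_measurable M" unfolding u_def by measurable
  have cauchy: "l2norm M (\<lambda>x. f (k + j) x - f k x) \<le> C * q ^ k / (1 - q)" for k j
  proof -
    have "l2norm M (\<lambda>x. f (k + j) x - f k x) \<le> (\<Sum>i<j. C * q ^ (k + i))"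
    proof (induction j)
      case 0
      then show ?case by (simp add: l2norm_def)
    next
      case (Suc j)
      have "l2norm M (\<lambda>x. f (k + Suc j) x - f k x)
          \<le> l2norm M (\<lambda>x. f (Suc (k + j)) x - f (k + j) x) + l2norm M (\<lambda>x. f (k + j) x - f k x)"
        using l2norm_triangle[OF df[of "Suc (k+j)" "k+j"] df[of "k+j" k]] by simp
      also have "\<dots> \<le> C * q ^ (k + j) + (\<Sum>i<j. C * q ^ (k + i))"
        using step[of "k + j"] Suc by simp
      finally show ?case by simp
    qed
    also have "\<dots> = C * q ^ k * (\<Sum>i<j. q ^ i)" by (simp add: sum_distrib_left power_add mult_ac)
    also have "\<dots> \<le> C * q ^ k * (1 / (1 - q))"
    proof (intro mult_left_mono)
      have "(\<Sum>i<j. q ^ i) = (1 - q ^ j) / (1 - q)" using q by (simp add: sum_gp_strict)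
      also have "\<dots> \<le> 1 / (1 - q)" using q by (intro divide_right_mono) auto
      finally show "(\<Sum>i<j. q ^ i) \<le> 1 / (1 - q)" .
    qed (use C q in auto)
    finally show ?thesis by simp
  qed
  \<comment> \<open>Almost everywhere the integrand is the liminf over \<open>j\<close> of the
    squared distance of \<open>f (k + j)\<close> to \<open>f k\<close>, whose integrals are bounded
    by \<open>cauchy\<close>.\<close>
  have fatou: "(\<integral>\<^sup>+x. ennreal ((norm (u x - f k x))\<^sup>2) \<partial>M) \<le> ennreal ((C * q ^ k / (1 - q))\<^sup>2)" for k
  proof -
    have "(\<integral>\<^sup>+x. ennreal ((norm (u x - f k x))\<^sup>2) \<partial>M)
        = (\<integral>\<^sup>+x. liminf (\<lambda>j. ennreal ((norm (f (k + j) x - f k x))\<^sup>2)) \<partial>M)"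
    proof (rule nn_integral_cong_AE)
      show "AE x in M. ennreal ((norm (u x - f k x))\<^sup>2) = liminf (\<lambda>j. ennreal ((norm (f (k + j) x - f k x))\<^sup>2))"
        using AE
      proof eventually_elim
        case (elim x)
        then have "(\<lambda>j. f (j + k) x) \<longlonglongrightarrow> u x" unfolding u_def by (rule LIMSEQ_ignore_initial_segment)
        then have "(\<lambda>j. ennreal ((norm (f (k + j) x - f k x))\<^sup>2)) \<longlonglongrightarrow> ennreal ((norm (u x - f k x))\<^sup>2)"
          by (auto intro!: tendsto_intros simp: add.commute)
        then show ?case by (rule lim_imp_Liminf[OF trivial_limit_sequentially, symmetric])
      qed
    qed
    also have "\<dots> \<le> liminf (\<lambda>j. \<integral>\<^sup>+x. ennreal ((norm (f (k + j) x - f k x))\<^sup>2) \<partial>M)"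
      by (rule nn_integral_liminf) auto
    also have "\<dots> \<le> liminf (\<lambda>j. ennreal ((C * q ^ k / (1 - q))\<^sup>2))"
    proof (intro Liminf_mono always_eventually allI)
      fix j
      have "(\<integral>\<^sup>+x. ennreal ((norm (f (k + j) x - f k x))\<^sup>2) \<partial>M) = ennreal ((l2norm M (\<lambda>x. f (k + j) x - f k x))\<^sup>2)"
        unfolding l2norm_square by (intro nn_integral_eq_integral sq_integrableD df) auto
      also have "\<dots> \<le> ennreal ((C * q ^ k / (1 - q))\<^sup>2)"
        by (intro ennreal_leI power_mono cauchy) auto
      finally show "(\<integral>\<^sup>+x. ennreal ((norm (f (k + j) x - f k x))\<^sup>2) \<partial>M) \<le> ennreal ((C * q ^ k / (1 - q))\<^sup>2)" .
    qed
    also have "\<dots> = ennreal ((C * q ^ k / (1 - q))\<^sup>2)" by (simp add: Liminf_const)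
    finally show ?thesis .
  qed
  have du: "sq_integrable M (\<lambda>x. u x - f k x)" for k
    unfolding sq_integrable_def
    by (auto intro!: integrableI_bounded order.strict_trans1[OF fatou[of k]])
  have "sq_integrable M u" using sq_integrable_add[OF du[of 0] f[of 0]] by simp
  moreover have "L2_tendsto M f u"
  proof -
    have "l2norm M (\<lambda>x. f k x - u x) \<le> C * q ^ k / (1 - q)" for k
    proof -
      have "ennreal ((l2norm M (\<lambda>x. u x - f k x))\<^sup>2) \<le> ennreal ((C * q ^ k / (1 - q))\<^sup>2)"
        using fatou[of k] unfolding l2norm_square
        by (subst nn_integral_eq_integral[symmetric]) (auto intro: sq_integrableD du)
      then have "(l2norm M (\<lambda>x. u x - f k x))\<^sup>2 \<le> (C * q ^ k / (1 - q))\<^sup>2" by simp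
      then show ?thesis
        unfolding l2norm_minus_commute[of M "f k"]
        by (rule power2_le_imp_le) (use C q in auto)
    qed
    moreover have "(\<lambda>k. C * q ^ k / (1 - q)) \<longlonglongrightarrow> 0"
      using tendsto_divide[OF tendsto_mult[OF tendsto_const[of C] LIMSEQ_realpow_zero[OF q]] tendsto_const[of "1 - q"]] q
      by simp
    ultimately show ?thesis
      unfolding L2_tendsto_iff_l2norm by (auto intro: LIMSEQ_zero_bounded)
  qed
  ultimately show ?thesis by (rule that)
qed

section \<open>Fourier coefficients of continuous periodic functions\<close>

abbreviation CC :: "real measure" where "CC \<equiv> lebesgue_on {-pi..pi}"

abbreviation cint :: "(real \<Rightarrow> complex) \<Rightarrow> complex" where
  "cint h \<equiv> LINT \<theta>|CC. h \<theta>"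

lemma fmode_eq_cis: "fmode n \<theta> = cis (of_int n * \<theta>)"
  by (simp add: fmode_def cis_conv_exp mult_ac)

lemma fmode_0 [simp]: "fmode 0 = (\<lambda>_. 1)"
  by (auto simp: fmode_def)

lemma norm_fmode [simp]: "norm (fmode n \<theta>) = 1"
  by (simp add: fmode_eq_cis)

lemma fmode_mult: "fmode m \<theta> * fmode n \<theta> = fmode (m + n) \<theta>"
  by (simp add: fmode_eq_cis cis_mult algebra_simps)

lemma cnj_fmode [simp]: "cnj (fmode n \<theta>) = fmode (- n) \<theta>"
  by (simp add: fmode_eq_cis cis_cnj)

lemma fmode_periodic: "fmode n (\<theta> + 2 * pi) = fmode n \<theta>"
proof -
  have "fmode n (\<theta> + 2 * pi) = fmode n \<theta> * cis (2 * pi * of_int n)"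
    by (simp add: fmode_eq_cis cis_mult algebra_simps)
  also have "cis (2 * pi * of_int n) = 1" by (rule cis_multiple_2pi) simp
  finally show ?thesis by simp
qed

lemma fmode_has_vector_derivative:
  "(fmode n has_vector_derivative (\<i> * of_int n * fmode n \<theta>)) (at \<theta> within S)"
proof -
  have "((\<lambda>\<theta>. exp (\<i> * of_int n * of_real \<theta>)) has_vector_derivative
      exp (\<i> * of_int n * of_real \<theta>) * (\<i> * of_int n)) (at \<theta> within S)"
    by (rule has_vector_derivative_real_field[where f = "\<lambda>z. exp (\<i> * of_int n * z)"])
      (auto intro!: derivative_eq_intros)
  then show ?thesis by (simp add: fmode_def[abs_def] mult_ac)
qed

lemma continuous_on_fmode [continuous_intros]: "continuous_on S (fmode n)"
  unfolding fmode_def[abs_def] by (intro continuous_intros)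

lemma cint_integrable:
  fixes h :: "real \<Rightarrow> 'a::euclidean_space"
  shows "continuous_on UNIV h \<Longrightarrow> integrable CC h"
  by (rule continuous_imp_integrable_real) (rule continuous_on_subset, auto)

lemma finite_measure_circle: "finite_measure CC"
  by (rule finite_measure_lebesgue_on) simp

lemma measure_circle [simp]: "measure CC {-pi..pi} = 2 * pi"
  by (simp add: measure_restrict_space)

lemma cint_derivative_periodic:
  assumes "\<And>\<theta>. (F has_vector_derivative f \<theta>) (at \<theta>)" and "continuous_on UNIV f"
    and "\<And>\<theta>. F (\<theta> + 2 * pi) = F \<theta>"
  shows "cint f = 0"
proof -
  have "(f has_integral (F pi - F (- pi))) {-pi..pi}"
    by (rule fundamental_theorem_of_calculus) (auto intro: assms has_vector_derivative_at_within)
  moreover have "F pi = F (- pi)" using assms(3)[of "- pi"] by simp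
  ultimately show ?thesis
    using lebesgue_integral_eq_integral[OF cint_integrable[OF assms(2)]] by (auto simp: integral_unique)
qed

lemma cint_fmode: "cint (fmode n) = (if n = 0 then 2 * pi else 0)"
proof (cases "n = 0")
  case False
  have "cint (\<lambda>\<theta>. \<i> * of_int n * fmode n \<theta>) = 0"
    by (rule cint_derivative_periodic[OF fmode_has_vector_derivative])
      (auto intro!: continuous_intros simp: fmode_periodic)
  then show ?thesis using False by simp
qed (simp add: scaleR_conv_of_real)

lemma cint_fmode_mult: "cint (\<lambda>\<theta>. fmode m \<theta> * fmode n \<theta>) = (if m = - n then 2 * pi else 0)"
proof -
  have "cint (\<lambda>\<theta>. fmode m \<theta> * fmode n \<theta>) = cint (fmode (m + n))" by (simp add: fmode_mult)
  then show ?thesis by (auto simp: cint_fmode)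
qed

section \<open>Continuous periodic functions and the density of trigonometric polynomials\<close>

lemma periodic_representative:
  fixes \<theta> :: real
  assumes "\<And>\<theta>. f (\<theta> + 2 * pi) = f \<theta>"
  obtains \<theta>' where "\<theta>' \<in> {-pi..pi}" "f \<theta> = f \<theta>'"
proof -
  interpret periodic_fun_simple f "2 * pi" by standard (rule assms)
  define k where "k = \<lfloor>(\<theta> + pi) / (2 * pi)\<rfloor>"
  have "of_int k \<le> (\<theta> + pi) / (2 * pi)" "(\<theta> + pi) / (2 * pi) < of_int k + 1"
    unfolding k_def by linarith+
  then have "\<theta> - of_int k * (2 * pi) \<in> {-pi..pi}"
    using pi_gt_zero by (auto simp: field_simps)
  moreover have "f \<theta> = f (\<theta> - of_int k * (2 * pi))" by (simp add: minus_of_int)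
  ultimately show ?thesis by (rule that)
qed

lemma periodic_continuous_bounded:
  fixes f :: "real \<Rightarrow> complex"
  assumes "\<And>\<theta>. f (\<theta> + 2 * pi) = f \<theta>" "continuous_on UNIV f"
  obtains B where "B > 0" "\<And>\<theta>. norm (f \<theta>) \<le> B"
proof -
  have "bounded (f ` {-pi..pi})"
    by (intro compact_imp_bounded compact_continuous_image continuous_on_subset[OF assms(2)]) auto
  then obtain B where B: "B > 0" "\<And>\<theta>. \<theta> \<in> {-pi..pi} \<Longrightarrow> norm (f \<theta>) \<le> B"
    unfolding bounded_pos by auto
  have "norm (f \<theta>) \<le> B" for \<theta>
    using periodic_representative[of f \<theta>, OF assms(1)] B(2) by metis
  with B(1) show ?thesis by (rule that)
qed

text \<open>The inductive form makes closure under products an induction over generators, with no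
  bookkeeping of index sets and coefficients.\<close>

inductive_set trigpoly :: "(real \<Rightarrow> complex) set" where
  mode: "(\<lambda>\<theta>. c * fmode n \<theta>) \<in> trigpoly"
| add: "p \<in> trigpoly \<Longrightarrow> q \<in> trigpoly \<Longrightarrow> (\<lambda>\<theta>. p \<theta> + q \<theta>) \<in> trigpoly"

lemma trigpoly_const: "(\<lambda>_. c) \<in> trigpoly"
  using trigpoly.mode[of c 0] by simp

lemma trigpoly_mode_mult:
  assumes "p \<in> trigpoly"
  shows "(\<lambda>\<theta>. c * fmode n \<theta> * p \<theta>) \<in> trigpoly"
  using assms
proof induction
  case (mode d m)
  have "(\<lambda>\<theta>. c * d * fmode (n + m) \<theta>) \<in> trigpoly" by (rule trigpoly.mode)
  then show ?case by (simp add: fmode_mult[symmetric] mult_ac)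
next
  case (add p q)
  then show ?case using trigpoly.add[OF add.IH] by (simp add: distrib_left)
qed

lemma trigpoly_mult:
  assumes "p \<in> trigpoly" "q \<in> trigpoly"
  shows "(\<lambda>\<theta>. p \<theta> * q \<theta>) \<in> trigpoly"
  using assms(1)
proof induction
  case (mode d m)
  then show ?case by (rule trigpoly_mode_mult[OF assms(2)])
next
  case (add p' q')
  then show ?case using trigpoly.add[OF add.IH] by (simp add: distrib_right)
qed

lemma trigpoly_continuous: "p \<in> trigpoly \<Longrightarrow> continuous_on UNIV p"
  by (induction rule: trigpoly.induct) (auto intro!: continuous_intros)

lemma trigpoly_cos_sin: "(\<lambda>\<theta>. of_real (cos \<theta>)) \<in> trigpoly" "(\<lambda>\<theta>. of_real (sin \<theta>)) \<in> trigpoly"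
proof -
  have "(\<lambda>\<theta>. (1/2) * fmode 1 \<theta> + (1/2) * fmode (-1) \<theta>) \<in> trigpoly"
    by (intro trigpoly.intros)
  moreover have "(1/2) * fmode 1 \<theta> + (1/2) * fmode (-1) \<theta> = of_real (cos \<theta>)" for \<theta>
    by (simp add: fmode_eq_cis complex_eq_iff)
  ultimately show "(\<lambda>\<theta>. of_real (cos \<theta>)) \<in> trigpoly" by simp
  have "(\<lambda>\<theta>. (-\<i>/2) * fmode 1 \<theta> + (\<i>/2) * fmode (-1) \<theta>) \<in> trigpoly"
    by (intro trigpoly.intros)
  moreover have "(-\<i>/2) * fmode 1 \<theta> + (\<i>/2) * fmode (-1) \<theta> = of_real (sin \<theta>)" for \<theta>
    by (simp add: fmode_eq_cis complex_eq_iff)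
  ultimately show "(\<lambda>\<theta>. of_real (sin \<theta>)) \<in> trigpoly" by simp
qed

text \<open>On the circle a real-linear functional of the plane is a combination of
  \<open>cos\<close> and \<open>sin\<close>, so polynomials restricted to it are trigonometric. This
  lets the Stone-Weierstrass theorem in the plane be used on the circle.\<close>

lemma trigpoly_real_polynomial:
  fixes g :: "complex \<Rightarrow> real"
  assumes "real_polynomial_function g"
  shows "(\<lambda>\<theta>. of_real (g (cis \<theta>))) \<in> trigpoly"
  using assms
proof induction
  case (linear f)
  interpret bounded_linear f by fact
  have "f (cis \<theta>) = cos \<theta> * f 1 + sin \<theta> * f \<i>" for \<theta>
  proof -
    have "cis \<theta> = cos \<theta> *\<^sub>R 1 + sin \<theta> *\<^sub>R \<i>" by (simp add: complex_eq_iff)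
    then show ?thesis by (simp add: add scaleR)
  qed
  moreover have "(\<lambda>\<theta>. of_real (cos \<theta>) * of_real (f 1) + of_real (sin \<theta>) * of_real (f \<i>)) \<in> trigpoly"
    by (intro trigpoly.add trigpoly_mult trigpoly_cos_sin trigpoly_const)
  ultimately show ?case by simp
qed (auto intro: trigpoly_const trigpoly_mult trigpoly.add)

lemma trigpoly_dense_real:
  fixes g :: "real \<Rightarrow> real"
  assumes g: "\<And>\<theta>. g (\<theta> + 2 * pi) = g \<theta>" "continuous_on UNIV g" and e: "e > 0"
  obtains p where "p \<in> trigpoly" "\<And>\<theta>. \<theta> \<in> {-pi..pi} \<Longrightarrow> norm (of_real (g \<theta>) - p \<theta>) < e"
proof -
  have cisArg: "cis (Arg z) = z" if "z \<in> sphere 0 1" for z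
    using that cis_Arg[of z] by (cases "z = 0") (auto simp: sgn_div_norm)
  \<comment> \<open>\<open>Arg\<close> takes values in (-pi, pi], so the endpoint
    \<open>- pi\<close> comes back as \<open>pi\<close>; periodicity repairs this.\<close>
  have gArg: "g (Arg (cis \<theta>)) = g \<theta>" if "\<theta> \<in> {-pi..pi}" for \<theta>
  proof (cases "\<theta> = - pi")
    case True
    then have "Arg (cis \<theta>) = pi" by (intro cis_Arg_unique) (auto simp: sgn_div_norm complex_eq_iff)
    then show ?thesis using g(1)[of "- pi"] True by simp
  next
    case False
    then have "Arg (cis \<theta>) = \<theta>" using that by (intro cis_Arg_unique) (auto simp: sgn_div_norm)
    then show ?thesis by simp
  qed
  \<comment> \<open>\<open>Arg\<close> jumps at -1, so continuity is shown through closed sets: the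
    preimage of a closed set is the \<open>cis\<close>-image of a compact subset of
    [-pi, pi].\<close>
  have "continuous_on (sphere 0 1) (\<lambda>z. g (Arg z))"
    unfolding continuous_on_closed_vimage[OF closed_sphere]
  proof (intro allI impI)
    fix B :: "real set" assume "closed B"
    then have "closed (g -` B)" using g(2) by (intro continuous_closed_vimage) (auto simp: continuous_on_eq_continuous_at)
    then have "compact (cis ` (g -` B \<inter> {-pi..pi}))"
      by (intro compact_continuous_image closed_Int_compact) (auto intro!: continuous_intros)
    moreover have "(\<lambda>z. g (Arg z)) -` B \<inter> sphere 0 1 = cis ` (g -` B \<inter> {-pi..pi})"
    proof (intro equalityI subsetI)
      fix z assume z: "z \<in> (\<lambda>z. g (Arg z)) -` B \<inter> sphere 0 1"
      then have "z = cis (Arg z)" "Arg z \<in> g -` B \<inter> {-pi..pi}"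
        using cisArg[of z] Arg_bounded[of z] by auto
      then show "z \<in> cis ` (g -` B \<inter> {-pi..pi})" by blast
    qed (auto simp: gArg)
    ultimately show "closed ((\<lambda>z. g (Arg z)) -` B \<inter> sphere 0 1)" by (simp add: compact_imp_closed)
  qed
  then obtain r where r: "real_polynomial_function r" "\<And>z. z \<in> sphere 0 1 \<Longrightarrow> \<bar>g (Arg z) - r z\<bar> < e"
    using Stone_Weierstrass_real_polynomial_function[OF compact_sphere _ e] by blast
  have "norm (of_real (g \<theta>) - complex_of_real (r (cis \<theta>))) < e" if "\<theta> \<in> {-pi..pi}" for \<theta>
    using r(2)[of "cis \<theta>"] gArg[OF that] unfolding of_real_diff[symmetric] norm_of_real by auto
  then show ?thesis using that trigpoly_real_polynomial[OF r(1)] by blast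
qed

text \<open>Orthogonality to all modes extends to trigonometric polynomials; approximating the
  conjugate of \<open>g\<close> uniformly by them makes the integral of its squared modulus
  arbitrarily small.\<close>

lemma periodic_function_zero:
  fixes g :: "real \<Rightarrow> complex"
  assumes g: "\<And>\<theta>. g (\<theta> + 2 * pi) = g \<theta>" "continuous_on UNIV g"
    and z: "\<And>n. cint (\<lambda>\<theta>. g \<theta> * fmode n \<theta>) = 0"
  shows "g \<theta> = 0"
proof -
  have p0: "cint (\<lambda>\<theta>. g \<theta> * p \<theta>) = 0" if "p \<in> trigpoly" for p
    using that
  proof induction
    case (mode c n)
    have "cint (\<lambda>\<theta>. c * (g \<theta> * fmode n \<theta>)) = 0" using z by simp
    then show ?case by (simp add: mult_ac)
  next
    case (add p q)
    have "integrable CC (\<lambda>\<theta>. g \<theta> * p \<theta>)" "integrable CC (\<lambda>\<theta>. g \<theta> * q \<theta>)"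
      using add.hyps trigpoly_continuous by (auto intro!: cint_integrable continuous_intros g)
    then show ?case using add.IH by (simp add: distrib_left)
  qed
  obtain B where B: "B > 0" "\<And>\<theta>. norm (g \<theta>) \<le> B" using periodic_continuous_bounded[OF g] by blast
  define K where "K = (LINT \<theta>|CC. (norm (g \<theta>))\<^sup>2)"
  have "K \<le> e" if e: "e > 0" for e
  proof -
    \<comment> \<open>Real and imaginary parts are each approximated within \<open>d\<close>, and
      the circle has length \<open>2 * pi\<close>, so the final bound
      \<open>2 * pi * B * (2 * d)\<close> equals \<open>e\<close>.\<close>
    define d where "d = e / (4 * pi * B)"
    have d: "d > 0" using e B by (simp add: d_def)
    obtain p1 where p1: "p1 \<in> trigpoly" "\<And>\<theta>. \<theta> \<in> {-pi..pi} \<Longrightarrow> norm (of_real (Re (g \<theta>)) - p1 \<theta>) < d"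
      using trigpoly_dense_real[of "\<lambda>\<theta>. Re (g \<theta>)" d] g d by (auto intro!: continuous_intros)
    obtain p2 where p2: "p2 \<in> trigpoly" "\<And>\<theta>. \<theta> \<in> {-pi..pi} \<Longrightarrow> norm (of_real (Im (g \<theta>)) - p2 \<theta>) < d"
      using trigpoly_dense_real[of "\<lambda>\<theta>. Im (g \<theta>)" d] g d by (auto intro!: continuous_intros)
    define p where "p \<theta> = p1 \<theta> + (- \<i>) * p2 \<theta>" for \<theta>
    have p: "p \<in> trigpoly"
      unfolding p_def[abs_def] using p1 p2 by (intro trigpoly.add trigpoly_mult trigpoly_const)
    have near: "norm (cnj (g \<theta>) - p \<theta>) \<le> 2 * d" if "\<theta> \<in> {-pi..pi}" for \<theta>
    proof -
      have "cnj (g \<theta>) - p \<theta> = (of_real (Re (g \<theta>)) - p1 \<theta>) + (- \<i>) * (of_real (Im (g \<theta>)) - p2 \<theta>)"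
        by (simp add: p_def algebra_simps complex_eq_iff)
      also have "norm \<dots> \<le> norm (of_real (Re (g \<theta>)) - p1 \<theta>) + norm ((- \<i>) * (of_real (Im (g \<theta>)) - p2 \<theta>))"
        by (rule norm_triangle_ineq)
      also have "\<dots> \<le> d + d"
        using p1(2)[OF that] p2(2)[OF that] by (simp add: norm_mult)
      finally show ?thesis by simp
    qed
    have ic: "continuous_on UNIV (\<lambda>\<theta>. g \<theta> * (cnj (g \<theta>) - p \<theta>))"
      "continuous_on UNIV (\<lambda>\<theta>. g \<theta> * cnj (g \<theta>))" "continuous_on UNIV (\<lambda>\<theta>. g \<theta> * p \<theta>)"
      using trigpoly_continuous[OF p] by (auto intro!: continuous_intros g)
    have "of_real K = cint (\<lambda>\<theta>. g \<theta> * cnj (g \<theta>))"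
      unfolding K_def integral_complex_of_real[symmetric] complex_norm_square ..
    also have "\<dots> = cint (\<lambda>\<theta>. g \<theta> * (cnj (g \<theta>) - p \<theta>))"
      using p0[OF p] cint_integrable[OF ic(2)] cint_integrable[OF ic(3)] by (simp add: right_diff_distrib)
    finally have "norm (complex_of_real K) = norm (cint (\<lambda>\<theta>. g \<theta> * (cnj (g \<theta>) - p \<theta>)))" by simp
    also have "\<dots> \<le> (LINT \<theta>|CC. norm (g \<theta> * (cnj (g \<theta>) - p \<theta>)))" by simp
    also have "\<dots> \<le> (LINT \<theta>|CC. B * (2 * d))"
      using B near by (intro integral_mono integrable_norm cint_integrable ic)
        (auto simp: norm_mult intro!: mult_mono continuous_intros)
    also have "\<dots> = e" using B by (simp add: d_def)
    finally show ?thesis by (simp add: K_def)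
  qed
  then have "K \<le> 0" by (rule field_le_epsilon[of K 0, simplified])
  then have "K = 0" by (simp add: K_def antisym)
  moreover have "continuous_on {-pi..pi} (\<lambda>\<theta>. (norm (g \<theta>))\<^sup>2)"
    by (intro continuous_intros continuous_on_subset[OF g(2)]) simp
  ultimately have 0: "g \<theta> = 0" if "\<theta> \<in> {-pi..pi}" for \<theta>
    using integralL_eq_0_iff[of "-pi" pi "\<lambda>\<theta>. (norm (g \<theta>))\<^sup>2"] that unfolding K_def by simp
  show ?thesis using periodic_representative[of g \<theta>, OF g(1)] 0 by metis
qed

subsection \<open>Absolutely convergent Fourier series\<close>

lemma infsum_tail_tendsto_0:
  fixes a :: "'a \<Rightarrow> real"
  assumes "a summable_on UNIV"
  shows "((\<lambda>F. infsum a (- F)) \<longlongrightarrow> 0) (finite_subsets_at_top UNIV)"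
proof -
  have "((\<lambda>F. infsum a UNIV - sum a F) \<longlongrightarrow> infsum a UNIV - infsum a UNIV) (finite_subsets_at_top UNIV)"
    by (intro tendsto_intros infsum_tendsto assms)
  moreover have "\<forall>\<^sub>F F in finite_subsets_at_top UNIV. infsum a UNIV - sum a F = infsum a (- F)"
  proof (rule eventually_finite_subsets_at_top_weakI)
    fix F :: "'a set" assume "finite F"
    then have "infsum a UNIV = infsum a F + infsum a (- F)"
      using infsum_Un_disjoint[of a F "- F"] assms summable_on_subset[OF assms] by (simp add: Compl_partition)
    then show "infsum a UNIV - sum a F = infsum a (- F)" using \<open>finite F\<close> by simp
  qed
  ultimately show ?thesis by (simp add: filterlim_cong)
qed

definition fseries :: "(int \<Rightarrow> complex) \<Rightarrow> real \<Rightarrow> complex" where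
  "fseries c \<theta> = (\<Sum>\<^sub>\<infinity>n. c n * fmode n \<theta>)"

context
  fixes c :: "int \<Rightarrow> complex"
  assumes c: "(\<lambda>n. norm (c n)) summable_on UNIV"
begin

lemma fseries_has_sum: "((\<lambda>n. c n * fmode n \<theta>) has_sum fseries c \<theta>) UNIV"
proof -
  have "(\<lambda>n. norm (c n * fmode n \<theta>)) summable_on UNIV" using c by (simp add: norm_mult)
  then show ?thesis unfolding fseries_def by (intro has_sum_infsum) (rule abs_summable_summable)
qed

lemma fseries_periodic: "fseries c (\<theta> + 2 * pi) = fseries c \<theta>"
  by (simp add: fseries_def fmode_periodic)

lemma continuous_on_fseries: "continuous_on UNIV (fseries c)"
proof (rule uniform_limit_theorem)
  show "uniform_limit UNIV (\<lambda>F \<theta>. \<Sum>n\<in>F. c n * fmode n \<theta>) (fseries c) (finite_subsets_at_top UNIV)"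
    unfolding fseries_def[abs_def]
    by (rule Weierstrass_m_test_general[where M = "\<lambda>n. norm (c n)"]) (use c in \<open>auto simp: norm_mult\<close>)
qed (auto intro!: always_eventually continuous_intros)

lemma norm_fseries_diff_le:
  assumes "finite F"
  shows "norm (fseries c \<theta> - (\<Sum>n\<in>F. c n * fmode n \<theta>)) \<le> (\<Sum>\<^sub>\<infinity>n\<in>-F. norm (c n))"
proof -
  have s: "(\<lambda>n. c n * fmode n \<theta>) summable_on A" for A
    using fseries_has_sum has_sum_imp_summable summable_on_subset_banach subset_UNIV by metis
  have "fseries c \<theta> = infsum (\<lambda>n. c n * fmode n \<theta>) F + infsum (\<lambda>n. c n * fmode n \<theta>) (- F)"
    using infsum_Un_disjoint[of "\<lambda>n. c n * fmode n \<theta>" F "- F"] s by (simp add: Compl_partition fseries_def)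
  then have "fseries c \<theta> - (\<Sum>n\<in>F. c n * fmode n \<theta>) = infsum (\<lambda>n. c n * fmode n \<theta>) (- F)"
    using assms by simp
  also have "norm \<dots> \<le> (\<Sum>\<^sub>\<infinity>n\<in>-F. norm (c n * fmode n \<theta>))"
    using summable_on_subset[OF c] by (intro norm_infsum_bound) (simp add: norm_mult)
  finally show ?thesis by (simp add: norm_mult)
qed

text \<open>Finite partial sums differ from the series uniformly by at most the tail of the
  coefficients, which justifies integrating term by term along the net of finite sets.\<close>

lemma cint_fseries_mult_has_sum:
  assumes "continuous_on UNIV \<psi>"
  shows "((\<lambda>n. c n * cint (\<lambda>\<theta>. fmode n \<theta> * \<psi> \<theta>)) has_sum cint (\<lambda>\<theta>. fseries c \<theta> * \<psi> \<theta>)) UNIV"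
proof -
  define K where "K = (LINT \<theta>|CC. norm (\<psi> \<theta>))"
  have i\<psi>: "integrable CC (\<lambda>\<theta>. norm (\<psi> \<theta>))"
    by (intro cint_integrable continuous_intros assms)
  have "norm ((\<Sum>n\<in>F. c n * cint (\<lambda>\<theta>. fmode n \<theta> * \<psi> \<theta>)) - cint (\<lambda>\<theta>. fseries c \<theta> * \<psi> \<theta>))
      \<le> (\<Sum>\<^sub>\<infinity>n\<in>-F. norm (c n)) * K" if F: "finite F" for F
  proof -
    have i: "integrable CC (\<lambda>\<theta>. fmode n \<theta> * \<psi> \<theta>)" for n
      by (intro cint_integrable continuous_intros assms)
    have cf: "continuous_on UNIV (\<lambda>\<theta>. (fseries c \<theta> - (\<Sum>n\<in>F. c n * fmode n \<theta>)) * \<psi> \<theta>)"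
      by (intro continuous_intros assms continuous_on_fseries)
    have i1: "integrable CC (\<lambda>\<theta>. fseries c \<theta> * \<psi> \<theta>)"
      by (intro cint_integrable continuous_intros assms continuous_on_fseries)
    have "cint (\<lambda>\<theta>. fseries c \<theta> * \<psi> \<theta>) - (\<Sum>n\<in>F. c n * cint (\<lambda>\<theta>. fmode n \<theta> * \<psi> \<theta>))
        = cint (\<lambda>\<theta>. fseries c \<theta> * \<psi> \<theta>) - cint (\<lambda>\<theta>. \<Sum>n\<in>F. c n * (fmode n \<theta> * \<psi> \<theta>))"
      using i by (subst Bochner_Integration.integral_sum) auto
    also have "\<dots> = cint (\<lambda>\<theta>. fseries c \<theta> * \<psi> \<theta> - (\<Sum>n\<in>F. c n * (fmode n \<theta> * \<psi> \<theta>)))"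
      using i i1 by (subst Bochner_Integration.integral_diff) auto
    also have "\<dots> = cint (\<lambda>\<theta>. (fseries c \<theta> - (\<Sum>n\<in>F. c n * fmode n \<theta>)) * \<psi> \<theta>)"
      by (simp add: left_diff_distrib sum_distrib_right mult.assoc)
    finally have "norm (cint (\<lambda>\<theta>. fseries c \<theta> * \<psi> \<theta>) - (\<Sum>n\<in>F. c n * cint (\<lambda>\<theta>. fmode n \<theta> * \<psi> \<theta>)))
        \<le> (LINT \<theta>|CC. norm ((fseries c \<theta> - (\<Sum>n\<in>F. c n * fmode n \<theta>)) * \<psi> \<theta>))"
      by simp
    also have "\<dots> \<le> (LINT \<theta>|CC. (\<Sum>\<^sub>\<infinity>n\<in>-F. norm (c n)) * norm (\<psi> \<theta>))"
      using norm_fseries_diff_le[OF F] i\<psi> cint_integrable[OF assms]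
      by (intro integral_mono integrable_norm cint_integrable[OF cf] integrable_mult_right)
        (auto simp: norm_mult intro!: mult_right_mono)
    also have "\<dots> = (\<Sum>\<^sub>\<infinity>n\<in>-F. norm (c n)) * K" by (simp add: K_def)
    finally show ?thesis by (simp add: norm_minus_commute)
  qed
  moreover have "((\<lambda>F. (\<Sum>\<^sub>\<infinity>n\<in>-F. norm (c n)) * K) \<longlongrightarrow> 0) (finite_subsets_at_top UNIV)"
    using tendsto_mult_right[OF infsum_tail_tendsto_0[OF c], of K] by simp
  ultimately have "((\<lambda>F. (\<Sum>n\<in>F. c n * cint (\<lambda>\<theta>. fmode n \<theta> * \<psi> \<theta>)) - cint (\<lambda>\<theta>. fseries c \<theta> * \<psi> \<theta>)) \<longlongrightarrow> 0)
      (finite_subsets_at_top UNIV)"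
    by (rule Lim_null_comparison[OF eventually_finite_subsets_at_top_weakI])
  then show ?thesis unfolding has_sum_def using LIM_zero_cancel by blast
qed

lemma cint_fseries_fmode: "cint (\<lambda>\<theta>. fseries c \<theta> * fmode (- n) \<theta>) = 2 * pi * c n"
proof -
  have "((\<lambda>m. c m * cint (\<lambda>\<theta>. fmode m \<theta> * fmode (- n) \<theta>)) has_sum 2 * pi * c n) UNIV"
    by (rule has_sum_finite_neutralI[of "{n}"]) (auto simp: cint_fmode_mult)
  then show ?thesis
    using cint_fseries_mult_has_sum[OF continuous_on_fmode] has_sum_unique by blast
qed

end

text \<open>Both sides have the same Fourier coefficients, so their difference vanishes by
  \<open>periodic_function_zero\<close>; no summation kernel enters.\<close>

lemma fourier_series_eq:
  assumes h: "continuous_on UNIV h" "\<And>\<theta>. h (\<theta> + 2 * pi) = h \<theta>"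
    and c: "\<And>n. c n = cint (\<lambda>\<theta>. h \<theta> * fmode (- n) \<theta>) / (2 * pi)"
    and s: "(\<lambda>n. norm (c n)) summable_on UNIV"
  shows "fseries c = h"
proof
  fix \<theta>
  have "fseries c \<theta> - h \<theta> = 0"
  proof (rule periodic_function_zero)
    show "continuous_on UNIV (\<lambda>\<theta>. fseries c \<theta> - h \<theta>)"
      by (intro continuous_intros continuous_on_fseries s h)
    show "fseries c (\<theta> + 2 * pi) - h (\<theta> + 2 * pi) = fseries c \<theta> - h \<theta>" for \<theta>
      by (simp add: fseries_periodic[OF s] h)
    fix n
    have "integrable CC (\<lambda>\<theta>. fseries c \<theta> * fmode n \<theta>)"
      "integrable CC (\<lambda>\<theta>. h \<theta> * fmode n \<theta>)"
      by (intro cint_integrable continuous_intros continuous_on_fseries s h)+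
    then show "cint (\<lambda>\<theta>. (fseries c \<theta> - h \<theta>) * fmode n \<theta>) = 0"
      using cint_fseries_fmode[OF s, of "- n"] c[of "- n"] by (simp add: left_diff_distrib)
  qed
  then show "fseries c \<theta> = h \<theta>" by simp
qed

section \<open>Periodic test functions and distributions\<close>

abbreviation vder :: "nat \<Rightarrow> (real \<Rightarrow> complex) \<Rightarrow> real \<Rightarrow> complex" where
  "vder k \<phi> \<equiv> ((\<lambda>h t. vector_derivative h (at t)) ^^ k) \<phi>"

lemma per_test_periodic: "\<phi> \<in> per_test \<Longrightarrow> \<phi> (\<theta> + 2 * pi) = \<phi> \<theta>"
  by (simp add: per_test_def)

lemma vder_has_vector_derivative:
  "\<phi> \<in> per_test \<Longrightarrow> (vder k \<phi> has_vector_derivative vder (Suc k) \<phi> \<theta>) (at \<theta>)"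
  by (simp add: per_test_def vector_derivative_works)

lemma continuous_on_vder: "\<phi> \<in> per_test \<Longrightarrow> continuous_on S (vder k \<phi>)"
  using vder_has_vector_derivative
  by (metis continuous_at_imp_continuous_on has_vector_derivative_continuous)

lemma per_test_continuous: "\<phi> \<in> per_test \<Longrightarrow> continuous_on S \<phi>"
  using continuous_on_vder[of \<phi> S 0] by simp

text \<open>Iterated \<open>vector_derivative\<close> is awkward to unfold; an explicit family of
  successive derivatives fixes all of it and, through \<open>per_testI\<close>, also yields
  membership in \<open>per_test\<close>.\<close>

lemma vder_unique:
  assumes "\<And>k \<theta>. (D k has_vector_derivative D (Suc k) \<theta>) (at \<theta>)"
  shows "vder k (D 0) = D k"
proof (induction k)
  case (Suc k)
  have "vector_derivative (D k) (at \<theta>) = D (Suc k) \<theta>" for \<theta>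
    by (rule vector_derivative_at) (rule assms)
  then show ?case using Suc by simp
qed simp

lemma per_testI:
  assumes "\<And>\<theta>. D 0 (\<theta> + 2 * pi) = D 0 \<theta>"
    and "\<And>k \<theta>. (D k has_vector_derivative D (Suc k) \<theta>) (at \<theta>)"
  shows "D 0 \<in> per_test"
  unfolding per_test_def mem_Collect_eq vder_unique[of D, OF assms(2)]
  using assms differentiableI_vector by blast

lemma vder_Suc_shift: "vder k (\<lambda>t. vector_derivative \<phi> (at t)) = vder (Suc k) \<phi>"
  by (simp add: funpow_Suc_right del: funpow.simps)

lemma per_test_deriv:
  assumes "\<phi> \<in> per_test"
  shows "(\<lambda>t. vector_derivative \<phi> (at t)) \<in> per_test"
proof -
  have d: "(\<phi> has_vector_derivative vector_derivative \<phi> (at \<theta>)) (at \<theta>)" for \<theta>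
    using vder_has_vector_derivative[OF assms, of 0] by simp
  have "vector_derivative \<phi> (at (\<theta> + 2 * pi)) = vector_derivative \<phi> (at \<theta>)" for \<theta>
  proof -
    have "(\<phi> \<circ> (\<lambda>\<theta>. \<theta> + 2 * pi) has_vector_derivative 1 *\<^sub>R vector_derivative \<phi> (at (\<theta> + 2 * pi))) (at \<theta>)"
      by (rule vector_diff_chain_at) (auto intro!: derivative_eq_intros d)
    moreover have "\<phi> \<circ> (\<lambda>\<theta>. \<theta> + 2 * pi) = \<phi>" by (auto simp: per_test_periodic[OF assms])
    ultimately show ?thesis using vector_derivative_at by fastforce
  qed
  moreover have "vder k (\<lambda>t. vector_derivative \<phi> (at t)) differentiable (at \<theta>)" for k \<theta>
    unfolding vder_Suc_shift using assms by (simp add: per_test_def del: funpow.simps)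
  ultimately show ?thesis by (simp add: per_test_def)
qed

lemma per_test_vder: "\<phi> \<in> per_test \<Longrightarrow> vder k \<phi> \<in> per_test"
  by (induction k) (auto intro: per_test_deriv)

lemma
  assumes "\<phi> \<in> per_test" "\<psi> \<in> per_test"
  shows vder_lincomb: "vder k (\<lambda>\<theta>. a * \<phi> \<theta> + b * \<psi> \<theta>) = (\<lambda>\<theta>. a * vder k \<phi> \<theta> + b * vder k \<psi> \<theta>)"
    and per_test_lincomb: "(\<lambda>\<theta>. a * \<phi> \<theta> + b * \<psi> \<theta>) \<in> per_test"
proof -
  define D where "D k = (\<lambda>\<theta>. a * vder k \<phi> \<theta> + b * vder k \<psi> \<theta>)" for k
  have D: "(D k has_vector_derivative D (Suc k) \<theta>) (at \<theta>)" for k \<theta>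
    unfolding D_def
    by (intro has_vector_derivative_add has_vector_derivative_mult_right vder_has_vector_derivative assms)
  show "vder k (\<lambda>\<theta>. a * \<phi> \<theta> + b * \<psi> \<theta>) = (\<lambda>\<theta>. a * vder k \<phi> \<theta> + b * vder k \<psi> \<theta>)"
    using vder_unique[of D k, OF D] by (simp add: D_def)
  show "(\<lambda>\<theta>. a * \<phi> \<theta> + b * \<psi> \<theta>) \<in> per_test"
    using per_testI[of D, OF _ D] assms by (simp add: D_def per_test_periodic)
qed

lemma
  shows vder_fmode: "vder k (fmode n) = (\<lambda>\<theta>. (\<i> * of_int n) ^ k * fmode n \<theta>)"
    and fmode_in_per_test: "fmode n \<in> per_test"
proof -
  define D where "D k = (\<lambda>\<theta>. (\<i> * of_int n) ^ k * fmode n \<theta>)" for k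
  have D: "(D k has_vector_derivative D (Suc k) \<theta>) (at \<theta>)" for k \<theta>
    using has_vector_derivative_mult_right[OF fmode_has_vector_derivative, of "(\<i> * of_int n) ^ k" n \<theta> UNIV]
    by (simp add: D_def mult_ac)
  show "vder k (fmode n) = (\<lambda>\<theta>. (\<i> * of_int n) ^ k * fmode n \<theta>)"
    using vder_unique[of D k, OF D] by (simp add: D_def)
  show "fmode n \<in> per_test"
    using per_testI[of D, OF _ D] by (simp add: D_def fmode_periodic)
qed

lemma per_test_const: "(\<lambda>_. c) \<in> per_test"
  using per_test_lincomb[OF fmode_in_per_test[of 0] fmode_in_per_test[of 0], of c 0] by simp

lemma
  assumes "finite F"
  shows vder_trig_sum: "vder k (\<lambda>\<theta>. \<Sum>n\<in>F. c n * fmode n \<theta>) = (\<lambda>\<theta>. \<Sum>n\<in>F. (\<i> * of_int n) ^ k * c n * fmode n \<theta>)"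
    and per_test_trig_sum: "(\<lambda>\<theta>. \<Sum>n\<in>F. c n * fmode n \<theta>) \<in> per_test"
proof -
  have "(\<lambda>\<theta>. \<Sum>n\<in>F. c n * fmode n \<theta>) \<in> per_test \<and>
    vder k (\<lambda>\<theta>. \<Sum>n\<in>F. c n * fmode n \<theta>) = (\<lambda>\<theta>. \<Sum>n\<in>F. (\<i> * of_int n) ^ k * c n * fmode n \<theta>)"
    using assms
  proof induction
    case empty
    have "vder k (\<lambda>\<theta>. 0 * fmode 0 \<theta> + 0 * fmode 0 \<theta>) = (\<lambda>\<theta>. 0)"
      unfolding vder_lincomb[OF fmode_in_per_test fmode_in_per_test] by simp
    then show ?case using per_test_const[of 0] by simp
  next
    case (insert n F)
    then have IH: "(\<lambda>\<theta>. \<Sum>n\<in>F. c n * fmode n \<theta>) \<in> per_test"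
      "vder k (\<lambda>\<theta>. \<Sum>n\<in>F. c n * fmode n \<theta>) = (\<lambda>\<theta>. \<Sum>n\<in>F. (\<i> * of_int n) ^ k * c n * fmode n \<theta>)"
      by auto
    have e: "(\<lambda>\<theta>. \<Sum>n\<in>insert n F. c n * fmode n \<theta>) = (\<lambda>\<theta>. c n * fmode n \<theta> + 1 * (\<Sum>n\<in>F. c n * fmode n \<theta>))"
      using insert.hyps by simp
    show ?case
      unfolding e vder_lincomb[OF fmode_in_per_test IH(1)] IH(2) vder_fmode
      using per_test_lincomb[OF fmode_in_per_test IH(1), of "c n" n 1] insert.hyps
      by (auto simp: algebra_simps)
  qed
  then show "vder k (\<lambda>\<theta>. \<Sum>n\<in>F. c n * fmode n \<theta>) = (\<lambda>\<theta>. \<Sum>n\<in>F. (\<i> * of_int n) ^ k * c n * fmode n \<theta>)"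
    "(\<lambda>\<theta>. \<Sum>n\<in>F. c n * fmode n \<theta>) \<in> per_test" by auto
qed

section \<open>Decay of the Fourier coefficients of test functions\<close>

lemma norm_vder_le_sup_deriv:
  assumes "\<phi> \<in> per_test"
  shows "norm (vder k \<phi> \<theta>) \<le> sup_deriv k \<phi>"
proof -
  obtain B where "\<And>\<theta>. norm (vder k \<phi> \<theta>) \<le> B"
    using periodic_continuous_bounded[OF per_test_periodic[OF per_test_vder[OF assms, of k]] continuous_on_vder[OF assms, of UNIV k]]
    by blast
  then have "bdd_above (range (\<lambda>\<theta>. norm (vder k \<phi> \<theta>)))" by (auto simp: bdd_above_def)
  then show ?thesis unfolding sup_deriv_def by (rule cSUP_upper[OF UNIV_I])
qed

lemma norm_le_sup_deriv: "\<phi> \<in> per_test \<Longrightarrow> norm (\<phi> \<theta>) \<le> sup_deriv 0 \<phi>"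
  using norm_vder_le_sup_deriv[of \<phi> 0] by simp

lemma sup_deriv_leI: "(\<And>\<theta>. norm (vder k \<phi> \<theta>) \<le> B) \<Longrightarrow> sup_deriv k \<phi> \<le> B"
  unfolding sup_deriv_def by (rule cSUP_least) auto

lemma sup_deriv_nonneg: "\<phi> \<in> per_test \<Longrightarrow> 0 \<le> sup_deriv k \<phi>"
  using norm_vder_le_sup_deriv[of \<phi> k 0] norm_ge_zero order_trans by blast

text \<open>Fourier coefficients of functions rather than functionals, so that they apply to test
  functions and to L^2 traces alike; \<open>fcoeff_dist_of\<close> links the two.\<close>

definition pcoeff :: "(real \<Rightarrow> complex) \<Rightarrow> int \<Rightarrow> complex" where
  "pcoeff \<phi> n = cint (\<lambda>\<theta>. \<phi> \<theta> * fmode (- n) \<theta>) / (2 * pi)"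

lemma norm_cint_le:
  assumes "\<And>\<theta>. norm (h \<theta>) \<le> B"
  shows "norm (cint h) \<le> 2 * pi * B"
proof (cases "integrable CC h")
  case True
  have "norm (cint h) \<le> (LINT \<theta>|CC. norm (h \<theta>))" by simp
  also have "\<dots> \<le> (LINT \<theta>|CC. B)"
    by (intro integral_mono) (use assms True in \<open>auto intro: finite_measure.integrable_const finite_measure_circle\<close>)
  finally show ?thesis by simp
next
  case False
  have "0 \<le> B" using order_trans[OF norm_ge_zero assms] .
  then show ?thesis using False by (simp add: not_integrable_integral_eq)
qed

lemma norm_pcoeff_le:
  assumes "\<phi> \<in> per_test"
  shows "norm (pcoeff \<phi> n) \<le> sup_deriv 0 \<phi>"
  using norm_cint_le[of "\<lambda>\<theta>. \<phi> \<theta> * fmode (- n) \<theta>" "sup_deriv 0 \<phi>"] norm_le_sup_deriv[OF assms]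
  by (simp add: pcoeff_def norm_divide norm_mult field_simps)

lemma pcoeff_deriv:
  assumes "\<phi> \<in> per_test"
  shows "pcoeff (\<lambda>t. vector_derivative \<phi> (at t)) n = \<i> * of_int n * pcoeff \<phi> n"
proof -
  let ?d = "\<lambda>t. vector_derivative \<phi> (at t)"
  have c: "continuous_on UNIV \<phi>" "continuous_on UNIV ?d"
    using assms per_test_deriv per_test_continuous by blast+
  have d: "(\<phi> has_vector_derivative ?d \<theta>) (at \<theta>)" for \<theta>
    using vder_has_vector_derivative[OF assms, of 0] by simp
  have "cint (\<lambda>\<theta>. \<phi> \<theta> * (\<i> * of_int (- n) * fmode (- n) \<theta>) + ?d \<theta> * fmode (- n) \<theta>) = 0"
  proof (rule cint_derivative_periodic)
    fix \<theta>
    show "((\<lambda>\<theta>. \<phi> \<theta> * fmode (- n) \<theta>) has_vector_derivative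
        \<phi> \<theta> * (\<i> * of_int (- n) * fmode (- n) \<theta>) + ?d \<theta> * fmode (- n) \<theta>) (at \<theta>)"
      by (intro has_vector_derivative_mult d fmode_has_vector_derivative)
  qed (use c in \<open>auto simp: fmode_periodic per_test_periodic[OF assms] intro!: continuous_intros\<close>)
  moreover have "integrable CC (\<lambda>\<theta>. \<phi> \<theta> * (\<i> * of_int (- n) * fmode (- n) \<theta>))"
    "integrable CC (\<lambda>\<theta>. ?d \<theta> * fmode (- n) \<theta>)"
    by (intro cint_integrable continuous_intros c)+
  ultimately have "cint (\<lambda>\<theta>. \<phi> \<theta> * (\<i> * of_int (- n) * fmode (- n) \<theta>)) + cint (\<lambda>\<theta>. ?d \<theta> * fmode (- n) \<theta>) = 0"
    by simp
  moreover have "cint (\<lambda>\<theta>. \<phi> \<theta> * (\<i> * of_int (- n) * fmode (- n) \<theta>)) = - (\<i> * of_int n * cint (\<lambda>\<theta>. \<phi> \<theta> * fmode (- n) \<theta>))"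
    using integral_mult_right_zero[of CC "- \<i> * of_int n" "\<lambda>\<theta>. \<phi> \<theta> * fmode (- n) \<theta>"]
    by (simp add: mult_ac)
  ultimately show ?thesis by (simp add: pcoeff_def algebra_simps eq_neg_iff_add_eq_0)
qed

lemma pcoeff_vder:
  assumes "\<phi> \<in> per_test"
  shows "pcoeff (vder k \<phi>) n = (\<i> * of_int n) ^ k * pcoeff \<phi> n"
proof (induction k)
  case (Suc k)
  show ?case using pcoeff_deriv[OF per_test_vder[OF assms], of k n] Suc by simp
qed simp

definition wt :: "int \<Rightarrow> real" where
  "wt n = real_of_int (max 1 \<bar>n\<bar>)"

lemma wt_ge_1 [simp]: "1 \<le> wt n" and wt_pos [simp]: "0 < wt n"
  by (auto simp: wt_def max_def)

lemma wt_uminus [simp]: "wt (- n) = wt n" by (simp add: wt_def)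

lemma wt_0 [simp]: "wt 0 = 1" by (simp add: wt_def)

lemma wt_neq_0 [simp]: "wt n \<noteq> 0"
  using wt_pos[of n] by linarith

lemma wt_nonzero: "n \<noteq> 0 \<Longrightarrow> wt n = real_of_int \<bar>n\<bar>"
  using max_absorb2[of 1 "\<bar>n\<bar>"] by (simp add: wt_def)

lemma sob_weight_wt: "sob_weight s n = wt n powr (2 * s)" by (simp add: sob_weight_def wt_def)

lemma summable_on_int_from_nat:
  fixes f :: "int \<Rightarrow> real"
  assumes "(\<lambda>n. f (int n)) summable_on UNIV" "(\<lambda>n. f (- int n)) summable_on UNIV"
  shows "f summable_on UNIV"
proof -
  have "f summable_on range int" "f summable_on range (\<lambda>n. - int n)"
    using assms by (subst summable_on_reindex; auto simp: o_def inj_on_def)+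
  then have "f summable_on (range int \<union> range (\<lambda>n. - int n))" by (intro summable_on_union)
  moreover have "range int \<union> range (\<lambda>n. - int n) = UNIV"
  proof (intro equalityI subsetI UNIV_I)
    fix n :: int
    show "n \<in> range int \<union> range (\<lambda>n. - int n)"
      by (cases n rule: int_cases2) auto
  qed
  ultimately show ?thesis by simp
qed

lemma summable_wt_powr:
  assumes "a > 1"
  shows "(\<lambda>n. wt n powr (- a)) summable_on UNIV"
proof -
  have "summable (\<lambda>n. real n powr (- a))" using assms by (simp add: summable_real_powr_iff)
  then have "summable (\<lambda>n. wt (int (Suc n)) powr (- a))"
    by (subst (asm) summable_Suc_iff[symmetric]) (simp add: wt_def max_def add.commute)
  then have "summable (\<lambda>n. wt (int n) powr (- a))" by (subst (asm) summable_Suc_iff)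
  then have "(\<lambda>n. wt (int n) powr (- a)) summable_on UNIV"
    by (subst summable_on_UNIV_nonneg_real_iff) auto
  then show ?thesis by (intro summable_on_int_from_nat) auto
qed

text \<open>For \<open>n\<close> other than 0 this is integration by parts, \<open>k\<close> times.
  At \<open>n = 0\<close> the derivatives carry no information, which is why
  \<open>sup_deriv 0 \<phi>\<close> is added.\<close>

lemma norm_pcoeff_decay:
  assumes "\<phi> \<in> per_test"
  shows "norm (pcoeff \<phi> n) \<le> (sup_deriv 0 \<phi> + sup_deriv k \<phi>) * wt n powr (- real k)"
proof (cases "n = 0")
  case True
  then show ?thesis using norm_pcoeff_le[OF assms] sup_deriv_nonneg[OF assms, of k]
    by (simp add: add_increasing2)
next
  case False
  have "norm (pcoeff (vder k \<phi>) n) \<le> sup_deriv k \<phi>"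
    using norm_pcoeff_le[OF per_test_vder[OF assms, of k]] by (simp add: sup_deriv_def)
  then have "wt n ^ k * norm (pcoeff \<phi> n) \<le> sup_deriv 0 \<phi> + sup_deriv k \<phi>"
    using sup_deriv_nonneg[OF assms, of 0] False
    by (simp add: pcoeff_vder[OF assms] norm_mult norm_power wt_nonzero)
  then show ?thesis by (simp add: powr_minus powr_realpow field_simps)
qed

text \<open>Two derivatives more than \<open>k\<close> are spent, leaving the summable weight
  \<open>wt n powr (- 2)\<close>.\<close>

lemma pcoeff_weighted_summable:
  assumes "\<phi> \<in> per_test"
  shows "(\<lambda>n. wt n ^ k * norm (pcoeff \<phi> n)) summable_on UNIV"
proof (rule summable_on_comparison_test)
  show "(\<lambda>n. (sup_deriv 0 \<phi> + sup_deriv (k + 2) \<phi>) * wt n powr (- 2)) summable_on UNIV"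
    by (intro summable_on_cmult_right summable_wt_powr) simp
  fix n
  have "wt n ^ k * norm (pcoeff \<phi> n) \<le> wt n ^ k * ((sup_deriv 0 \<phi> + sup_deriv (k + 2) \<phi>) * wt n powr (- real (k + 2)))"
    by (intro mult_left_mono norm_pcoeff_decay assms) (simp add: less_imp_le)
  also have "\<dots> = (sup_deriv 0 \<phi> + sup_deriv (k + 2) \<phi>) * (wt n powr real k * wt n powr (- real (k + 2)))"
    by (simp add: powr_realpow)
  also have "wt n powr real k * wt n powr (- real (k + 2)) = wt n powr (- 2)"
    by (simp flip: powr_add)
  finally show "wt n ^ k * norm (pcoeff \<phi> n) \<le> (sup_deriv 0 \<phi> + sup_deriv (k + 2) \<phi>) * wt n powr (- 2)" .
qed (simp add: less_imp_le)

lemma abs_le_wt: "\<bar>real_of_int n\<bar> \<le> wt n" by (simp add: wt_def)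

lemma vder_pcoeff_summable:
  assumes "\<phi> \<in> per_test"
  shows "(\<lambda>n. norm ((\<i> * of_int n) ^ k * pcoeff \<phi> n)) summable_on UNIV"
  by (rule summable_on_comparison_test[OF pcoeff_weighted_summable[OF assms, of k]])
    (auto simp: norm_mult norm_power intro!: mult_right_mono power_mono abs_le_wt)

lemma vder_eq_fseries:
  assumes "\<phi> \<in> per_test"
  shows "vder k \<phi> = fseries (\<lambda>n. (\<i> * of_int n) ^ k * pcoeff \<phi> n)"
proof (rule fourier_series_eq[symmetric])
  show "(\<i> * of_int n) ^ k * pcoeff \<phi> n = cint (\<lambda>\<theta>. vder k \<phi> \<theta> * fmode (- n) \<theta>) / (2 * pi)" for n
    using pcoeff_vder[OF assms] unfolding pcoeff_def by simp
qed (rule continuous_on_vder per_test_periodic per_test_vder vder_pcoeff_summable assms)+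

section \<open>Distributions and their Fourier coefficients\<close>

lemma pdist_lincomb:
  "g \<in> pdist \<Longrightarrow> \<phi> \<in> per_test \<Longrightarrow> \<psi> \<in> per_test \<Longrightarrow> g (\<lambda>\<theta>. a * \<phi> \<theta> + b * \<psi> \<theta>) = a * g \<phi> + b * g \<psi>"
  by (simp add: pdist_def)

lemma pdist_trig_sum:
  assumes "g \<in> pdist" "finite F"
  shows "g (\<lambda>\<theta>. \<Sum>n\<in>F. c n * fmode n \<theta>) = (\<Sum>n\<in>F. c n * g (fmode n))"
  using assms(2)
proof induction
  case empty
  show ?case using pdist_lincomb[OF assms(1) fmode_in_per_test fmode_in_per_test, of 0 0 0 0] by simp
next
  case (insert n F)
  then show ?case
    using pdist_lincomb[OF assms(1) fmode_in_per_test per_test_trig_sum[OF insert.hyps(1)], of "c n" n 1 c] by simp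
qed

text \<open>Fourier partial sums of a test function converge to it together with every derivative,
  each error being a tail of an absolutely convergent series; the seminorm bound of \<open>g\<close>
  then carries the convergence over. It follows that Fourier coefficients determine a
  distribution.\<close>

lemma pdist_has_sum:
  assumes g: "g \<in> pdist" and \<phi>: "\<phi> \<in> per_test"
  shows "((\<lambda>n. pcoeff \<phi> n * g (fmode n)) has_sum g \<phi>) UNIV"
proof -
  obtain C N where CN: "\<And>\<phi>. \<phi> \<in> per_test \<Longrightarrow> norm (g \<phi>) \<le> C * (\<Sum>k\<le>N. sup_deriv k \<phi>)"
    using g unfolding pdist_def by blast
  define T where "T k F = (\<Sum>\<^sub>\<infinity>n\<in>-F. norm ((\<i> * of_int n) ^ k * pcoeff \<phi> n))" for k F
  have "norm ((\<Sum>n\<in>F. pcoeff \<phi> n * g (fmode n)) - g \<phi>) \<le> \<bar>C\<bar> * (\<Sum>k\<le>N. T k F)" if F: "finite F" for F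
  proof -
    let ?p = "\<lambda>\<theta>. \<Sum>n\<in>F. pcoeff \<phi> n * fmode n \<theta>"
    have p: "?p \<in> per_test" by (rule per_test_trig_sum[OF F])
    define r where "r = (\<lambda>\<theta>. 1 * \<phi> \<theta> + (- 1) * ?p \<theta>)"
    have r: "r \<in> per_test" unfolding r_def by (rule per_test_lincomb[OF \<phi> p])
    have "sup_deriv k r \<le> T k F" for k
    proof (rule sup_deriv_leI)
      fix \<theta>
      have "vder k r \<theta> = fseries (\<lambda>n. (\<i> * of_int n) ^ k * pcoeff \<phi> n) \<theta> - (\<Sum>n\<in>F. ((\<i> * of_int n) ^ k * pcoeff \<phi> n) * fmode n \<theta>)"
        unfolding r_def vder_lincomb[OF \<phi> p] vder_trig_sum[OF F] vder_eq_fseries[OF \<phi>] by simp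
      then show "norm (vder k r \<theta>) \<le> T k F"
        unfolding T_def using norm_fseries_diff_le[OF vder_pcoeff_summable[OF \<phi>] F] by simp
    qed
    then have "(\<Sum>k\<le>N. sup_deriv k r) \<le> (\<Sum>k\<le>N. T k F)" by (intro sum_mono)
    moreover have "0 \<le> (\<Sum>k\<le>N. sup_deriv k r)" by (intro sum_nonneg sup_deriv_nonneg r)
    ultimately have "C * (\<Sum>k\<le>N. sup_deriv k r) \<le> \<bar>C\<bar> * (\<Sum>k\<le>N. T k F)"
      by (intro mult_mono) auto
    moreover have "g r = g \<phi> - (\<Sum>n\<in>F. pcoeff \<phi> n * g (fmode n))"
      unfolding r_def pdist_lincomb[OF g \<phi> p] pdist_trig_sum[OF g F] by simp
    ultimately show ?thesis using CN[OF r] by (simp add: norm_minus_commute)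
  qed
  moreover have "((\<lambda>F. \<bar>C\<bar> * (\<Sum>k\<le>N. T k F)) \<longlongrightarrow> 0) (finite_subsets_at_top UNIV)"
  proof -
    have "((\<lambda>F. \<bar>C\<bar> * (\<Sum>k\<le>N. T k F)) \<longlongrightarrow> \<bar>C\<bar> * (\<Sum>k\<le>N. 0)) (finite_subsets_at_top UNIV)"
      unfolding T_def by (intro tendsto_intros infsum_tail_tendsto_0 vder_pcoeff_summable \<phi>)
    then show ?thesis by simp
  qed
  ultimately have "((\<lambda>F. (\<Sum>n\<in>F. pcoeff \<phi> n * g (fmode n)) - g \<phi>) \<longlongrightarrow> 0) (finite_subsets_at_top UNIV)"
    by (rule Lim_null_comparison[OF eventually_finite_subsets_at_top_weakI])
  then show ?thesis unfolding has_sum_def using LIM_zero_cancel by blast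
qed

lemma pdist_fmode: "g (fmode n) = 2 * pi * fcoeff g (- n)"
  by (simp add: fcoeff_def)

text \<open>Later equations between distributions are reduced by this to equations between
  coefficients; off \<open>per_test\<close> both sides are 0 by convention.\<close>

lemma pdist_eqI:
  assumes "g \<in> pdist" "h \<in> pdist" "\<And>n. fcoeff g n = fcoeff h n"
  shows "g = h"
proof
  fix \<phi>
  show "g \<phi> = h \<phi>"
  proof (cases "\<phi> \<in> per_test")
    case True
    then show ?thesis
      using pdist_has_sum[OF assms(1) True] pdist_has_sum[OF assms(2) True] assms(3) has_sum_unique
      by (simp add: pdist_fmode)
  qed (use assms in \<open>auto simp: pdist_def\<close>)
qed

lemma pdistI:
  assumes "\<And>\<phi> \<psi> a b. \<phi> \<in> per_test \<Longrightarrow> \<psi> \<in> per_test \<Longrightarrow> g (\<lambda>\<theta>. a * \<phi> \<theta> + b * \<psi> \<theta>) = a * g \<phi> + b * g \<psi>"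
    and "\<And>\<phi>. \<phi> \<in> per_test \<Longrightarrow> norm (g \<phi>) \<le> C * (\<Sum>k\<le>N. sup_deriv k \<phi>)"
    and "\<And>\<phi>. \<phi> \<notin> per_test \<Longrightarrow> g \<phi> = 0"
  shows "g \<in> pdist"
  unfolding pdist_def using assms by blast

lemma sup_deriv_le_sum:
  assumes "\<phi> \<in> per_test" "i \<le> N"
  shows "sup_deriv i \<phi> \<le> (\<Sum>k\<le>N. sup_deriv k \<phi>)"
  using member_le_sum[of i "{..N}" "\<lambda>k. sup_deriv k \<phi>"] sup_deriv_nonneg assms by auto

lemma fcoeff_lincomb: "fcoeff (\<lambda>\<phi>. a * g \<phi> + b * h \<phi>) n = a * fcoeff g n + b * fcoeff h n"
  by (simp add: fcoeff_def add_divide_distrib)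

lemma pdist_comb:
  assumes g: "g \<in> pdist" and h: "h \<in> pdist"
  shows "(\<lambda>\<phi>. a * g \<phi> + b * h \<phi>) \<in> pdist"
proof -
  obtain C N where C: "\<And>\<phi>. \<phi> \<in> per_test \<Longrightarrow> norm (g \<phi>) \<le> C * (\<Sum>k\<le>N. sup_deriv k \<phi>)"
    using g unfolding pdist_def by blast
  obtain C' N' where C': "\<And>\<phi>. \<phi> \<in> per_test \<Longrightarrow> norm (h \<phi>) \<le> C' * (\<Sum>k\<le>N'. sup_deriv k \<phi>)"
    using h unfolding pdist_def by blast
  show ?thesis
  proof (rule pdistI)
    fix \<phi> assume \<phi>: "\<phi> \<in> per_test"
    let ?S = "\<Sum>k\<le>max N N'. sup_deriv k \<phi>"
    have m: "(\<Sum>k\<le>N. sup_deriv k \<phi>) \<le> ?S" "(\<Sum>k\<le>N'. sup_deriv k \<phi>) \<le> ?S"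
      by (auto intro!: sum_mono2 sup_deriv_nonneg \<phi>)
    have nn: "0 \<le> (\<Sum>k\<le>M. sup_deriv k \<phi>)" for M by (intro sum_nonneg sup_deriv_nonneg \<phi>)
    have "norm (g \<phi>) \<le> \<bar>C\<bar> * ?S"
      by (rule order_trans[OF C[OF \<phi>]]) (intro mult_mono m nn; simp)
    moreover have "norm (h \<phi>) \<le> \<bar>C'\<bar> * ?S"
      by (rule order_trans[OF C'[OF \<phi>]]) (intro mult_mono m nn; simp)
    ultimately have "norm (a * g \<phi>) + norm (b * h \<phi>) \<le> norm a * (\<bar>C\<bar> * ?S) + norm b * (\<bar>C'\<bar> * ?S)"
      unfolding norm_mult by (intro add_mono mult_left_mono) auto
    then show "norm (a * g \<phi> + b * h \<phi>) \<le> (norm a * \<bar>C\<bar> + norm b * \<bar>C'\<bar>) * ?S"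
      by (intro order_trans[OF norm_triangle_ineq]) (simp add: algebra_simps)
  qed (use g h in \<open>auto simp: pdist_def algebra_simps\<close>)
qed

lemma zero_in_pdist: "(\<lambda>_. 0) \<in> pdist"
  by (rule pdistI[of _ 0 0]) auto

lemma pdist_finite_sum:
  assumes "finite F" "\<And>i. i \<in> F \<Longrightarrow> g i \<in> pdist"
  shows "(\<lambda>\<phi>. \<Sum>i\<in>F. c i * g i \<phi>) \<in> pdist"
  using assms
proof induction
  case empty
  then show ?case using zero_in_pdist by simp
next
  case (insert i F)
  then show ?case using pdist_comb[of "g i" "\<lambda>\<phi>. \<Sum>i\<in>F. c i * g i \<phi>" "c i" 1] by simp
qed

lemma fcoeff_finite_sum: "fcoeff (\<lambda>\<phi>. \<Sum>i\<in>F. c i * g i \<phi>) n = (\<Sum>i\<in>F. c i * fcoeff (g i) n)"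
  by (simp add: fcoeff_def sum_divide_distrib)

lemma integrable_mult_per_test:
  assumes h: "integrable CC h" and \<phi>: "\<phi> \<in> per_test"
  shows "integrable CC (\<lambda>\<theta>. h \<theta> * \<phi> \<theta>)"
proof -
  have [measurable]: "h \<in> borel_measurable CC" "\<phi> \<in> borel_measurable CC"
    using h cint_integrable[OF per_test_continuous[OF \<phi>]] by auto
  have "integrable CC (\<lambda>\<theta>. sup_deriv 0 \<phi> * norm (h \<theta>))"
    using h by auto
  then show ?thesis
    by (rule Bochner_Integration.integrable_bound)
      (use norm_le_sup_deriv[OF \<phi>] sup_deriv_nonneg[OF \<phi>] in \<open>auto simp: norm_mult mult.commute intro!: AE_I2 mult_mono\<close>)
qed

lemma dist_of_in_pdist:
  assumes h: "integrable CC h"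
  shows "dist_of h \<in> pdist"
proof (rule pdistI)
  fix \<phi> \<psi> :: "real \<Rightarrow> complex" and a b :: complex
  assume *: "\<phi> \<in> per_test" "\<psi> \<in> per_test"
  have "cint (\<lambda>\<theta>. h \<theta> * (a * \<phi> \<theta> + b * \<psi> \<theta>)) = cint (\<lambda>\<theta>. a * (h \<theta> * \<phi> \<theta>) + b * (h \<theta> * \<psi> \<theta>))"
    by (simp add: algebra_simps)
  also have "\<dots> = a * cint (\<lambda>\<theta>. h \<theta> * \<phi> \<theta>) + b * cint (\<lambda>\<theta>. h \<theta> * \<psi> \<theta>)"
    using integrable_mult_per_test[OF h *(1)] integrable_mult_per_test[OF h *(2)] by simp
  finally show "dist_of h (\<lambda>\<theta>. a * \<phi> \<theta> + b * \<psi> \<theta>) = a * dist_of h \<phi> + b * dist_of h \<psi>"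
    using * per_test_lincomb[OF *] by (simp add: dist_of_def)
next
  fix \<phi> assume \<phi>: "\<phi> \<in> per_test"
  have "norm (cint (\<lambda>\<theta>. h \<theta> * \<phi> \<theta>)) \<le> (LINT \<theta>|CC. norm (h \<theta> * \<phi> \<theta>))" by simp
  also have "\<dots> \<le> (LINT \<theta>|CC. norm (h \<theta>) * sup_deriv 0 \<phi>)"
    using h norm_le_sup_deriv[OF \<phi>]
    by (intro integral_mono integrable_norm integrable_mult_per_test[OF h \<phi>])
      (auto simp: norm_mult intro!: mult_left_mono)
  finally show "norm (dist_of h \<phi>) \<le> (LINT \<theta>|CC. norm (h \<theta>)) * (\<Sum>k\<le>0. sup_deriv k \<phi>)"
    using \<phi> by (simp add: dist_of_def)
qed (auto simp: dist_of_def)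

lemma fcoeff_dist_of: "fcoeff (dist_of h) n = pcoeff h n"
  by (simp add: fcoeff_def dist_of_def pcoeff_def fmode_in_per_test)

lemma pcoeff_fmode: "pcoeff (fmode m) n = (if m = n then 1 else 0)"
  by (simp add: pcoeff_def cint_fmode_mult)

lemma dist_of_fmode_in_pdist: "dist_of (fmode m) \<in> pdist"
  by (intro dist_of_in_pdist cint_integrable continuous_intros)

lemma fcoeff_fmode: "fcoeff (dist_of (fmode m)) n = (if m = n then 1 else 0)"
  by (simp add: fcoeff_dist_of pcoeff_fmode)

lemma pcoeff_fseries:
  "(\<lambda>n. norm (c n)) summable_on UNIV \<Longrightarrow> pcoeff (fseries c) n = c n"
  by (simp add: pcoeff_def cint_fseries_fmode)

lemma dirac_in_pdist: "dirac a \<in> pdist"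
  by (rule pdistI[of _ 1 0]) (auto simp: dirac_def per_test_lincomb norm_le_sup_deriv)

lemma fcoeff_dirac: "fcoeff (dirac a) n = fmode (- n) a / (2 * pi)"
  by (simp add: fcoeff_def dirac_def fmode_in_per_test)

text \<open>The functional with Fourier coefficients \<open>c\<close>: the \<open>n\<close>-th mode
  pairs with \<phi> to \<open>2 * pi * pcoeff \<phi> (- n)\<close>. The value 0 off
  \<open>per_test\<close> is the convention of \<open>pdist\<close>.\<close>

definition dist_coeffs :: "(int \<Rightarrow> complex) \<Rightarrow> functional" where
  "dist_coeffs c \<phi> = (if \<phi> \<in> per_test then 2 * pi * (\<Sum>\<^sub>\<infinity>n. c n * pcoeff \<phi> (- n)) else 0)"

text \<open>Polynomial growth of the coefficients is tolerable because those of a test function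
  decay faster than any power; \<open>N + 2\<close> derivatives outweigh the growth and leave a
  summable factor.\<close>

lemma
  assumes c: "\<And>n. norm (c n) \<le> C * wt n ^ N"
  shows dist_coeffs_in_pdist: "dist_coeffs c \<in> pdist"
    and fcoeff_dist_coeffs: "fcoeff (dist_coeffs c) n = c n"
proof -
  have C: "0 \<le> C" using order_trans[OF norm_ge_zero c[of 0]] by simp
  have b: "norm (c n * pcoeff \<phi> (- n)) \<le> C * (wt n ^ N * norm (pcoeff \<phi> (- n)))" for \<phi> n
    using c[of n] by (simp add: norm_mult mult.assoc[symmetric] mult_right_mono)
  have r: "(\<lambda>n::int. f (- n)) summable_on UNIV" if "f summable_on UNIV" for f :: "int \<Rightarrow> real"
    using that summable_on_reindex_bij_betw[of uminus UNIV UNIV f] by (simp add: bij_uminus)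
  have s: "(\<lambda>n. norm (c n * pcoeff \<phi> (- n))) summable_on UNIV" if "\<phi> \<in> per_test" for \<phi>
    by (rule summable_on_comparison_test[OF _ b])
      (use r[OF pcoeff_weighted_summable[OF that, of N]] in \<open>auto intro!: summable_on_cmult_right\<close>)
  have s': "(\<lambda>n. c n * pcoeff \<phi> (- n)) summable_on UNIV" if "\<phi> \<in> per_test" for \<phi>
    by (rule abs_summable_summable) (rule s[OF that])
  show "dist_coeffs c \<in> pdist"
  proof (rule pdistI)
    fix \<phi> \<psi> :: "real \<Rightarrow> complex" and a b :: complex
    assume *: "\<phi> \<in> per_test" "\<psi> \<in> per_test"
    have "pcoeff (\<lambda>\<theta>. a * \<phi> \<theta> + b * \<psi> \<theta>) n = a * pcoeff \<phi> n + b * pcoeff \<psi> n" for n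
      using fcoeff_lincomb[of a "dist_of \<phi>" b "dist_of \<psi>" n]
        integrable_mult_per_test[OF cint_integrable[OF per_test_continuous[OF *(1)]] fmode_in_per_test[of "- n"]]
        integrable_mult_per_test[OF cint_integrable[OF per_test_continuous[OF *(2)]] fmode_in_per_test[of "- n"]]
      by (simp add: pcoeff_def distrib_right mult.assoc add_divide_distrib)
    then have "(\<Sum>\<^sub>\<infinity>n. c n * pcoeff (\<lambda>\<theta>. a * \<phi> \<theta> + b * \<psi> \<theta>) (- n))
        = (\<Sum>\<^sub>\<infinity>n. a * (c n * pcoeff \<phi> (- n)) + b * (c n * pcoeff \<psi> (- n)))"
      by (simp add: algebra_simps)
    also have "\<dots> = a * (\<Sum>\<^sub>\<infinity>n. c n * pcoeff \<phi> (- n)) + b * (\<Sum>\<^sub>\<infinity>n. c n * pcoeff \<psi> (- n))"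
      using s'[OF *(1)] s'[OF *(2)]
      by (subst infsum_add) (auto intro!: summable_on_cmult_right simp: infsum_cmult_right)
    finally show "dist_coeffs c (\<lambda>\<theta>. a * \<phi> \<theta> + b * \<psi> \<theta>) = a * dist_coeffs c \<phi> + b * dist_coeffs c \<psi>"
      using * by (simp add: dist_coeffs_def per_test_lincomb algebra_simps)
  next
    fix \<phi> assume \<phi>: "\<phi> \<in> per_test"
    define S where "S = (\<Sum>k\<le>N+2. sup_deriv k \<phi>)"
    define W where "W = (\<Sum>\<^sub>\<infinity>n. wt n powr (- 2))"
    have S: "sup_deriv 0 \<phi> + sup_deriv (N + 2) \<phi> \<le> 2 * S"
      using sup_deriv_le_sum[OF \<phi>, of 0 "N + 2"] sup_deriv_le_sum[OF \<phi>, of "N + 2" "N + 2"] by (simp add: S_def)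
    have "norm (\<Sum>\<^sub>\<infinity>n. c n * pcoeff \<phi> (- n)) \<le> (\<Sum>\<^sub>\<infinity>n. norm (c n * pcoeff \<phi> (- n)))"
      by (rule norm_infsum_bound[OF s[OF \<phi>]])
    also have "\<dots> \<le> (\<Sum>\<^sub>\<infinity>n. (2 * C * S) * wt n powr (- 2))"
    proof (rule infsum_mono[OF s[OF \<phi>]])
      show "(\<lambda>n. (2 * C * S) * wt n powr (- 2)) summable_on UNIV"
        by (intro summable_on_cmult_right summable_wt_powr) simp
      fix n
      have "norm (c n * pcoeff \<phi> (- n)) \<le> C * (wt n ^ N * norm (pcoeff \<phi> (- n)))" by (rule b)
      also have "\<dots> \<le> C * (wt n ^ N * ((2 * S) * wt n powr (- real (N + 2))))"
      proof -
        have "norm (pcoeff \<phi> (- n)) \<le> (sup_deriv 0 \<phi> + sup_deriv (N + 2) \<phi>) * wt n powr (- real (N + 2))"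
          using norm_pcoeff_decay[OF \<phi>, of "- n" "N + 2"] by simp
        also have "\<dots> \<le> (2 * S) * wt n powr (- real (N + 2))" by (intro mult_right_mono S) simp
        finally show ?thesis by (intro mult_left_mono C) (auto simp: less_imp_le)
      qed
      also have "\<dots> = 2 * C * S * (wt n powr real N * wt n powr (- real (N + 2)))"
        by (simp add: powr_realpow)
      also have "wt n powr real N * wt n powr (- real (N + 2)) = wt n powr (- 2)"
        by (simp flip: powr_add)
      finally show "norm (c n * pcoeff \<phi> (- n)) \<le> (2 * C * S) * wt n powr (- 2)" .
    qed
    also have "\<dots> = 2 * C * S * W" by (simp add: W_def infsum_cmult_right')
    finally have "norm (dist_coeffs c \<phi>) \<le> 2 * pi * (2 * C * S * W)"
      using \<phi> by (simp add: dist_coeffs_def norm_mult mult_left_mono)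
    then show "norm (dist_coeffs c \<phi>) \<le> (2 * pi * 2 * C * W) * (\<Sum>k\<le>N+2. sup_deriv k \<phi>)"
      by (simp add: S_def mult_ac)
  qed (simp add: dist_coeffs_def)
  have "(\<Sum>\<^sub>\<infinity>m. c m * pcoeff (fmode (- n)) (- m)) = c n"
    by (rule infsumI, rule has_sum_finite_neutralI[of "{n}"]) (auto simp: pcoeff_fmode)
  then show "fcoeff (dist_coeffs c) n = c n"
    by (simp add: fcoeff_def dist_coeffs_def fmode_in_per_test)
qed

section \<open>Periodic Sobolev spaces\<close>

lemma infsum_Cauchy_Schwarz:
  fixes a b :: "'a \<Rightarrow> real"
  assumes a: "(\<lambda>x. (a x)\<^sup>2) summable_on A" and b: "(\<lambda>x. (b x)\<^sup>2) summable_on A"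
    and nn: "\<And>x. 0 \<le> a x" "\<And>x. 0 \<le> b x"
  shows "(\<lambda>x. a x * b x) summable_on A"
    and "infsum (\<lambda>x. a x * b x) A \<le> sqrt (infsum (\<lambda>x. (a x)\<^sup>2) A) * sqrt (infsum (\<lambda>x. (b x)\<^sup>2) A)"
proof -
  have fin: "(\<Sum>x\<in>F. a x * b x) \<le> sqrt (infsum (\<lambda>x. (a x)\<^sup>2) A) * sqrt (infsum (\<lambda>x. (b x)\<^sup>2) A)"
    if F: "finite F" "F \<subseteq> A" for F
  proof -
    have "(\<Sum>x\<in>F. a x * b x)\<^sup>2 \<le> (\<Sum>x\<in>F. (a x)\<^sup>2) * (\<Sum>x\<in>F. (b x)\<^sup>2)"
      by (rule Cauchy_Schwarz_ineq_sum)
    also have "\<dots> \<le> infsum (\<lambda>x. (a x)\<^sup>2) A * infsum (\<lambda>x. (b x)\<^sup>2) A"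
      using F by (intro mult_mono finite_sum_le_infsum a b infsum_nonneg sum_nonneg) auto
    finally have "(\<Sum>x\<in>F. a x * b x) \<le> sqrt (infsum (\<lambda>x. (a x)\<^sup>2) A * infsum (\<lambda>x. (b x)\<^sup>2) A)"
      by (rule real_le_rsqrt)
    then show ?thesis by (simp add: real_sqrt_mult)
  qed
  show s: "(\<lambda>x. a x * b x) summable_on A"
    by (rule nonneg_bdd_above_summable_on) (use nn in \<open>auto intro!: bdd_aboveI2 fin\<close>)
  show "infsum (\<lambda>x. a x * b x) A \<le> sqrt (infsum (\<lambda>x. (a x)\<^sup>2) A) * sqrt (infsum (\<lambda>x. (b x)\<^sup>2) A)"
    by (rule infsum_le_finite_sums[OF s fin])
qed

lemma sob_weight_pos [simp]: "0 < sob_weight s n"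
  by (simp add: sob_weight_wt less_le)

lemma sob_weight_nonneg [simp]: "0 \<le> sob_weight s n"
  by (simp add: less_imp_le)

lemma HsI:
  "g \<in> pdist \<Longrightarrow> (\<lambda>n. sob_weight s n * (norm (fcoeff g n))\<^sup>2) summable_on UNIV \<Longrightarrow> g \<in> Hs s"
  by (simp add: Hs_def)

lemma Hs_summable: "g \<in> Hs s \<Longrightarrow> (\<lambda>n. sob_weight s n * (norm (fcoeff g n))\<^sup>2) summable_on UNIV"
  by (simp add: Hs_def)

lemma Hs_pdist: "g \<in> Hs s \<Longrightarrow> g \<in> pdist"
  by (simp add: Hs_def)

lemma Hs0_Hs: "g \<in> Hs0 s \<Longrightarrow> g \<in> Hs s" and Hs0_fcoeff: "g \<in> Hs0 s \<Longrightarrow> fcoeff g 0 = 0"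
  by (simp_all add: Hs0_def)

lemma Hs0_pdist: "g \<in> Hs0 s \<Longrightarrow> g \<in> pdist"
  by (simp add: Hs0_def Hs_def)

lemma Hs_norm_nonneg [simp]: "0 \<le> Hs_norm s g"
  by (auto simp: Hs_norm_def intro!: mult_nonneg_nonneg infsum_nonneg)

lemma Hs_norm_square: "(Hs_norm s g)\<^sup>2 = 2 * pi * (\<Sum>\<^sub>\<infinity>n. sob_weight s n * (norm (fcoeff g n))\<^sup>2)"
  unfolding Hs_norm_def by (subst real_sqrt_pow2) (auto intro!: mult_nonneg_nonneg infsum_nonneg)

lemma Hs_comb:
  assumes "g \<in> Hs s" "h \<in> Hs s"
  shows "(\<lambda>\<phi>. a * g \<phi> + b * h \<phi>) \<in> Hs s"
proof (rule HsI)
  show "(\<lambda>\<phi>. a * g \<phi> + b * h \<phi>) \<in> pdist" by (intro pdist_comb Hs_pdist[OF assms(1)] Hs_pdist[OF assms(2)])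
  show "(\<lambda>n. sob_weight s n * (norm (fcoeff (\<lambda>\<phi>. a * g \<phi> + b * h \<phi>) n))\<^sup>2) summable_on UNIV"
  proof (rule summable_on_comparison_test)
    show "(\<lambda>n. 2 * (norm a)\<^sup>2 * (sob_weight s n * (norm (fcoeff g n))\<^sup>2)
        + 2 * (norm b)\<^sup>2 * (sob_weight s n * (norm (fcoeff h n))\<^sup>2)) summable_on UNIV"
      by (intro summable_on_add summable_on_cmult_right Hs_summable assms)
    fix n
    have "sob_weight s n * (norm (a * fcoeff g n + b * fcoeff h n))\<^sup>2
        \<le> sob_weight s n * (2 * (norm (a * fcoeff g n))\<^sup>2 + 2 * (norm (b * fcoeff h n))\<^sup>2)"
      by (intro mult_left_mono norm_add_square_le) simp
    then show "sob_weight s n * (norm (fcoeff (\<lambda>\<phi>. a * g \<phi> + b * h \<phi>) n))\<^sup>2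
        \<le> 2 * (norm a)\<^sup>2 * (sob_weight s n * (norm (fcoeff g n))\<^sup>2)
        + 2 * (norm b)\<^sup>2 * (sob_weight s n * (norm (fcoeff h n))\<^sup>2)"
      unfolding fcoeff_lincomb by (simp add: norm_mult power_mult_distrib algebra_simps)
  qed simp
qed

lemma Hs0_comb: "g \<in> Hs0 s \<Longrightarrow> h \<in> Hs0 s \<Longrightarrow> (\<lambda>\<phi>. a * g \<phi> + b * h \<phi>) \<in> Hs0 s"
  by (simp add: Hs0_def Hs_comb fcoeff_lincomb)

lemma Hs_finite_spectrum:
  assumes "g \<in> pdist" "finite F" "\<And>n. n \<notin> F \<Longrightarrow> fcoeff g n = 0"
  shows "g \<in> Hs s"
proof (rule HsI[OF assms(1)])
  show "(\<lambda>n. sob_weight s n * (norm (fcoeff g n))\<^sup>2) summable_on UNIV"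
    by (rule finite_nonzero_values_imp_summable_on[OF finite_subset[OF _ assms(2)]]) (use assms(3) in auto)
qed

lemma fmode_in_Hs0: "m \<noteq> 0 \<Longrightarrow> dist_of (fmode m) \<in> Hs0 s"
  using Hs_finite_spectrum[OF dist_of_fmode_in_pdist, of "{m}" m s] by (auto simp: Hs0_def fcoeff_fmode)

lemma zero_in_Hs0: "(\<lambda>_. 0) \<in> Hs0 s"
  using Hs_finite_spectrum[OF zero_in_pdist, of "{}" s] by (auto simp: Hs0_def fcoeff_def)

lemma Hs_norm_zero [simp]: "Hs_norm s (\<lambda>_. 0) = 0"
  by (simp add: Hs_norm_def fcoeff_def)

text \<open>The Cauchy-Schwarz inequality for the weights \<open>wt n powr (- s)\<close> and
  \<open>wt n powr s\<close>. Choices of \<open>d\<close> and \<open>A\<close> give the bound on a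
  single coefficient, absolute summability for \<open>s > 1/2\<close>, the aliasing tails, and the
  convergence of matrix rows.\<close>

lemma Hs_duality:
  assumes g: "g \<in> Hs s" and d: "(\<lambda>n. sob_weight (- s) n * (d n)\<^sup>2) summable_on A" and nn: "\<And>n. 0 \<le> d n"
  shows "(\<lambda>n. d n * norm (fcoeff g n)) summable_on A"
    and "(\<Sum>\<^sub>\<infinity>n\<in>A. d n * norm (fcoeff g n)) \<le> sqrt (\<Sum>\<^sub>\<infinity>n\<in>A. sob_weight (- s) n * (d n)\<^sup>2) * Hs_norm s g"
proof -
  define a where "a n = wt n powr (- s) * d n" for n
  define b where "b n = wt n powr s * norm (fcoeff g n)" for n
  have sq: "(x powr t)\<^sup>2 = x powr (2 * t)" if "x > 0" for x t :: real
    using that by (simp add: power2_eq_square flip: powr_add)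
  have a2: "(a n)\<^sup>2 = sob_weight (- s) n * (d n)\<^sup>2" and b2: "(b n)\<^sup>2 = sob_weight s n * (norm (fcoeff g n))\<^sup>2" for n
    using sq[of "wt n" "- s"] sq[of "wt n" s]
    by (simp_all add: a_def b_def power_mult_distrib sob_weight_wt)
  have ab: "a n * b n = d n * norm (fcoeff g n)" for n
  proof -
    have "wt n powr (- s) * wt n powr s = 1" by (simp flip: powr_add)
    then show ?thesis by (simp add: a_def b_def)
  qed
  have s1: "(\<lambda>n. (a n)\<^sup>2) summable_on A" using d by (simp add: a2)
  have s2: "(\<lambda>n. (b n)\<^sup>2) summable_on A"
    unfolding b2 by (rule summable_on_subset[OF Hs_summable[OF g]]) simp
  have nn': "\<And>n. 0 \<le> a n" "\<And>n. 0 \<le> b n" using nn by (auto simp: a_def b_def)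
  show "(\<lambda>n. d n * norm (fcoeff g n)) summable_on A"
    using infsum_Cauchy_Schwarz(1)[OF s1 s2 nn'] by (simp add: ab)
  have "infsum (\<lambda>n. (b n)\<^sup>2) A \<le> infsum (\<lambda>n. (b n)\<^sup>2) UNIV"
    by (rule infsum_mono2) (use Hs_summable[OF g] s2 in \<open>auto simp: b2\<close>)
  \<comment> \<open>\<open>Hs_norm\<close> carries the factor \<open>2 * pi\<close>, which is at
    least 1 and is simply given away.\<close>
  also have "\<dots> \<le> 2 * pi * infsum (\<lambda>n. (b n)\<^sup>2) UNIV"
    using pi_ge_two mult_right_mono[of 1 "2 * pi" "infsum (\<lambda>n. (b n)\<^sup>2) UNIV"] by (simp add: infsum_nonneg)
  finally have "sqrt (infsum (\<lambda>n. (b n)\<^sup>2) A) \<le> Hs_norm s g"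
    by (simp add: Hs_norm_def b2)
  then show "(\<Sum>\<^sub>\<infinity>n\<in>A. d n * norm (fcoeff g n)) \<le> sqrt (\<Sum>\<^sub>\<infinity>n\<in>A. sob_weight (- s) n * (d n)\<^sup>2) * Hs_norm s g"
    using infsum_Cauchy_Schwarz(2)[OF s1 s2 nn']
    by (simp add: ab a2) (meson mult_left_mono order_trans infsum_nonneg real_sqrt_ge_zero sob_weight_nonneg zero_le_power2 mult_nonneg_nonneg)
qed

lemma norm_fcoeff_le:
  assumes "g \<in> Hs s"
  shows "norm (fcoeff g n) \<le> Hs_norm s g * wt n powr (- s)"
proof -
  have "(\<Sum>\<^sub>\<infinity>m\<in>{n}. 1 * norm (fcoeff g m)) \<le> sqrt (\<Sum>\<^sub>\<infinity>m\<in>{n}. sob_weight (- s) m * 1\<^sup>2) * Hs_norm s g"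
    by (rule Hs_duality(2)[OF assms]) auto
  moreover have "sqrt (sob_weight (- s) n) = wt n powr (- s)"
    by (simp add: sob_weight_wt powr_half_sqrt[symmetric] powr_powr)
  ultimately show ?thesis by (simp add: mult.commute)
qed

text \<open>\<open>K\<close> carries the dependence on the data and \<open>e\<close> a fixed decay,
  so that the second conclusion is directly an operator bound.\<close>

lemma Hs_from_decay:
  assumes g: "g \<in> pdist" and b: "\<And>n. norm (fcoeff g n) \<le> K * e n"
    and e: "(\<lambda>n. sob_weight s n * (e n)\<^sup>2) summable_on UNIV"
    and K: "0 \<le> K" and e0: "\<And>n. 0 \<le> e n"
  shows "g \<in> Hs s"
    and "Hs_norm s g \<le> sqrt (2 * pi * (\<Sum>\<^sub>\<infinity>n. sob_weight s n * (e n)\<^sup>2)) * K"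
proof -
  have b2: "sob_weight s n * (norm (fcoeff g n))\<^sup>2 \<le> K\<^sup>2 * (sob_weight s n * (e n)\<^sup>2)" for n
    using mult_left_mono[OF power_mono[OF b norm_ge_zero, of n 2], of "sob_weight s n"]
    by (simp add: power_mult_distrib mult_ac)
  show H: "g \<in> Hs s"
    by (rule HsI[OF g summable_on_comparison_test[OF summable_on_cmult_right[OF e] b2]]) simp
  have "(Hs_norm s g)\<^sup>2 \<le> 2 * pi * (\<Sum>\<^sub>\<infinity>n. K\<^sup>2 * (sob_weight s n * (e n)\<^sup>2))"
    unfolding Hs_norm_square
    by (intro mult_left_mono infsum_mono Hs_summable[OF H] summable_on_cmult_right[OF e] b2) simp
  also have "\<dots> = (2 * pi * (\<Sum>\<^sub>\<infinity>n. sob_weight s n * (e n)\<^sup>2)) * K\<^sup>2"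
    by (simp add: infsum_cmult_right')
  finally have "sqrt ((Hs_norm s g)\<^sup>2) \<le> sqrt ((2 * pi * (\<Sum>\<^sub>\<infinity>n. sob_weight s n * (e n)\<^sup>2)) * K\<^sup>2)"
    by (rule real_sqrt_le_mono)
  then show "Hs_norm s g \<le> sqrt (2 * pi * (\<Sum>\<^sub>\<infinity>n. sob_weight s n * (e n)\<^sup>2)) * K"
    using K by (simp add: real_sqrt_mult)
qed

text \<open>Truncated Fourier sums of \<open>f\<close> converge to it in \<open>Hs0 s\<close>, so a
  bounded functional is determined by its values on the modes. It is applied with \<Phi> a single
  output coefficient of an operator.\<close>

lemma bounded_functional_expansion:
  fixes \<Phi> :: "functional \<Rightarrow> complex"
  assumes lin: "\<And>g h a b. g \<in> Hs0 s \<Longrightarrow> h \<in> Hs0 s \<Longrightarrow> \<Phi> (\<lambda>\<phi>. a * g \<phi> + b * h \<phi>) = a * \<Phi> g + b * \<Phi> h"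
    and bd: "\<And>g. g \<in> Hs0 s \<Longrightarrow> norm (\<Phi> g) \<le> C * Hs_norm s g"
    and f: "f \<in> Hs0 s"
  shows "((\<lambda>m. fcoeff f m * \<Phi> (dist_of (fmode m))) has_sum \<Phi> f) UNIV"
proof -
  define T where "T F = (\<Sum>\<^sub>\<infinity>n\<in>-F. sob_weight s n * (norm (fcoeff f n))\<^sup>2)" for F
  have fin: "(\<lambda>\<phi>. \<Sum>m\<in>F. fcoeff f m * dist_of (fmode m) \<phi>) \<in> Hs0 s \<and>
      \<Phi> (\<lambda>\<phi>. \<Sum>m\<in>F. fcoeff f m * dist_of (fmode m) \<phi>) = (\<Sum>m\<in>F. fcoeff f m * \<Phi> (dist_of (fmode m)))"
    if "finite F" "0 \<notin> F" for F
    using that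
  proof induction
    case empty
    show ?case using lin[OF f f, of 0 0] zero_in_Hs0 by simp
  next
    case (insert m F)
    then have IH: "(\<lambda>\<phi>. \<Sum>m\<in>F. fcoeff f m * dist_of (fmode m) \<phi>) \<in> Hs0 s"
      "\<Phi> (\<lambda>\<phi>. \<Sum>m\<in>F. fcoeff f m * dist_of (fmode m) \<phi>) = (\<Sum>m\<in>F. fcoeff f m * \<Phi> (dist_of (fmode m)))"
      and m: "dist_of (fmode m) \<in> Hs0 s" by (auto intro: fmode_in_Hs0)
    show ?case
      using Hs0_comb[OF m IH(1), of "fcoeff f m" 1] lin[OF m IH(1), of "fcoeff f m" 1] IH(2) insert.hyps by simp
  qed
  have "norm ((\<Sum>m\<in>F. fcoeff f m * \<Phi> (dist_of (fmode m))) - \<Phi> f) \<le> \<bar>C\<bar> * sqrt (2 * pi * T F)" if F: "finite F" for F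
  proof -
    \<comment> \<open>The mode 0 is left out because the constant is not in \<open>Hs0 s\<close>;
      nothing is lost, as \<open>f\<close> has mean zero.\<close>
    let ?p = "\<lambda>\<phi>. \<Sum>m\<in>F-{0}. fcoeff f m * dist_of (fmode m) \<phi>"
    have p: "?p \<in> Hs0 s" "\<Phi> ?p = (\<Sum>m\<in>F-{0}. fcoeff f m * \<Phi> (dist_of (fmode m)))"
      using fin[of "F - {0}"] F by auto
    have "(\<Sum>m\<in>F-{0}. fcoeff f m * \<Phi> (dist_of (fmode m))) = (\<Sum>m\<in>F. fcoeff f m * \<Phi> (dist_of (fmode m)))"
      by (rule sum.mono_neutral_left) (use F Hs0_fcoeff[OF f] in auto)
    then have e: "(\<Sum>m\<in>F. fcoeff f m * \<Phi> (dist_of (fmode m))) - \<Phi> f = \<Phi> (\<lambda>\<phi>. 1 * ?p \<phi> + (- 1) * f \<phi>)"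
      unfolding lin[OF p(1) f] p(2) by simp
    have co: "fcoeff (\<lambda>\<phi>. 1 * ?p \<phi> + (- 1) * f \<phi>) n = (if n \<in> F then 0 else - fcoeff f n)" for n
      unfolding fcoeff_lincomb fcoeff_finite_sum fcoeff_fmode
      using F Hs0_fcoeff[OF f] by (auto simp: sum.delta if_distrib cong: if_cong)
    have "(\<Sum>\<^sub>\<infinity>n. sob_weight s n * (norm (fcoeff (\<lambda>\<phi>. 1 * ?p \<phi> + (- 1) * f \<phi>) n))\<^sup>2) = T F"
      unfolding T_def co by (rule infsum_cong_neutral) auto
    then have "Hs_norm s (\<lambda>\<phi>. 1 * ?p \<phi> + (- 1) * f \<phi>) = sqrt (2 * pi * T F)"
      by (simp add: Hs_norm_def)
    moreover have "norm (\<Phi> (\<lambda>\<phi>. 1 * ?p \<phi> + (- 1) * f \<phi>)) \<le> C * Hs_norm s (\<lambda>\<phi>. 1 * ?p \<phi> + (- 1) * f \<phi>)"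
      by (rule bd[OF Hs0_comb[OF p(1) f]])
    moreover have "\<dots> \<le> \<bar>C\<bar> * Hs_norm s (\<lambda>\<phi>. 1 * ?p \<phi> + (- 1) * f \<phi>)"
      by (intro mult_right_mono) auto
    ultimately show ?thesis unfolding e by simp
  qed
  moreover have "((\<lambda>F. \<bar>C\<bar> * sqrt (2 * pi * T F)) \<longlongrightarrow> 0) (finite_subsets_at_top UNIV)"
  proof -
    have "((\<lambda>F. \<bar>C\<bar> * sqrt (2 * pi * T F)) \<longlongrightarrow> \<bar>C\<bar> * sqrt (2 * pi * 0)) (finite_subsets_at_top UNIV)"
      unfolding T_def by (intro tendsto_intros infsum_tail_tendsto_0 Hs_summable[OF Hs0_Hs[OF f]])
    then show ?thesis by simp
  qed
  ultimately have "((\<lambda>F. (\<Sum>m\<in>F. fcoeff f m * \<Phi> (dist_of (fmode m))) - \<Phi> f) \<longlongrightarrow> 0) (finite_subsets_at_top UNIV)"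
    by (rule Lim_null_comparison[OF eventually_finite_subsets_at_top_weakI])
  then show ?thesis unfolding has_sum_def using LIM_zero_cancel by blast
qed

text \<open>With \<open>r = root N q\<close> and \<open>N\<close> at least \<open>a\<close>, the
  product is at most the \<open>N\<close>-th power of \<open>wt n * r ^ nat \<bar>n\<bar>\<close>,
  which is bounded because \<open>k r^k\<close> tends to 0.\<close>

lemma geometric_wt_bound:
  assumes "0 < q" "q < (1::real)"
  obtains C where "\<And>n. wt n powr a * q ^ nat \<bar>n\<bar> \<le> C"
proof -
  define N where "N = Suc (nat \<lceil>a\<rceil>)"
  have N: "N > 0" "a \<le> real N" unfolding N_def by linarith+
  define r where "r = root N q"
  have r: "0 < r" "r < 1" "r ^ N = q" using assms N by (auto simp: r_def)
  have "(\<lambda>k. real k * r ^ k) \<longlonglongrightarrow> 0" using powser_times_n_limit_0[of r] r by simp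
  then obtain B where B: "\<And>k. norm (real k * r ^ k) \<le> B"
    using convergent_imp_Bseq[of "\<lambda>k. real k * r ^ k"] unfolding convergent_def Bseq_def by blast
  have "wt n powr a * q ^ nat \<bar>n\<bar> \<le> (max 1 B) ^ N" for n
  proof -
    have "wt n * r ^ nat \<bar>n\<bar> \<le> max 1 B"
    proof (cases "n = 0")
      case False
      then show ?thesis using B[of "nat \<bar>n\<bar>"] r by (simp add: wt_nonzero)
    qed simp
    then have "(wt n * r ^ nat \<bar>n\<bar>) ^ N \<le> (max 1 B) ^ N"
      using r by (intro power_mono) (auto simp: less_imp_le)
    moreover have "(wt n * r ^ nat \<bar>n\<bar>) ^ N = wt n ^ N * q ^ nat \<bar>n\<bar>"
      by (simp add: power_mult_distrib r(3)[symmetric] power_mult[symmetric] mult.commute)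
    moreover have "wt n powr a * q ^ nat \<bar>n\<bar> \<le> wt n ^ N * q ^ nat \<bar>n\<bar>"
      using powr_mono[OF N(2) wt_ge_1[of n]] assms by (intro mult_right_mono) (auto simp: powr_realpow)
    ultimately show ?thesis by simp
  qed
  then show ?thesis by (rule that)
qed

lemma summable_geometric_wt:
  assumes q: "0 < q" "q < (1::real)"
  shows "(\<lambda>n::int. wt n powr a * q ^ nat \<bar>n\<bar>) summable_on UNIV"
proof -
  obtain C where C: "\<And>n. wt n powr (a + 2) * q ^ nat \<bar>n\<bar> \<le> C"
    using geometric_wt_bound[OF q] by blast
  show ?thesis
  proof (rule summable_on_comparison_test)
    show "(\<lambda>n. C * wt n powr (- 2)) summable_on UNIV"
      by (intro summable_on_cmult_right summable_wt_powr) simp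
    fix n
    have "wt n powr a = wt n powr (a + 2) * wt n powr (- 2)" by (simp flip: powr_add)
    then have "wt n powr a * q ^ nat \<bar>n\<bar> = (wt n powr (a + 2) * q ^ nat \<bar>n\<bar>) * wt n powr (- 2)" by simp
    also have "\<dots> \<le> C * wt n powr (- 2)" by (intro mult_right_mono C) simp
    finally show "wt n powr a * q ^ nat \<bar>n\<bar> \<le> C * wt n powr (- 2)" .
  qed (use q in auto)
qed

section \<open>Smooth functions on the plane\<close>

lemma px_eqI: "(v has_derivative D) (at z) \<Longrightarrow> px v z = D 1"
  and py_eqI: "(v has_derivative D) (at z) \<Longrightarrow> py v z = D \<i>"
  unfolding px_def py_def by (simp_all add: frechet_derivative_at[symmetric])

lemma px_py_has_derivative:
  assumes "v differentiable (at z)"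
  shows "(v has_derivative (\<lambda>h. of_real (Re h) * px v z + of_real (Im h) * py v z)) (at z)"
proof -
  let ?D = "frechet_derivative v (at z)"
  have D: "(v has_derivative ?D) (at z)" using assms by (rule frechet_derivative_works[THEN iffD1])
  interpret D: bounded_linear ?D using D by (rule has_derivative_bounded_linear)
  have "?D h = of_real (Re h) * px v z + of_real (Im h) * py v z" for h
  proof -
    have "h = Re h *\<^sub>R 1 + Im h *\<^sub>R \<i>" by (simp add: complex_eq_iff)
    then have "?D h = Re h *\<^sub>R ?D 1 + Im h *\<^sub>R ?D \<i>" by (metis D.add D.scaleR)
    then show ?thesis by (simp add: px_def py_def scaleR_conv_of_real)
  qed
  then have "?D = (\<lambda>h. of_real (Re h) * px v z + of_real (Im h) * py v z)" by blast
  then show ?thesis using D by simp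
qed

lemma
  assumes "u differentiable (at z)" "v differentiable (at z)"
  shows px_add: "px (\<lambda>z. u z + v z) z = px u z + px v z"
    and py_add: "py (\<lambda>z. u z + v z) z = py u z + py v z"
    and px_mult: "px (\<lambda>z. u z * v z) z = u z * px v z + px u z * v z"
    and py_mult: "py (\<lambda>z. u z * v z) z = u z * py v z + py u z * v z"
  using px_eqI[OF has_derivative_add[OF px_py_has_derivative px_py_has_derivative, OF assms]]
    py_eqI[OF has_derivative_add[OF px_py_has_derivative px_py_has_derivative, OF assms]]
    px_eqI[OF has_derivative_mult[OF px_py_has_derivative px_py_has_derivative, OF assms]]
    py_eqI[OF has_derivative_mult[OF px_py_has_derivative px_py_has_derivative, OF assms]]
  by simp_all

lemma
  assumes "v differentiable (at z)"
  shows px_cnj: "px (\<lambda>z. cnj (v z)) z = cnj (px v z)"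
    and py_cnj: "py (\<lambda>z. cnj (v z)) z = cnj (py v z)"
    and differentiable_cnj: "(\<lambda>z. cnj (v z)) differentiable (at z)"
proof -
  have d: "((\<lambda>z. cnj (v z)) has_derivative (\<lambda>h. cnj (of_real (Re h) * px v z + of_real (Im h) * py v z))) (at z)"
    by (rule bounded_linear.has_derivative[OF bounded_linear_cnj px_py_has_derivative[OF assms]])
  show "px (\<lambda>z. cnj (v z)) z = cnj (px v z)" "py (\<lambda>z. cnj (v z)) z = cnj (py v z)"
    using px_eqI[OF d] py_eqI[OF d] by simp_all
  show "(\<lambda>z. cnj (v z)) differentiable (at z)" using d by (rule differentiableI)
qed

lemma
  assumes "(v has_field_derivative d) (at z)"
  shows px_holomorphic: "px v z = d" and py_holomorphic: "py v z = \<i> * d"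
  using px_eqI[OF assms[unfolded has_field_derivative_def]] py_eqI[OF assms[unfolded has_field_derivative_def]]
  by simp_all

lemma px_const [simp]: "px (\<lambda>_. c) = (\<lambda>_. 0)" and py_const [simp]: "py (\<lambda>_. c) = (\<lambda>_. 0)"
  using px_holomorphic[of "\<lambda>_. c" 0] py_holomorphic[of "\<lambda>_. c" 0] by fastforce+

lemma Ck_plane_Suc_imp: "Ck_plane (Suc k) v \<Longrightarrow> Ck_plane k v"
proof (induction k arbitrary: v)
  case 0
  then show ?case
    by (auto intro!: continuous_at_imp_continuous_on differentiable_imp_continuous_within)
next
  case (Suc k)
  then show ?case by (metis Ck_plane.simps(2))
qed

lemma Ck_plane_const: "Ck_plane k (\<lambda>_. c)"
  by (induction k arbitrary: c) auto

lemma Ck_plane_add: "Ck_plane k u \<Longrightarrow> Ck_plane k v \<Longrightarrow> Ck_plane k (\<lambda>z. u z + v z)"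
proof (induction k arbitrary: u v)
  case (Suc k)
  have "px (\<lambda>z. u z + v z) = (\<lambda>z. px u z + px v z)" "py (\<lambda>z. u z + v z) = (\<lambda>z. py u z + py v z)"
    using Suc.prems by (auto simp: px_add py_add)
  then show ?case using Suc by (auto intro: differentiable_add)
qed (auto intro: continuous_intros)

lemma Ck_plane_mult: "Ck_plane k u \<Longrightarrow> Ck_plane k v \<Longrightarrow> Ck_plane k (\<lambda>z. u z * v z)"
proof (induction k arbitrary: u v)
  case (Suc k)
  have "px (\<lambda>z. u z * v z) = (\<lambda>z. u z * px v z + px u z * v z)" "py (\<lambda>z. u z * v z) = (\<lambda>z. u z * py v z + py u z * v z)"
    using Suc.prems by (auto simp: px_mult py_mult)
  moreover have "Ck_plane k u" "Ck_plane k v" using Suc.prems Ck_plane_Suc_imp by blast+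
  ultimately show ?case using Suc by (auto intro!: Ck_plane_add differentiable_mult)
qed (auto intro: continuous_intros)

lemma Ck_plane_cnj: "Ck_plane k v \<Longrightarrow> Ck_plane k (\<lambda>z. cnj (v z))"
proof (induction k arbitrary: v)
  case (Suc k)
  have "px (\<lambda>z. cnj (v z)) = (\<lambda>z. cnj (px v z))" "py (\<lambda>z. cnj (v z)) = (\<lambda>z. cnj (py v z))"
    using Suc.prems by (auto simp: px_cnj py_cnj)
  then show ?case using Suc by (auto intro!: differentiable_cnj)
qed (auto intro: continuous_intros)

lemma px_id: "px (\<lambda>z. z) = (\<lambda>_. 1)" and py_id: "py (\<lambda>z. z) = (\<lambda>_. \<i>)"
  using px_holomorphic[OF DERIV_ident] py_holomorphic[OF DERIV_ident] by fastforce+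

lemma Ck_plane_id: "Ck_plane k (\<lambda>z. z)"
  by (induction k) (auto simp: px_id py_id Ck_plane_const)

lemma smooth_plane_const [simp, intro]: "smooth_plane (\<lambda>_. c)"
  and smooth_plane_add [intro]: "smooth_plane u \<Longrightarrow> smooth_plane v \<Longrightarrow> smooth_plane (\<lambda>z. u z + v z)"
  and smooth_plane_mult [intro]: "smooth_plane u \<Longrightarrow> smooth_plane v \<Longrightarrow> smooth_plane (\<lambda>z. u z * v z)"
  and smooth_plane_cnj [intro]: "smooth_plane v \<Longrightarrow> smooth_plane (\<lambda>z. cnj (v z))"
  and smooth_plane_id [simp, intro]: "smooth_plane (\<lambda>z. z)"
  by (simp_all add: smooth_plane_def Ck_plane_const Ck_plane_add Ck_plane_mult Ck_plane_cnj Ck_plane_id)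

lemma smooth_plane_px [intro]: "smooth_plane v \<Longrightarrow> smooth_plane (px v)"
  and smooth_plane_py [intro]: "smooth_plane v \<Longrightarrow> smooth_plane (py v)"
  unfolding smooth_plane_def by (metis Ck_plane.simps(2))+

lemma smooth_plane_differentiable: "smooth_plane v \<Longrightarrow> v differentiable (at z)"
  unfolding smooth_plane_def by (metis Ck_plane.simps(2))

lemma smooth_plane_continuous: "smooth_plane v \<Longrightarrow> continuous_on S v"
  unfolding smooth_plane_def by (metis Ck_plane.simps(1) continuous_on_subset subset_UNIV)

lemma smooth_plane_lincomb: "smooth_plane u \<Longrightarrow> smooth_plane v \<Longrightarrow> smooth_plane (\<lambda>z. a * u z + b * v z)"
  by (intro smooth_plane_add smooth_plane_mult smooth_plane_const)

lemma smooth_plane_diff [intro]: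
  assumes "smooth_plane u" "smooth_plane v"
  shows "smooth_plane (\<lambda>z. u z - v z)"
  using smooth_plane_lincomb[OF assms, of 1 "- 1"] by simp

lemma smooth_plane_sum [intro]: "(\<And>i. i \<in> F \<Longrightarrow> smooth_plane (f i)) \<Longrightarrow> smooth_plane (\<lambda>z. \<Sum>i\<in>F. f i z)"
  by (induction F rule: infinite_finite_induct) auto

lemma smooth_plane_power [intro]: "smooth_plane v \<Longrightarrow> smooth_plane (\<lambda>z. v z ^ n)"
  by (induction n) auto

lemma smooth_plane_Re [simp, intro]: "smooth_plane (\<lambda>z. of_real (Re z))"
  and smooth_plane_Im [simp, intro]: "smooth_plane (\<lambda>z. of_real (Im z))"
proof -
  have "smooth_plane (\<lambda>z. (1/2) * z + (1/2) * cnj z)" "smooth_plane (\<lambda>z. (- \<i>/2) * z + (\<i>/2) * cnj z)"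
    by (intro smooth_plane_lincomb smooth_plane_id smooth_plane_cnj)+
  moreover have "(1/2) * z + (1/2) * cnj z = of_real (Re z)" "(- \<i>/2) * z + (\<i>/2) * cnj z = of_real (Im z)" for z
    by (simp_all add: complex_eq_iff)
  ultimately show "smooth_plane (\<lambda>z. of_real (Re z))" "smooth_plane (\<lambda>z. of_real (Im z))" by simp_all
qed

lemma
  assumes "smooth_plane u" "smooth_plane v"
  shows px_lincomb: "px (\<lambda>z. a * u z + b * v z) = (\<lambda>z. a * px u z + b * px v z)"
    and py_lincomb: "py (\<lambda>z. a * u z + b * v z) = (\<lambda>z. a * py u z + b * py v z)"
proof -
  have d: "(\<lambda>z. c) differentiable (at z)" "u differentiable (at z)" "v differentiable (at z)"
    "(\<lambda>z. c * u z) differentiable (at z)" "(\<lambda>z. c * v z) differentiable (at z)" for c z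
    using assms by (auto intro!: smooth_plane_differentiable)
  show "px (\<lambda>z. a * u z + b * v z) = (\<lambda>z. a * px u z + b * px v z)"
    "py (\<lambda>z. a * u z + b * v z) = (\<lambda>z. a * py u z + b * py v z)"
    by (simp_all add: fun_eq_iff px_add py_add px_mult py_mult d)
qed

lemma
  assumes "smooth_plane u" "smooth_plane v"
  shows px_diff: "px (\<lambda>z. u z - v z) = (\<lambda>z. px u z - px v z)"
    and py_diff: "py (\<lambda>z. u z - v z) = (\<lambda>z. py u z - py v z)"
  using px_lincomb[OF assms, of 1 "- 1"] py_lincomb[OF assms, of 1 "- 1"] by simp_all

lemma
  assumes "smooth_plane v"
  shows px_smooth_cnj: "px (\<lambda>z. cnj (v z)) = (\<lambda>z. cnj (px v z))"
    and py_smooth_cnj: "py (\<lambda>z. cnj (v z)) = (\<lambda>z. cnj (py v z))"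
  using smooth_plane_differentiable[OF assms] by (simp_all add: fun_eq_iff px_cnj py_cnj)

lemma
  assumes "smooth_plane u" "smooth_plane v"
  shows px_smooth_mult: "px (\<lambda>z. u z * v z) = (\<lambda>z. u z * px v z + px u z * v z)"
    and py_smooth_mult: "py (\<lambda>z. u z * v z) = (\<lambda>z. u z * py v z + py u z * v z)"
  using smooth_plane_differentiable assms by (auto simp: px_mult py_mult)

lemma
  assumes "\<And>i. i \<in> F \<Longrightarrow> smooth_plane (f i)"
  shows px_sum: "px (\<lambda>z. \<Sum>i\<in>F. c i * f i z) = (\<lambda>z. \<Sum>i\<in>F. c i * px (f i) z)"
    and py_sum: "py (\<lambda>z. \<Sum>i\<in>F. c i * f i z) = (\<lambda>z. \<Sum>i\<in>F. c i * py (f i) z)"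
proof -
  have "px (\<lambda>z. \<Sum>i\<in>F. c i * f i z) = (\<lambda>z. \<Sum>i\<in>F. c i * px (f i) z) \<and>
      py (\<lambda>z. \<Sum>i\<in>F. c i * f i z) = (\<lambda>z. \<Sum>i\<in>F. c i * py (f i) z)"
    using assms
  proof (induction F rule: infinite_finite_induct)
    case (insert i F)
    have s: "smooth_plane (\<lambda>z. \<Sum>i\<in>F. c i * f i z)" "smooth_plane (f i)"
      using insert.prems by (auto intro!: smooth_plane_sum smooth_plane_mult)
    show ?case
      using px_lincomb[OF s(2,1), of "c i" 1] py_lincomb[OF s(2,1), of "c i" 1] insert by simp
  qed auto
  then show "px (\<lambda>z. \<Sum>i\<in>F. c i * f i z) = (\<lambda>z. \<Sum>i\<in>F. c i * px (f i) z)"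
    "py (\<lambda>z. \<Sum>i\<in>F. c i * f i z) = (\<lambda>z. \<Sum>i\<in>F. c i * py (f i) z)" by auto
qed

lemma px_Re: "px (\<lambda>z. of_real (Re z)) = (\<lambda>_. 1)" and py_Im: "py (\<lambda>z. of_real (Im z)) = (\<lambda>_. 1)"
proof -
  have "((\<lambda>z. complex_of_real (Re z)) has_derivative (\<lambda>h. of_real (Re h))) (at z)"
    "((\<lambda>z. complex_of_real (Im z)) has_derivative (\<lambda>h. of_real (Im h))) (at z)" for z
    by (auto intro!: derivative_eq_intros)
  from px_eqI[OF this(1)] py_eqI[OF this(2)]
  show "px (\<lambda>z. of_real (Re z)) = (\<lambda>_. 1)" "py (\<lambda>z. of_real (Im z)) = (\<lambda>_. 1)" by auto
qed

lemma smooth_circle_per_test: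
  assumes "smooth_plane v"
  shows "(\<lambda>\<theta>. v (cis \<theta>)) \<in> per_test"
proof -
  \<comment> \<open>\<open>A\<close> is the angular derivative x d/dy - y d/dx. It maps smooth
    functions of the plane to such, so the \<open>k\<close>-th derivative of the boundary values is
    the restriction of \<open>(A ^^ k) v\<close>.\<close>
  define A where "A w = (\<lambda>z. of_real (Re z) * py w z + (- 1) * (of_real (Im z) * px w z))" for w
  have A: "smooth_plane ((A ^^ k) v)" for k
  proof (induction k)
    case (Suc k)
    show ?case
      unfolding funpow.simps o_def A_def[of "(A ^^ k) v"]
      by (intro smooth_plane_add smooth_plane_mult smooth_plane_const smooth_plane_Re smooth_plane_Im
          smooth_plane_px smooth_plane_py Suc)
  qed (simp add: assms)
  define D where "D k \<theta> = (A ^^ k) v (cis \<theta>)" for k \<theta>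
  have "(D k has_vector_derivative D (Suc k) \<theta>) (at \<theta>)" for k \<theta>
  proof -
    let ?w = "(A ^^ k) v"
    have c: "(cis has_vector_derivative \<i> * cis \<theta>) (at \<theta>)"
      using fmode_has_vector_derivative[of 1 \<theta> UNIV] by (simp add: fmode_eq_cis[abs_def])
    have "((?w \<circ> cis) has_derivative
        ((\<lambda>h. of_real (Re h) * px ?w (cis \<theta>) + of_real (Im h) * py ?w (cis \<theta>)) \<circ> (\<lambda>x. x *\<^sub>R (\<i> * cis \<theta>)))) (at \<theta>)"
      by (intro diff_chain_at c[unfolded has_vector_derivative_def] px_py_has_derivative
          smooth_plane_differentiable A)
    then show ?thesis
      unfolding has_vector_derivative_def D_def o_def[of ?w cis]
      by (rule has_derivative_eq_rhs) (simp add: A_def o_def fun_eq_iff algebra_simps scaleR_conv_of_real)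
  qed
  then have "D 0 \<in> per_test"
    by (intro per_testI[of D]) (auto simp: D_def cis_mult[symmetric] simp flip: add.commute)
  then show ?thesis by (simp add: D_def[abs_def])
qed

section \<open>The divergence theorem on the disk\<close>

abbreviation DD :: "complex measure" where "DD \<equiv> lebesgue_on disk"

lemma finite_measure_disk: "finite_measure DD"
  by (rule finite_measure_lebesgue_on) simp

lemma continuous_disk_bounded:
  fixes f :: "complex \<Rightarrow> 'a::real_normed_vector"
  assumes "continuous_on UNIV f"
  obtains B where "B > 0" "\<And>z. norm z \<le> 1 \<Longrightarrow> norm (f z) \<le> B"
proof -
  have "bounded (f ` cball 0 1)"
    by (intro compact_imp_bounded compact_continuous_image continuous_on_subset[OF assms]) auto
  then show ?thesis using that unfolding bounded_pos by auto
qed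

lemma continuous_measurable_disk:
  fixes f :: "complex \<Rightarrow> 'a::euclidean_space"
  assumes "continuous_on UNIV f"
  shows "f \<in> borel_measurable DD"
  by (rule continuous_imp_measurable_on_sets_lebesgue) (auto intro: continuous_on_subset[OF assms])

lemma continuous_integrable_disk:
  fixes f :: "complex \<Rightarrow> 'a::euclidean_space"
  assumes "continuous_on UNIV f"
  shows "integrable DD f"
proof -
  obtain B where "B > 0" "\<And>z. norm z \<le> 1 \<Longrightarrow> norm (f z) \<le> B" using continuous_disk_bounded[OF assms] by blast
  then show ?thesis
    by (intro finite_measure.integrable_const_bound[OF finite_measure_disk, of _ B] continuous_measurable_disk assms AE_I2) auto
qed

lemma smooth_integrable: "smooth_plane v \<Longrightarrow> integrable DD v"
  by (intro continuous_integrable_disk smooth_plane_continuous)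

lemma smooth_sq_integrable: "smooth_plane v \<Longrightarrow> sq_integrable DD v"
  unfolding sq_integrable_def
  by (auto intro!: continuous_integrable_disk continuous_measurable_disk continuous_intros smooth_plane_continuous)

lemma borel_measurable_Complex:
  "(\<lambda>(x, y). Complex x y) \<in> borel_measurable (lborel \<Otimes>\<^sub>M lborel)"
  "(\<lambda>(x, y). Complex y x) \<in> borel_measurable (lborel \<Otimes>\<^sub>M lborel)"
proof -
  have "(\<lambda>(x, y). Complex x y) = (\<lambda>p. of_real (fst p) + \<i> * of_real (snd p))"
    "(\<lambda>(x, y). Complex y x) = (\<lambda>p. of_real (snd p) + \<i> * of_real (fst p))"
    by (auto simp: complex_eq_iff)
  then show "(\<lambda>(x, y). Complex x y) \<in> borel_measurable (lborel \<Otimes>\<^sub>M lborel)"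
    "(\<lambda>(x, y). Complex y x) \<in> borel_measurable (lborel \<Otimes>\<^sub>M lborel)" by simp_all
qed

text \<open>The two measures agree on boxes. Both orders of the coordinates are recorded because
  \<open>disk_px_integral\<close> exchanges the axes.\<close>

lemma lborel_complex_distr:
  shows "distr (lborel \<Otimes>\<^sub>M lborel) borel (\<lambda>(x, y). Complex x y) = lborel"
    and "distr (lborel \<Otimes>\<^sub>M lborel) borel (\<lambda>(x, y). Complex y x) = lborel"
proof -
  note m = borel_measurable_Complex
  have pre: "(\<lambda>(x, y). Complex x y) -` box l u = box (Re l) (Re u) \<times> box (Im l) (Im u)"
    "(\<lambda>(x, y). Complex y x) -` box l u = box (Im l) (Im u) \<times> box (Re l) (Re u)" for l u
    by (auto simp: box_def Basis_complex_def inner_complex_def)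
  have le: "Re l \<le> Re u" "Im l \<le> Im u" if "\<And>b. b \<in> Basis \<Longrightarrow> l \<bullet> b \<le> u \<bullet> b" for l u :: complex
    using that[of 1] that[of \<i>] by (simp_all add: Basis_complex_def inner_complex_def)
  have em: "emeasure (lborel \<Otimes>\<^sub>M lborel) ({a<..<b} \<times> {c<..<d}) = ennreal ((b - a) * (d - c))" if "a \<le> b" "c \<le> d" for a b c d :: real
    using that by (simp add: lborel.emeasure_pair_measure_Times ennreal_mult)
  have pr: "(\<Prod>b\<in>Basis. (u - l) \<bullet> b) = (Re u - Re l) * (Im u - Im l)" for l u :: complex
    by (simp add: Basis_complex_def inner_complex_def)
  show "distr (lborel \<Otimes>\<^sub>M lborel) borel (\<lambda>(x, y). Complex x y) = lborel"
    by (rule lborel_eqI[symmetric])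
      (auto simp: emeasure_distr[OF m(1)] pre space_pair_measure em le pr)
  show "distr (lborel \<Otimes>\<^sub>M lborel) borel (\<lambda>(x, y). Complex y x) = lborel"
    by (rule lborel_eqI[symmetric])
      (auto simp: emeasure_distr[OF m(2)] pre space_pair_measure em le pr mult.commute)
qed

lemma disk_integral_iterated:
  fixes f :: "complex \<Rightarrow> complex"
  assumes f: "continuous_on UNIV f"
  shows "(LINT z|DD. f z) = (LINT x|lborel. LINT y|lborel. indicator (cball 0 1) (Complex x y) *\<^sub>R f (Complex x y))"
    and "(LINT z|DD. f z) = (LINT x|lborel. LINT y|lborel. indicator (cball 0 1) (Complex y x) *\<^sub>R f (Complex y x))"
proof -
  \<comment> \<open>The closed disk replaces the open one, at the cost of a negligible circle: it is
    compact, and so are its slices, on which the fundamental theorem is used later.\<close>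
  let ?g = "\<lambda>z. indicator (cball 0 1) z *\<^sub>R f z"
  have i: "integrable lborel ?g"
    by (intro borel_integrable_compact continuous_on_subset[OF f]) auto
  have "(?g has_integral (LINT z|lborel. ?g z)) UNIV" using i by (rule has_integral_integral_lborel)
  then have "(f has_integral (LINT z|lborel. ?g z)) (cball 0 1)"
    unfolding indicator_scaleR_eq_if has_integral_restrict_UNIV .
  moreover have "(f has_integral (LINT z|lborel. ?g z)) (cball 0 1) \<longleftrightarrow> (f has_integral (LINT z|lborel. ?g z)) disk"
  proof (rule has_integral_spike_set_eq)
    have "negligible (sphere 0 1 :: complex set)"
      using negligible_convex_frontier[of "cball 0 1 :: complex set"] by simp
    then show "negligible {z \<in> cball 0 1 - disk. f z \<noteq> 0}" 
      by (rule negligible_subset) auto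
    have "{z \<in> disk - cball 0 1. f z \<noteq> 0} = {}" by auto
    then show "negligible {z \<in> disk - cball 0 1. f z \<noteq> 0}" by (simp only: negligible_empty)
  qed
  ultimately have "(LINT z|DD. f z) = (LINT z|lborel. ?g z)"
    by (simp add: lebesgue_integral_eq_integral continuous_integrable_disk f integral_unique)
  then have e: "(LINT z|DD. f z) = (LINT z|distr (lborel \<Otimes>\<^sub>M lborel) borel (\<lambda>(x, y). Complex x y). ?g z)"
    "(LINT z|DD. f z) = (LINT z|distr (lborel \<Otimes>\<^sub>M lborel) borel (\<lambda>(x, y). Complex y x). ?g z)"
    by (simp_all only: lborel_complex_distr)
  have gm: "?g \<in> borel_measurable borel" using i by auto
  have i': "integrable (distr (lborel \<Otimes>\<^sub>M lborel) borel (\<lambda>(x, y). Complex x y)) ?g"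
    "integrable (distr (lborel \<Otimes>\<^sub>M lborel) borel (\<lambda>(x, y). Complex y x)) ?g"
    by (simp_all only: lborel_complex_distr i)
  show "(LINT z|DD. f z) = (LINT x|lborel. LINT y|lborel. indicator (cball 0 1) (Complex x y) *\<^sub>R f (Complex x y))"
    unfolding e(1) integral_distr[OF borel_measurable_Complex(1) gm]
    using lborel_pair.integral_fst'[OF i'(1)[unfolded integrable_distr_eq[OF borel_measurable_Complex(1) gm]]]
    by (simp add: case_prod_unfold)
  show "(LINT z|DD. f z) = (LINT x|lborel. LINT y|lborel. indicator (cball 0 1) (Complex y x) *\<^sub>R f (Complex y x))"
    unfolding e(2) integral_distr[OF borel_measurable_Complex(2) gm]
    using lborel_pair.integral_fst'[OF i'(2)[unfolded integrable_distr_eq[OF borel_measurable_Complex(2) gm]]]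
    by (simp add: case_prod_unfold)
qed


lemma lborel_interval_integral:
  fixes f :: "real \<Rightarrow> 'a::euclidean_space"
  assumes "continuous_on {a..b} f"
  shows "(LINT x|lborel. indicator {a..b} x *\<^sub>R f x) = integral {a..b} f"
proof -
  have "integrable lborel (\<lambda>x. indicator {a..b} x *\<^sub>R f x)"
    by (intro borel_integrable_compact assms) auto
  then have "((\<lambda>x. indicator {a..b} x *\<^sub>R f x) has_integral (LINT x|lborel. indicator {a..b} x *\<^sub>R f x)) UNIV"
    by (rule has_integral_integral_lborel)
  then show ?thesis
    unfolding indicator_scaleR_eq_if has_integral_restrict_UNIV by (simp add: integral_unique)
qed

text \<open>The divergence theorem for a vertical field: integrate along vertical chords by the
  fundamental theorem, then parametrize the upper and the lower arc by
  \<open>x = cos \<theta>\<close>.\<close>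

lemma disk_py_integral:
  assumes A: "smooth_plane A"
  shows "(LINT z|DD. py A z) = cint (\<lambda>\<theta>. A (cis \<theta>) * of_real (sin \<theta>))"
proof -
  define s where "s x = sqrt (1 - x\<^sup>2)" for x :: real
  define f1 where "f1 x = A (Complex x (s x))" for x
  define f2 where "f2 x = A (Complex x (- s x))" for x
  have Complex_eq': "Complex (a x) (b x) = of_real (a x) + \<i> * of_real (b x)" for a b :: "real \<Rightarrow> real" and x
    by (simp add: complex_eq_iff)
  have cf: "continuous_on {-1..1} f1" "continuous_on {-1..1} f2"
    unfolding f1_def f2_def s_def Complex_eq'
    by (intro continuous_on_compose2[OF smooth_plane_continuous[OF A, of UNIV]] continuous_intros; simp)+
  have cpy: "continuous_on UNIV (py A)" by (intro smooth_plane_continuous smooth_plane_py A)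
  have inner: "(LINT y|lborel. indicator (cball 0 1) (Complex x y) *\<^sub>R py A (Complex x y)) = indicator {-1..1} x *\<^sub>R (f1 x - f2 x)" for x
  proof (cases "x \<in> {-1..1}")
    case True
    then have x: "0 \<le> 1 - x\<^sup>2" by (auto simp: abs_square_le_1 abs_le_iff)
    then have s0: "0 \<le> s x" by (simp add: s_def)
    have "indicator (cball 0 1) (Complex x y) = (indicator {- s x..s x} y :: real)" for y
    proof -
      have "norm (Complex x y) \<le> 1 \<longleftrightarrow> y\<^sup>2 \<le> 1 - x\<^sup>2" by (simp add: cmod_def algebra_simps)
      also have "\<dots> \<longleftrightarrow> \<bar>y\<bar> \<le> s x" unfolding s_def
        using x real_sqrt_le_iff[of "y\<^sup>2" "1 - x\<^sup>2"] by simp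
      finally show ?thesis by (auto simp: indicator_def abs_le_iff)
    qed
    moreover have c: "continuous_on {- s x..s x} (\<lambda>y. py A (Complex x y))"
      unfolding Complex_eq'[of "\<lambda>_. x" _ "\<lambda>y. y"]
      by (intro continuous_on_compose2[OF cpy] continuous_intros) auto
    moreover have "((\<lambda>y. py A (Complex x y)) has_integral (A (Complex x (s x)) - A (Complex x (- s x)))) {- s x..s x}"
    proof (rule fundamental_theorem_of_calculus)
      fix y
      have d: "((\<lambda>y. Complex x y) has_derivative (\<lambda>h. \<i> * of_real h)) (at y within {- s x..s x})"
      proof -
        have "Complex x = (\<lambda>y. of_real x + \<i> * of_real y)" by (auto simp: complex_eq_iff)
        then show ?thesis by (auto intro!: derivative_eq_intros)
      qed
      have "(A \<circ> Complex x has_derivative (\<lambda>h. of_real (Re h) * px A (Complex x y) + of_real (Im h) * py A (Complex x y)) \<circ> (\<lambda>h. \<i> * of_real h))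
          (at y within {- s x..s x})"
        by (rule diff_chain_within[OF d has_derivative_at_withinI[OF px_py_has_derivative[OF smooth_plane_differentiable[OF A]]]])
      then show "((\<lambda>y. A (Complex x y)) has_vector_derivative py A (Complex x y)) (at y within {- s x..s x})"
        unfolding has_vector_derivative_def o_def[of A]
        by (rule has_derivative_eq_rhs) (simp add: o_def fun_eq_iff scaleR_conv_of_real)
    qed (use s0 in simp)
    ultimately show ?thesis
      using True lborel_interval_integral[OF c] by (simp add: f1_def f2_def integral_unique)
  next
    case False
    have "indicator (cball 0 1) (Complex x y) = (0 :: real)" for y
    proof -
      have "\<bar>x\<bar> \<le> norm (Complex x y)" using abs_Re_le_cmod[of "Complex x y"] by simp
      then show ?thesis using False by (auto simp: indicator_def)
    qed
    then show ?thesis using False by simp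
  qed
  have "(LINT z|DD. py A z) = (LINT x|lborel. indicator {-1..1} x *\<^sub>R (f1 x - f2 x))"
    unfolding disk_integral_iterated(1)[OF cpy] inner ..
  also have "\<dots> = integral {-1..1} f1 - integral {-1..1} f2"
    using cf by (subst lborel_interval_integral) (auto intro!: continuous_intros integral_diff integrable_continuous_interval)
  finally have L: "(LINT z|DD. py A z) = integral {-1..1} f1 - integral {-1..1} f2" .
  have h2: "((\<lambda>\<theta>. - sin \<theta> *\<^sub>R f2 (cos \<theta>)) has_integral (integral {cos (- pi)..cos 0} f2)) {-pi..0}"
    by (rule has_integral_substitution[where c = "-1" and d = 1 and g' = "\<lambda>\<theta>. - sin \<theta>"])
      (use cf in \<open>auto intro!: derivative_eq_intros\<close>)
  \<comment> \<open>On \<open>{0..pi}\<close> the substitution \<open>cos\<close> decreases: the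
    interval \<open>{cos 0..cos pi}\<close> is empty, and the value is minus the integral of
    \<open>f1\<close> over \<open>{-1..1}\<close>.\<close>
  have h1: "((\<lambda>\<theta>. - sin \<theta> *\<^sub>R f1 (cos \<theta>)) has_integral (integral {cos 0..cos pi} f1 - integral {cos pi..cos 0} f1)) {0..pi}"
    by (rule has_integral_substitution_general[of "{}" 0 pi cos "-1" 1])
      (use cf in \<open>auto intro!: derivative_eq_intros continuous_intros\<close>)
  \<comment> \<open>The sign of \<open>sin\<close> tells which arc the point lies on and resolves
    the absolute value.\<close>
  have s_cos: "s (cos \<theta>) = \<bar>sin \<theta>\<bar>" for \<theta>
    by (simp add: s_def sin_squared_eq[symmetric])
  have "((\<lambda>\<theta>. A (cis \<theta>) * of_real (sin \<theta>)) has_integral - integral {-1..1} f2) {-pi..0}"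
  proof (rule has_integral_eq)
    show "((\<lambda>\<theta>. - (- sin \<theta> *\<^sub>R f2 (cos \<theta>))) has_integral - integral {-1..1} f2) {-pi..0}"
      using has_integral_neg[OF h2] by simp
    fix \<theta> assume "\<theta> \<in> {-pi..0}"
    then have "sin \<theta> \<le> 0" using sin_ge_zero[of "- \<theta>"] by simp
    then show "- (- sin \<theta> *\<^sub>R f2 (cos \<theta>)) = A (cis \<theta>) * of_real (sin \<theta>)"
      by (simp add: f2_def s_cos cis.code scaleR_conv_of_real)
  qed
  moreover have "((\<lambda>\<theta>. A (cis \<theta>) * of_real (sin \<theta>)) has_integral integral {-1..1} f1) {0..pi}"
  proof (rule has_integral_eq)
    show "((\<lambda>\<theta>. - (- sin \<theta> *\<^sub>R f1 (cos \<theta>))) has_integral integral {-1..1} f1) {0..pi}"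
      using has_integral_neg[OF h1] by simp
    fix \<theta> assume "\<theta> \<in> {0..pi}"
    then have "sin \<theta> \<ge> 0" using sin_ge_zero[of \<theta>] by simp
    then show "- (- sin \<theta> *\<^sub>R f1 (cos \<theta>)) = A (cis \<theta>) * of_real (sin \<theta>)"
      by (simp add: f1_def s_cos cis.code scaleR_conv_of_real)
  qed
  ultimately have "((\<lambda>\<theta>. A (cis \<theta>) * of_real (sin \<theta>)) has_integral (- integral {-1..1} f2 + integral {-1..1} f1)) {-pi..pi}"
    by (rule has_integral_combine[rotated 2]) auto
  moreover have "continuous_on UNIV (\<lambda>\<theta>. A (cis \<theta>) * of_real (sin \<theta>))"
    by (intro continuous_intros continuous_on_compose2[OF smooth_plane_continuous[OF A, of UNIV]]) auto
  ultimately show ?thesis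
    unfolding L by (simp add: lebesgue_integral_eq_integral[OF cint_integrable] integral_unique)
qed

text \<open>A shift multiplies the Fourier coefficients by phases and leaves the coefficient of
  order 0 alone.\<close>

lemma cint_shift:
  assumes "h \<in> per_test"
  shows "cint (\<lambda>\<theta>. h (\<theta> + c)) = cint h"
proof -
  have s: "(\<lambda>n. norm (pcoeff h n)) summable_on UNIV" using vder_pcoeff_summable[OF assms, of 0] by simp
  have h: "h = fseries (pcoeff h)" using vder_eq_fseries[OF assms, of 0] by simp
  have "h (\<theta> + c) = fseries (\<lambda>n. pcoeff h n * fmode n c) \<theta>" for \<theta>
    by (subst h) (simp add: fseries_def fmode_def exp_add[symmetric] algebra_simps)
  then have "cint (\<lambda>\<theta>. h (\<theta> + c)) = cint (\<lambda>\<theta>. fseries (\<lambda>n. pcoeff h n * fmode n c) \<theta> * fmode (- 0) \<theta>)"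
    by simp
  also have "\<dots> = 2 * pi * pcoeff h 0"
    using s by (subst cint_fseries_fmode) (auto simp: norm_mult)
  also have "\<dots> = cint h" by (simp add: pcoeff_def)
  finally show ?thesis .
qed

text \<open>Obtained from \<open>disk_py_integral\<close> by the reflection \<open>S\<close>, which
  exchanges real and imaginary parts and hence d/dx with d/dy. On the circle
  \<open>S (cis (- \<theta>)) = cis (\<theta> + pi / 2)\<close>, and the shift by a quarter turn
  does not change the integral.\<close>

lemma disk_px_integral:
  assumes A: "smooth_plane A"
  shows "(LINT z|DD. px A z) = cint (\<lambda>\<theta>. A (cis \<theta>) * of_real (cos \<theta>))"
proof -
  define S where "S z = \<i> * cnj z" for z
  define B where "B z = A (S z)" for z
  have dS: "(S has_derivative (\<lambda>h. \<i> * cnj h)) (at z)" for z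
    unfolding S_def by (auto intro!: derivative_eq_intros)
  have dB: "(B has_derivative (\<lambda>h. of_real (Im h) * px A (S z) + of_real (Re h) * py A (S z))) (at z)" for z
  proof -
    have "(A \<circ> S has_derivative (\<lambda>h. of_real (Re h) * px A (S z) + of_real (Im h) * py A (S z)) \<circ> (\<lambda>h. \<i> * cnj h)) (at z)"
      by (rule diff_chain_at[OF dS]) (intro px_py_has_derivative smooth_plane_differentiable A)
    then show ?thesis unfolding B_def[abs_def] o_def[of A]
      by (rule has_derivative_eq_rhs) (simp add: o_def)
  qed
  have "Ck_plane k (\<lambda>z. a (S z))" if "Ck_plane k a" for k a
    using that
  proof (induction k arbitrary: a)
    case 0
    then show ?case unfolding S_def by (auto intro!: continuous_intros continuous_on_compose2[of UNIV a])
  next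
    case (Suc k)
    have d: "((\<lambda>z. a (S z)) has_derivative (\<lambda>h. of_real (Im h) * px a (S z) + of_real (Re h) * py a (S z))) (at z)" for z
    proof -
      have "(a \<circ> S has_derivative (\<lambda>h. of_real (Re h) * px a (S z) + of_real (Im h) * py a (S z)) \<circ> (\<lambda>h. \<i> * cnj h)) (at z)"
        by (rule diff_chain_at[OF dS]) (use Suc.prems in \<open>auto intro!: px_py_has_derivative\<close>)
      then show ?thesis unfolding o_def[of a]
        by (rule has_derivative_eq_rhs) (simp add: o_def)
    qed
    have "px (\<lambda>z. a (S z)) = (\<lambda>z. py a (S z))" "py (\<lambda>z. a (S z)) = (\<lambda>z. px a (S z))"
      using px_eqI[OF d] py_eqI[OF d] by auto
    then show ?case using Suc d by (auto intro: differentiableI)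
  qed
  then have B: "smooth_plane B" using A unfolding smooth_plane_def B_def[abs_def] by blast
  have pyB: "py B z = px A (S z)" for z using py_eqI[OF dB] by simp
  have c: "continuous_on UNIV (px A)" "continuous_on UNIV (\<lambda>z. px A (S z))"
    using smooth_plane_continuous[OF smooth_plane_px[OF A], of UNIV]
    by (auto simp: S_def intro!: continuous_on_compose2[of UNIV "px A"] continuous_intros)
  have "indicator (cball 0 1) (Complex y x) = (indicator (cball 0 1) (Complex x y) :: real)" and "S (Complex x y) = Complex y x" for x y
    by (auto simp: indicator_def cmod_def add.commute S_def complex_eq_iff)
  then have "(LINT z|DD. px A z) = (LINT z|DD. py B z)"
    unfolding pyB disk_integral_iterated(2)[OF c(1)] disk_integral_iterated(1)[OF c(2)] by simp
  also have "\<dots> = cint (\<lambda>\<theta>. B (cis \<theta>) * of_real (sin \<theta>))" by (rule disk_py_integral[OF B])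
  also have "\<dots> = cint (\<lambda>\<theta>. B (cis (- \<theta>)) * of_real (sin (- \<theta>)))"
    using integral_reflect_real[of pi "-pi" "\<lambda>\<theta>. B (cis \<theta>) * of_real (sin \<theta>)"] by simp
  also have "\<dots> = cint (\<lambda>\<theta>. A (cis (\<theta> + pi / 2)) * of_real (cos (\<theta> + pi / 2)))"
  proof -
    have "S (cis (- \<theta>)) = cis (\<theta> + pi / 2)" "sin (- \<theta>) = cos (\<theta> + pi / 2)" for \<theta>
      by (simp_all add: S_def complex_eq_iff cos_add sin_add)
    then show ?thesis unfolding B_def by simp
  qed
  also have "\<dots> = cint (\<lambda>\<theta>. A (cis \<theta>) * of_real (cos \<theta>))"
    using cint_shift[OF smooth_circle_per_test[OF smooth_plane_mult[OF A smooth_plane_Re]], of "pi / 2"] by simp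
  finally show ?thesis .
qed

section \<open>The Dirichlet form\<close>

text \<open>Bilinear, without a conjugate, and on pairs of gradient components rather than on
  functions: the gradients of weak solutions are L^2 limits and in general not of the form
  \<open>px v\<close>, \<open>py v\<close>.\<close>

definition dform :: "(complex \<Rightarrow> complex) \<Rightarrow> (complex \<Rightarrow> complex) \<Rightarrow> (complex \<Rightarrow> complex) \<Rightarrow> (complex \<Rightarrow> complex) \<Rightarrow> complex" where
  "dform p q p' q' = (LINT z|DD. p z * p' z + q z * q' z)"

definition dnorm :: "(complex \<Rightarrow> complex) \<Rightarrow> (complex \<Rightarrow> complex) \<Rightarrow> real" where
  "dnorm p q = sqrt ((l2norm DD p)\<^sup>2 + (l2norm DD q)\<^sup>2)"

abbreviation gform :: "(complex \<Rightarrow> complex) \<Rightarrow> (complex \<Rightarrow> complex) \<Rightarrow> complex" where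
  "gform v w \<equiv> dform (px v) (py v) (px w) (py w)"

abbreviation gnorm :: "(complex \<Rightarrow> complex) \<Rightarrow> real" where
  "gnorm v \<equiv> dnorm (px v) (py v)"

abbreviation sqd :: "(complex \<Rightarrow> complex) \<Rightarrow> bool" where "sqd \<equiv> sq_integrable DD"

lemma dnorm_nonneg [simp]: "0 \<le> dnorm p q"
  by (simp add: dnorm_def)

lemma dnorm_square: "(dnorm p q)\<^sup>2 = (l2norm DD p)\<^sup>2 + (l2norm DD q)\<^sup>2"
  by (simp add: dnorm_def)

lemma l2norm_le_dnorm: "l2norm DD p \<le> dnorm p q" "l2norm DD q \<le> dnorm p q"
  unfolding dnorm_def by (rule real_le_rsqrt; simp)+

lemma dform_commute: "dform p q p' q' = dform p' q' p q"
  by (simp add: dform_def mult.commute)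

lemma dform_eq:
  assumes "sqd p" "sqd q" "sqd p'" "sqd q'"
  shows "dform p q p' q' = (LINT z|DD. p z * p' z) + (LINT z|DD. q z * q' z)"
  unfolding dform_def by (intro Bochner_Integration.integral_add sq_integrable_mult_integrable assms)

lemma dform_cnj_self:
  assumes "sqd p" "sqd q"
  shows "dform p q (\<lambda>z. cnj (p z)) (\<lambda>z. cnj (q z)) = of_real ((dnorm p q)\<^sup>2)"
proof -
  have "(LINT z|DD. u z * cnj (u z)) = of_real ((l2norm DD u)\<^sup>2)" for u
    unfolding l2norm_square integral_complex_of_real[symmetric] complex_norm_square ..
  then show ?thesis
    using dform_eq[OF assms assms[THEN sq_integrable_cnj]] by (simp add: dnorm_square)
qed

lemma dform_Cauchy_Schwarz:
  assumes "sqd p" "sqd q" "sqd p'" "sqd q'"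
  shows "norm (dform p q p' q') \<le> dnorm p q * dnorm p' q'"
proof -
  have cs: "a * b + c * d \<le> sqrt (a\<^sup>2 + c\<^sup>2) * sqrt (b\<^sup>2 + d\<^sup>2)" for a b c d :: real
  proof -
    have "(a * b + c * d)\<^sup>2 \<le> (a\<^sup>2 + c\<^sup>2) * (b\<^sup>2 + d\<^sup>2)"
      using zero_le_power2[of "a * d - b * c"] by (simp add: power2_eq_square algebra_simps)
    then show ?thesis unfolding real_sqrt_mult[symmetric] by (rule real_le_rsqrt)
  qed
  have "norm (dform p q p' q') \<le> norm (LINT z|DD. p z * p' z) + norm (LINT z|DD. q z * q' z)"
    unfolding dform_eq[OF assms] by (rule norm_triangle_ineq)
  also have "\<dots> \<le> l2norm DD p * l2norm DD p' + l2norm DD q * l2norm DD q'"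
    by (intro add_mono l2norm_Cauchy_Schwarz assms)
  also have "\<dots> \<le> dnorm p q * dnorm p' q'" unfolding dnorm_def by (rule cs)
  finally show ?thesis .
qed

lemma dform_integrable:
  "sqd p \<Longrightarrow> sqd q \<Longrightarrow> sqd p' \<Longrightarrow> sqd q' \<Longrightarrow> integrable DD (\<lambda>z. p z * p' z + q z * q' z)"
  by (intro Bochner_Integration.integrable_add sq_integrable_mult_integrable)

lemma dform_lincomb_left:
  assumes "sqd p" "sqd q" "sqd p1" "sqd q1" "sqd p'" "sqd q'"
  shows "dform (\<lambda>z. a * p z + b * p1 z) (\<lambda>z. a * q z + b * q1 z) p' q' = a * dform p q p' q' + b * dform p1 q1 p' q'"
proof -
  have "dform (\<lambda>z. a * p z + b * p1 z) (\<lambda>z. a * q z + b * q1 z) p' q'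
      = (LINT z|DD. a * (p z * p' z + q z * q' z) + b * (p1 z * p' z + q1 z * q' z))"
    unfolding dform_def by (simp add: algebra_simps)
  also have "\<dots> = a * dform p q p' q' + b * dform p1 q1 p' q'"
    unfolding dform_def using dform_integrable[OF assms(1,2,5,6)] dform_integrable[OF assms(3-6)] by simp
  finally show ?thesis .
qed

lemma dform_lincomb_right:
  assumes "sqd p" "sqd q" "sqd p1" "sqd q1" "sqd p'" "sqd q'"
  shows "dform p' q' (\<lambda>z. a * p z + b * p1 z) (\<lambda>z. a * q z + b * q1 z) = a * dform p' q' p q + b * dform p' q' p1 q1"
  using dform_lincomb_left[OF assms, of a b] by (simp add: dform_commute[of p' q'])

lemma dform_sum_right:
  assumes "finite F" "\<And>i. i \<in> F \<Longrightarrow> sqd (p i)" "\<And>i. i \<in> F \<Longrightarrow> sqd (q i)" "sqd p'" "sqd q'"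
  shows "dform p' q' (\<lambda>z. \<Sum>i\<in>F. c i * p i z) (\<lambda>z. \<Sum>i\<in>F. c i * q i z) = (\<Sum>i\<in>F. c i * dform p' q' (p i) (q i))"
proof -
  have "dform p' q' (\<lambda>z. \<Sum>i\<in>F. c i * p i z) (\<lambda>z. \<Sum>i\<in>F. c i * q i z)
      = (LINT z|DD. (\<Sum>i\<in>F. c i * (p' z * p i z + q' z * q i z)))"
    unfolding dform_def by (simp add: sum_distrib_left sum.distrib algebra_simps)
  also have "\<dots> = (\<Sum>i\<in>F. c i * dform p' q' (p i) (q i))"
    unfolding dform_def using assms dform_integrable[OF assms(4,5)]
    by (subst Bochner_Integration.integral_sum) auto
  finally show ?thesis .
qed

section \<open>The form on gradients of smooth functions; Green's formula and trace
  estimates\<close>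

lemma smooth_sqd_grad: "smooth_plane v \<Longrightarrow> sqd (px v)" "smooth_plane v \<Longrightarrow> sqd (py v)"
  by (intro smooth_sq_integrable smooth_plane_px smooth_plane_py; assumption)+

lemma gform_lincomb_left:
  assumes "smooth_plane u" "smooth_plane v" "smooth_plane w"
  shows "gform (\<lambda>z. a * u z + b * v z) w = a * gform u w + b * gform v w"
  unfolding px_lincomb[OF assms(1,2)] py_lincomb[OF assms(1,2)]
  by (intro dform_lincomb_left smooth_sqd_grad assms)

lemma gform_cnj_self: "smooth_plane v \<Longrightarrow> gform v (\<lambda>z. cnj (v z)) = of_real ((gnorm v)\<^sup>2)"
  by (simp add: px_smooth_cnj py_smooth_cnj dform_cnj_self smooth_sqd_grad)

text \<open>The harmonic extension of \<open>fmode m\<close> to the disk, written as a polynomial in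
  z or in its conjugate so that it is smooth on the plane. The test function for the
  \<open>n\<close>-th coefficient is \<open>hmode (- n)\<close>.\<close>

definition hmode :: "int \<Rightarrow> complex \<Rightarrow> complex" where
  "hmode m z = (if 0 \<le> m then z ^ nat m else cnj z ^ nat (- m))"

lemma smooth_hmode [intro, simp]: "smooth_plane (hmode m)"
  unfolding hmode_def[abs_def]
  by (cases "0 \<le> m") (auto intro!: smooth_plane_power smooth_plane_cnj[OF smooth_plane_id])

lemma hmode_cis: "hmode m (cis \<theta>) = fmode m \<theta>"
  using Complex.DeMoivre[of \<theta> "nat m"] Complex.DeMoivre[of "- \<theta>" "nat (- m)"]
  by (auto simp: hmode_def fmode_eq_cis cis_cnj)

lemma cnj_hmode: "(\<lambda>z. cnj (hmode m z)) = hmode (- m)"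
  by (auto simp: hmode_def fun_eq_iff)

lemma hmode_nonneg_deriv:
  assumes "0 \<le> m"
  shows "px (hmode m) z = of_nat (nat m) * z ^ (nat m - 1)" "py (hmode m) z = \<i> * (of_nat (nat m) * z ^ (nat m - 1))"
proof -
  have "(hmode m has_field_derivative of_nat (nat m) * z ^ (nat m - 1)) (at z)"
    unfolding hmode_def[abs_def] using assms by (auto intro!: derivative_eq_intros)
  then show "px (hmode m) z = of_nat (nat m) * z ^ (nat m - 1)" "py (hmode m) z = \<i> * (of_nat (nat m) * z ^ (nat m - 1))"
    by (rule px_holomorphic, rule py_holomorphic)
qed

text \<open>The power of \<open>norm z\<close> is the source of the exponential decay: on a disk of
  radius less than 1 the gradients shrink geometrically, apart from the factor |m|. For
  \<open>m = 0\<close> the truncated exponent is harmless, as the factor in front vanishes.\<close>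

lemma norm_grad_hmode:
  "norm (px (hmode m) z) = of_int \<bar>m\<bar> * norm z ^ (nat \<bar>m\<bar> - 1)"
  "norm (py (hmode m) z) = of_int \<bar>m\<bar> * norm z ^ (nat \<bar>m\<bar> - 1)"
proof -
  have *: "norm (px (hmode m) z) = of_int \<bar>m\<bar> * norm z ^ (nat \<bar>m\<bar> - 1) \<and> norm (py (hmode m) z) = of_int \<bar>m\<bar> * norm z ^ (nat \<bar>m\<bar> - 1)"
    if "0 \<le> m" for m using that by (simp add: hmode_nonneg_deriv norm_mult norm_power)
  have "norm (px (hmode m) z) = norm (px (hmode (- m)) z)" "norm (py (hmode m) z) = norm (py (hmode (- m)) z)"
    using px_smooth_cnj[OF smooth_hmode, of "- m"] py_smooth_cnj[OF smooth_hmode, of "- m"]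
    by (simp_all add: cnj_hmode)
  then show "norm (px (hmode m) z) = of_int \<bar>m\<bar> * norm z ^ (nat \<bar>m\<bar> - 1)"
    "norm (py (hmode m) z) = of_int \<bar>m\<bar> * norm z ^ (nat \<bar>m\<bar> - 1)"
    using *[of m] *[of "- m"] by (cases "0 \<le> m"; simp)+
qed

text \<open>Since \<open>hmode m\<close> is harmonic, the integrand is the divergence of
  \<open>v\<close> times its gradient; on the circle the normal derivative of \<open>z ^ m\<close>
  is \<open>m * z ^ m\<close>.\<close>

lemma Green_nonneg:
  assumes v: "smooth_plane v" and m: "0 \<le> m"
  shows "gform v (hmode m) = of_int m * cint (\<lambda>\<theta>. v (cis \<theta>) * fmode m \<theta>)"
proof -
  let ?H = "hmode m"
  define k where "k = nat m"
  have sm: "smooth_plane (\<lambda>z. v z * px ?H z)" "smooth_plane (\<lambda>z. v z * py ?H z)"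
    using v by (auto intro: smooth_plane_px smooth_plane_py)
  have P: "px ?H = (\<lambda>z. of_nat k * z ^ (k - 1))" "py ?H = (\<lambda>z. \<i> * (of_nat k * z ^ (k - 1)))"
    using hmode_nonneg_deriv[OF m] by (auto simp: k_def)
  have d: "((\<lambda>z. of_nat k * z ^ (k - 1)) has_field_derivative of_nat k * (of_nat (k - 1) * z ^ (k - 1 - 1))) (at z)"
    "((\<lambda>z. \<i> * (of_nat k * z ^ (k - 1))) has_field_derivative \<i> * (of_nat k * (of_nat (k - 1) * z ^ (k - 1 - 1)))) (at z)" for z :: complex
    by (auto intro!: derivative_eq_intros)
  have harm: "px (px ?H) z + py (py ?H) z = 0" for z
    unfolding P px_holomorphic[OF d(1)] py_holomorphic[OF d(2)] by simp
  have "gform v ?H = (LINT z|DD. px (\<lambda>z. v z * px ?H z) z + py (\<lambda>z. v z * py ?H z) z)"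
  proof -
    have "px v z * px ?H z + py v z * py ?H z = px (\<lambda>z. v z * px ?H z) z + py (\<lambda>z. v z * py ?H z) z" for z
      using harm[of z] v
      by (simp add: px_smooth_mult py_smooth_mult smooth_plane_px smooth_plane_py eq_neg_iff_add_eq_0[symmetric])
    then show ?thesis by (simp add: dform_def)
  qed
  also have "\<dots> = (LINT z|DD. px (\<lambda>z. v z * px ?H z) z) + (LINT z|DD. py (\<lambda>z. v z * py ?H z) z)"
    by (intro Bochner_Integration.integral_add smooth_integrable smooth_plane_px smooth_plane_py sm)
  also have "\<dots> = cint (\<lambda>\<theta>. v (cis \<theta>) * px ?H (cis \<theta>) * of_real (cos \<theta>)) + cint (\<lambda>\<theta>. v (cis \<theta>) * py ?H (cis \<theta>) * of_real (sin \<theta>))"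
    unfolding disk_px_integral[OF sm(1)] disk_py_integral[OF sm(2)] ..
  also have "\<dots> = cint (\<lambda>\<theta>. v (cis \<theta>) * px ?H (cis \<theta>) * of_real (cos \<theta>) + v (cis \<theta>) * py ?H (cis \<theta>) * of_real (sin \<theta>))"
    by (intro Bochner_Integration.integral_add[symmetric] cint_integrable continuous_intros
        per_test_continuous[OF smooth_circle_per_test] v smooth_plane_px smooth_plane_py smooth_hmode)
  also have "\<dots> = cint (\<lambda>\<theta>. of_int m * (v (cis \<theta>) * fmode m \<theta>))"
  proof -
    have "v (cis \<theta>) * px ?H (cis \<theta>) * of_real (cos \<theta>) + v (cis \<theta>) * py ?H (cis \<theta>) * of_real (sin \<theta>)
        = of_int m * (v (cis \<theta>) * fmode m \<theta>)" for \<theta>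
    proof -
      have "v (cis \<theta>) * px ?H (cis \<theta>) * of_real (cos \<theta>) + v (cis \<theta>) * py ?H (cis \<theta>) * of_real (sin \<theta>)
          = v (cis \<theta>) * (of_nat k * cis \<theta> ^ (k - 1)) * (of_real (cos \<theta>) + \<i> * of_real (sin \<theta>))"
        unfolding P by (simp add: distrib_left mult_ac)
      also have "of_real (cos \<theta>) + \<i> * of_real (sin \<theta>) = cis \<theta>" by (simp add: complex_eq_iff)
      finally have "v (cis \<theta>) * px ?H (cis \<theta>) * of_real (cos \<theta>) + v (cis \<theta>) * py ?H (cis \<theta>) * of_real (sin \<theta>)
          = v (cis \<theta>) * (of_nat k * cis \<theta> ^ (k - 1)) * cis \<theta>" .
      also have "\<dots> = v (cis \<theta>) * of_nat k * (cis \<theta> * cis \<theta> ^ (k - 1))" by (simp only: mult_ac)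
      \<comment> \<open>For \<open>k = 0\<close> the truncated subtraction in \<open>k - 1\<close>
        is covered by the vanishing factor \<open>of_nat k\<close>.\<close>
      also have "\<dots> = v (cis \<theta>) * of_nat k * cis \<theta> ^ k" by (cases k) auto
      also have "cis \<theta> ^ k = fmode m \<theta>" using m Complex.DeMoivre[of \<theta> k] by (simp add: k_def fmode_eq_cis)
      finally show ?thesis using m by (simp add: k_def mult_ac)
    qed
    then show ?thesis by simp
  qed
  finally show ?thesis by simp
qed

text \<open>Negative orders follow by conjugating both functions, which turns \<open>hmode m\<close>
  into \<open>hmode (- m)\<close>.\<close>

lemma Green_hmode:
  assumes v: "smooth_plane v"
  shows "gform v (hmode m) = 2 * pi * of_int \<bar>m\<bar> * pcoeff (\<lambda>\<theta>. v (cis \<theta>)) (- m)"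
proof (cases "0 \<le> m")
  case True
  then show ?thesis using Green_nonneg[OF v True] by (simp add: pcoeff_def)
next
  case False
  have "gform (\<lambda>z. cnj (v z)) (\<lambda>z. cnj (hmode m z)) = cnj (gform v (hmode m))"
    using v Bochner_Integration.integral_cnj[where M = DD and f = "\<lambda>z. px v z * px (hmode m) z + py v z * py (hmode m) z"]
    by (simp add: px_smooth_cnj py_smooth_cnj dform_def)
  moreover have "gform (\<lambda>z. cnj (v z)) (hmode (- m)) = of_int (- m) * cint (\<lambda>\<theta>. cnj (v (cis \<theta>)) * fmode (- m) \<theta>)"
    by (rule Green_nonneg) (use v False in auto)
  moreover have "cint (\<lambda>\<theta>. cnj (v (cis \<theta>)) * fmode (- m) \<theta>) = cnj (cint (\<lambda>\<theta>. v (cis \<theta>) * fmode m \<theta>))"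
    using Bochner_Integration.integral_cnj[where M = CC and f = "\<lambda>\<theta>. v (cis \<theta>) * fmode m \<theta>"] by simp
  ultimately have "cnj (gform v (hmode m)) = cnj (of_int (- m) * cint (\<lambda>\<theta>. v (cis \<theta>) * fmode m \<theta>))"
    by (simp add: cnj_hmode)
  then have "gform v (hmode m) = of_int (- m) * cint (\<lambda>\<theta>. v (cis \<theta>) * fmode m \<theta>)"
    by (simp only: complex_cnj_cancel_iff)
  then show ?thesis using False by (simp add: pcoeff_def)
qed

lemma pcoeff_cnj: "pcoeff (\<lambda>\<theta>. cnj (h \<theta>)) n = cnj (pcoeff h (- n))"
  using Bochner_Integration.integral_cnj[where M = CC and f = "\<lambda>\<theta>. h \<theta> * fmode n \<theta>"] by (simp add: pcoeff_def)

lemma pcoeff_lincomb: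
  assumes "continuous_on UNIV f" "continuous_on UNIV g"
  shows "pcoeff (\<lambda>\<theta>. a * f \<theta> + b * g \<theta>) n = a * pcoeff f n + b * pcoeff g n"
proof -
  have "integrable CC (\<lambda>\<theta>. f \<theta> * fmode (- n) \<theta>)" "integrable CC (\<lambda>\<theta>. g \<theta> * fmode (- n) \<theta>)"
    by (intro cint_integrable continuous_intros assms)+
  then show ?thesis by (simp add: pcoeff_def distrib_right mult.assoc add_divide_distrib)
qed

text \<open>The Dirichlet principle: the truncated harmonic extension \<open>H\<close> of the trace of \<open>v\<close> is orthogonal to \<open>v - H\<close>.\<close>

lemma trace_energy_le:
  assumes v: "smooth_plane v" and F: "finite F"
  shows "2 * pi * (\<Sum>n\<in>F. of_int \<bar>n\<bar> * (norm (pcoeff (\<lambda>\<theta>. v (cis \<theta>)) n))\<^sup>2) \<le> (gnorm v)\<^sup>2"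
proof -
  define c where "c n = pcoeff (\<lambda>\<theta>. v (cis \<theta>)) n" for n
  define H where "H z = (\<Sum>n\<in>F. c n * hmode n z)" for z
  define S where "S = 2 * pi * (\<Sum>n\<in>F. of_int \<bar>n\<bar> * (norm (c n))\<^sup>2)"
  have H: "smooth_plane H" unfolding H_def[abs_def] by (auto intro!: smooth_plane_sum smooth_plane_mult)
  define W where "W z = 1 * v z + (- 1) * H z" for z
  have W: "smooth_plane W" unfolding W_def[abs_def] by (intro smooth_plane_lincomb v H)
  have Hc: "(\<lambda>z. cnj (H z)) = (\<lambda>z. \<Sum>n\<in>F. cnj (c n) * hmode (- n) z)"
    using cnj_hmode by (auto simp: H_def fun_eq_iff)
  have vH: "gform w (\<lambda>z. \<Sum>n\<in>F. d n * hmode (e n) z) = (\<Sum>n\<in>F. d n * gform w (hmode (e n)))"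
    if "smooth_plane w" for w d and e :: "int \<Rightarrow> int"
    using that F by (simp add: px_sum py_sum dform_sum_right smooth_sqd_grad)
  have c0: "pcoeff (\<lambda>\<theta>. W (cis \<theta>)) n = 0" if "n \<in> F" for n
  proof -
    have "pcoeff (\<lambda>\<theta>. H (cis \<theta>)) n = fcoeff (\<lambda>\<phi>. \<Sum>m\<in>F. c m * dist_of (fmode m) \<phi>) n"
    proof -
      have "dist_of (\<lambda>\<theta>. \<Sum>m\<in>F. c m * fmode m \<theta>) (fmode (- n)) = (\<Sum>m\<in>F. c m * dist_of (fmode m) (fmode (- n)))"
      proof -
        have "integrable CC (\<lambda>\<theta>. fmode m \<theta> * fmode (- n) \<theta>)" for m
          by (intro cint_integrable continuous_intros)
        then show ?thesis
          by (simp add: dist_of_def fmode_in_per_test sum_distrib_right mult.assoc)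
      qed
      then show ?thesis by (simp add: H_def hmode_cis fcoeff_dist_of[symmetric] fcoeff_def)
    qed
    also have "\<dots> = c n" unfolding fcoeff_finite_sum fcoeff_fmode using F that by (simp add: if_distrib sum.delta cong: if_cong)
    finally have "pcoeff (\<lambda>\<theta>. H (cis \<theta>)) n = c n" .
    then show ?thesis
      unfolding W_def
      by (subst pcoeff_lincomb) (auto simp: c_def intro!: per_test_continuous[OF smooth_circle_per_test] v H)
  qed
  \<comment> \<open>Green's formula against \<open>hmode (- n)\<close>, the conjugate of
    \<open>hmode n\<close>, reads off the \<open>n\<close>-th boundary coefficient of
    \<open>W\<close>, which is 0 for \<open>n\<close> in \<open>F\<close>.\<close>
  have WH: "gform W (\<lambda>z. cnj (H z)) = 0"
    unfolding Hc vH[OF W] Green_hmode[OF W] by (rule sum.neutral) (simp add: c0)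
  have Wc: "(\<lambda>z. cnj (W z)) = (\<lambda>z. 1 * cnj (v z) + (- 1) * cnj (H z))" by (simp add: W_def)
  have "of_real ((gnorm W)\<^sup>2) = gform W (\<lambda>z. cnj (W z))" using gform_cnj_self[OF W] by simp
  also have "\<dots> = gform W (\<lambda>z. cnj (v z)) - gform W (\<lambda>z. cnj (H z))"
    unfolding Wc dform_commute[of "px W"]
    using gform_lincomb_left[of "\<lambda>z. cnj (v z)" "\<lambda>z. cnj (H z)" W 1 "- 1"] v H W by auto
  also have "\<dots> = gform W (\<lambda>z. cnj (v z))" by (simp add: WH)
  also have "\<dots> = gform v (\<lambda>z. cnj (v z)) - gform (\<lambda>z. cnj (v z)) H"
    unfolding W_def[abs_def] using gform_lincomb_left[OF v H, of "\<lambda>z. cnj (v z)" 1 "- 1"] v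
    by (simp add: dform_commute[of "px H"] smooth_plane_cnj)
  also have "gform (\<lambda>z. cnj (v z)) H = (\<Sum>n\<in>F. c n * (2 * pi * of_int \<bar>n\<bar> * cnj (c n)))"
    unfolding H_def[abs_def] using vH[of "\<lambda>z. cnj (v z)" c "\<lambda>n. n"] v
    by (simp add: Green_hmode smooth_plane_cnj pcoeff_cnj c_def)
  also have "\<dots> = of_real S"
    unfolding S_def of_real_mult of_real_sum of_real_power[symmetric] sum_distrib_left
    by (intro sum.cong refl) (simp add: mult_ac flip: complex_norm_square)
  finally have "of_real ((gnorm W)\<^sup>2) = complex_of_real ((gnorm v)\<^sup>2 - S)"
    using gform_cnj_self[OF v] by simp
  then have "(gnorm W)\<^sup>2 = (gnorm v)\<^sup>2 - S" by (simp only: of_real_eq_iff)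
  then show ?thesis using zero_le_power2[of "gnorm W"] by (simp add: S_def c_def)
qed

lemma per_test_Parseval:
  assumes "\<phi> \<in> per_test"
  shows "((\<lambda>n. 2 * pi * (norm (pcoeff \<phi> n))\<^sup>2) has_sum (l2norm CC \<phi>)\<^sup>2) UNIV"
proof -
  have s: "(\<lambda>n. norm (pcoeff \<phi> n)) summable_on UNIV" using vder_pcoeff_summable[OF assms, of 0] by simp
  have h: "\<phi> = fseries (pcoeff \<phi>)" using vder_eq_fseries[OF assms, of 0] by simp
  have "((\<lambda>n. pcoeff \<phi> n * cint (\<lambda>\<theta>. fmode n \<theta> * cnj (\<phi> \<theta>))) has_sum cint (\<lambda>\<theta>. fseries (pcoeff \<phi>) \<theta> * cnj (\<phi> \<theta>))) UNIV"
    by (intro cint_fseries_mult_has_sum s continuous_intros per_test_continuous assms)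
  moreover have "cint (\<lambda>\<theta>. fmode n \<theta> * cnj (\<phi> \<theta>)) = 2 * pi * cnj (pcoeff \<phi> n)" for n
    using pcoeff_cnj[of \<phi> "- n"] by (simp add: pcoeff_def mult.commute)
  moreover have "cint (\<lambda>\<theta>. fseries (pcoeff \<phi>) \<theta> * cnj (\<phi> \<theta>)) = of_real ((l2norm CC \<phi>)\<^sup>2)"
    unfolding h[symmetric] l2norm_square integral_complex_of_real[symmetric] complex_norm_square ..
  moreover have "pcoeff \<phi> n * (2 * pi * cnj (pcoeff \<phi> n)) = of_real (2 * pi * (norm (pcoeff \<phi> n))\<^sup>2)" for n
    using complex_norm_square[of "pcoeff \<phi> n"] by simp
  ultimately have "((\<lambda>n. complex_of_real (2 * pi * (norm (pcoeff \<phi> n))\<^sup>2)) has_sum of_real ((l2norm CC \<phi>)\<^sup>2)) UNIV"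
    by (simp only:)
  then show ?thesis unfolding has_sum_of_real_iff .
qed

text \<open>With mean zero only modes with |n| >= 1 occur, so Parseval's sum is dominated by the
  energy in \<open>trace_energy_le\<close>.\<close>

lemma trace_l2norm_le:
  assumes v: "smooth_plane v" and 0: "cint (\<lambda>\<theta>. v (cis \<theta>)) = 0"
  shows "l2norm CC (\<lambda>\<theta>. v (cis \<theta>)) \<le> gnorm v"
proof -
  let ?c = "pcoeff (\<lambda>\<theta>. v (cis \<theta>))"
  have c0: "?c 0 = 0" using 0 by (simp add: pcoeff_def)
  have "(l2norm CC (\<lambda>\<theta>. v (cis \<theta>)))\<^sup>2 \<le> (gnorm v)\<^sup>2"
  proof (rule has_sum_le_finite_sums[OF per_test_Parseval[OF smooth_circle_per_test[OF v]]])
    fix F :: "int set" assume F: "finite F"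
    have "(\<Sum>n\<in>F. 2 * pi * (norm (?c n))\<^sup>2) \<le> (\<Sum>n\<in>F. 2 * pi * (of_int \<bar>n\<bar> * (norm (?c n))\<^sup>2))"
    proof (rule sum_mono)
      fix n
      show "2 * pi * (norm (?c n))\<^sup>2 \<le> 2 * pi * (of_int \<bar>n\<bar> * (norm (?c n))\<^sup>2)"
      proof (cases "n = 0")
        case False
        then have "1 \<le> real_of_int \<bar>n\<bar>" by linarith
        then show ?thesis using mult_right_mono[of 1 "real_of_int \<bar>n\<bar>" "(norm (?c n))\<^sup>2"] by simp
      qed (simp add: c0)
    qed
    then show "(\<Sum>n\<in>F. 2 * pi * (norm (?c n))\<^sup>2) \<le> (gnorm v)\<^sup>2"
      using trace_energy_le[OF v F] by (simp add: sum_distrib_left)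
  qed
  then show ?thesis by (rule power2_le_imp_le) simp
qed

text \<open>The divergence theorem for the radial field (x, y) times the squared modulus of
  \<open>v\<close>: its flux is the squared boundary norm, its divergence is twice that squared
  modulus plus a term that completing squares bounds by one copy of it and the squared
  gradient.\<close>

lemma disk_Poincare:
  assumes v: "smooth_plane v"
  shows "(l2norm DD v)\<^sup>2 \<le> (l2norm CC (\<lambda>\<theta>. v (cis \<theta>)))\<^sup>2 + (gnorm v)\<^sup>2"
proof -
  define w where "w z = v z * cnj (v z)" for z
  define X where "X z = of_real (Re z) * w z" for z
  define Y where "Y z = of_real (Im z) * w z" for z
  have w: "smooth_plane w" unfolding w_def[abs_def] by (intro smooth_plane_mult smooth_plane_cnj v)
  have X: "smooth_plane X" and Y: "smooth_plane Y"
    unfolding X_def[abs_def] Y_def[abs_def] by (intro smooth_plane_mult smooth_plane_Re smooth_plane_Im w)+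
  have pxX: "px X z = of_real (Re z) * px w z + w z" and pyY: "py Y z = of_real (Im z) * py w z + w z" for z
    unfolding X_def[abs_def] Y_def[abs_def]
    by (simp_all add: px_smooth_mult py_smooth_mult w px_Re py_Im)
  have pw: "px w z = of_real (2 * Re (px v z * cnj (v z)))" "py w z = of_real (2 * Re (py v z * cnj (v z)))" for z
    unfolding w_def[abs_def] using v
    by (simp_all add: px_smooth_mult py_smooth_mult px_smooth_cnj py_smooth_cnj smooth_plane_cnj complex_eq_iff)
  have "(LINT z|DD. px X z + py Y z) = cint (\<lambda>\<theta>. X (cis \<theta>) * of_real (cos \<theta>)) + cint (\<lambda>\<theta>. Y (cis \<theta>) * of_real (sin \<theta>))"
    unfolding disk_px_integral[OF X, symmetric] disk_py_integral[OF Y, symmetric]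
    by (intro Bochner_Integration.integral_add smooth_integrable smooth_plane_px smooth_plane_py X Y)
  also have "\<dots> = cint (\<lambda>\<theta>. X (cis \<theta>) * of_real (cos \<theta>) + Y (cis \<theta>) * of_real (sin \<theta>))"
    by (intro Bochner_Integration.integral_add[symmetric] cint_integrable continuous_intros
        per_test_continuous[OF smooth_circle_per_test] X Y)
  also have "\<dots> = cint (\<lambda>\<theta>. w (cis \<theta>))"
  proof -
    have "X (cis \<theta>) * of_real (cos \<theta>) + Y (cis \<theta>) * of_real (sin \<theta>) = w (cis \<theta>)" for \<theta>
    proof -
      have "X (cis \<theta>) * of_real (cos \<theta>) + Y (cis \<theta>) * of_real (sin \<theta>)
          = w (cis \<theta>) * of_real ((cos \<theta>)\<^sup>2 + (sin \<theta>)\<^sup>2)"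
        unfolding X_def Y_def of_real_add by (simp add: power2_eq_square algebra_simps)
      then show ?thesis by (simp add: cos_squared_eq)
    qed
    then show ?thesis by simp
  qed
  also have "\<dots> = of_real ((l2norm CC (\<lambda>\<theta>. v (cis \<theta>)))\<^sup>2)"
    unfolding w_def l2norm_square integral_complex_of_real[symmetric] complex_norm_square ..
  finally have b: "(LINT z|DD. px X z + py Y z) = of_real ((l2norm CC (\<lambda>\<theta>. v (cis \<theta>)))\<^sup>2)" .
  define I where "I z = 2 * (norm (v z))\<^sup>2 + (Re z * (2 * Re (px v z * cnj (v z))) + Im z * (2 * Re (py v z * cnj (v z))))" for z
  have "px X z + py Y z = of_real (I z)" for z
    unfolding pxX pyY pw I_def w_def by (simp add: complex_norm_square[symmetric])
  then have bI: "(LINT z|DD. I z) = (l2norm CC (\<lambda>\<theta>. v (cis \<theta>)))\<^sup>2"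
    using b by (simp only: integral_complex_of_real of_real_eq_iff)
  have sq: "integrable DD (\<lambda>z. (norm (v z))\<^sup>2)" "integrable DD (\<lambda>z. (norm (px v z))\<^sup>2)" "integrable DD (\<lambda>z. (norm (py v z))\<^sup>2)"
    using smooth_sq_integrable[OF v] smooth_sqd_grad[OF v] by (auto simp: sq_integrable_def)
  have iI: "integrable DD I" unfolding I_def[abs_def]
    by (intro continuous_integrable_disk continuous_intros smooth_plane_continuous v smooth_plane_px smooth_plane_py)
  have "(LINT z|DD. (norm (v z))\<^sup>2 - (norm (px v z))\<^sup>2 - (norm (py v z))\<^sup>2) \<le> (LINT z|DD. I z)"
  proof (rule integral_mono)
    fix z assume "z \<in> space DD"
    then have z: "norm z \<le> 1" by simp
    define a where "a = norm (v z)"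
    define b where "b = norm (px v z)"
    define d where "d = norm (py v z)"
    have ab: "\<bar>Re (px v z * cnj (v z))\<bar> \<le> b * a" "\<bar>Re (py v z * cnj (v z))\<bar> \<le> d * a"
      unfolding a_def b_def d_def using abs_Re_le_cmod[of "px v z * cnj (v z)"] abs_Re_le_cmod[of "py v z * cnj (v z)"]
      by (simp_all add: norm_mult)
    have xy: "(Re z)\<^sup>2 + (Im z)\<^sup>2 \<le> 1" using z by (simp add: cmod_def)
    have "\<bar>Re z * (2 * Re (px v z * cnj (v z))) + Im z * (2 * Re (py v z * cnj (v z)))\<bar>
        \<le> \<bar>Re z\<bar> * (2 * (b * a)) + \<bar>Im z\<bar> * (2 * (d * a))"
    proof (rule order_trans[OF abs_triangle_ineq], rule add_mono)
      show "\<bar>Re z * (2 * Re (px v z * cnj (v z)))\<bar> \<le> \<bar>Re z\<bar> * (2 * (b * a))"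
        "\<bar>Im z * (2 * Re (py v z * cnj (v z)))\<bar> \<le> \<bar>Im z\<bar> * (2 * (d * a))"
        unfolding abs_mult using ab by (intro mult_left_mono; simp)+
    qed
    also have "\<dots> \<le> a\<^sup>2 + b\<^sup>2 + d\<^sup>2"
    proof -
      have "0 \<le> (a * \<bar>Re z\<bar> - b)\<^sup>2 + (a * \<bar>Im z\<bar> - d)\<^sup>2" by simp
      also have "\<dots> = a\<^sup>2 * ((Re z)\<^sup>2 + (Im z)\<^sup>2) + b\<^sup>2 + d\<^sup>2 - (\<bar>Re z\<bar> * (2 * (b * a)) + \<bar>Im z\<bar> * (2 * (d * a)))"
        by (simp add: power2_diff power_mult_distrib algebra_simps)
      also have "a\<^sup>2 * ((Re z)\<^sup>2 + (Im z)\<^sup>2) \<le> a\<^sup>2" using xy by (simp add: mult_left_le)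
      finally show ?thesis by simp
    qed
    finally show "(norm (v z))\<^sup>2 - (norm (px v z))\<^sup>2 - (norm (py v z))\<^sup>2 \<le> I z"
      unfolding I_def a_def b_def d_def by (simp add: abs_le_iff)
  qed (use sq iI in auto)
  moreover have "(LINT z|DD. (norm (v z))\<^sup>2 - (norm (px v z))\<^sup>2 - (norm (py v z))\<^sup>2) = (l2norm DD v)\<^sup>2 - (gnorm v)\<^sup>2"
    using sq by (simp add: l2norm_square dnorm_square)
  ultimately show ?thesis using bI by simp
qed

section \<open>Weak solutions of the conductivity equation\<close>

lemma gnorm_cnj: "smooth_plane v \<Longrightarrow> gnorm (\<lambda>z. cnj (v z)) = gnorm v"
  by (simp add: dnorm_def px_smooth_cnj py_smooth_cnj)

lemma gnorm_cmult: "smooth_plane v \<Longrightarrow> gnorm (\<lambda>z. c * v z) = norm c * gnorm v"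
proof -
  assume v: "smooth_plane v"
  have "px (\<lambda>z. c * v z) = (\<lambda>z. c * px v z)" "py (\<lambda>z. c * v z) = (\<lambda>z. c * py v z)"
    using px_lincomb[OF v v, of c 0] py_lincomb[OF v v, of c 0] by simp_all
  then show ?thesis
    by (simp add: dnorm_def l2norm_cmult power_mult_distrib real_sqrt_mult flip: distrib_left)
qed

lemma gform_cnj_swap:
  assumes "smooth_plane u" "smooth_plane v"
  shows "gform u (\<lambda>z. cnj (v z)) = cnj (gform v (\<lambda>z. cnj (u z)))"
  using assms Bochner_Integration.integral_cnj[where M = DD and f = "\<lambda>z. px v z * cnj (px u z) + py v z * cnj (py u z)"]
  by (simp add: dform_def px_smooth_cnj py_smooth_cnj mult.commute)

lemma gnorm_add_square:
  fixes t :: real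
  assumes u: "smooth_plane u" and v: "smooth_plane v"
  shows "(gnorm (\<lambda>z. u z + of_real t * v z))\<^sup>2
      = (gnorm u)\<^sup>2 + 2 * t * Re (gform u (\<lambda>z. cnj (v z))) + t\<^sup>2 * (gnorm v)\<^sup>2"
proof -
  define w where "w z = 1 * u z + of_real t * v z" for z
  have w: "smooth_plane w" unfolding w_def[abs_def] by (intro smooth_plane_lincomb u v)
  have wc: "(\<lambda>z. cnj (w z)) = (\<lambda>z. 1 * cnj (u z) + of_real t * cnj (v z))" by (simp add: w_def)
  have r: "gform x (\<lambda>z. cnj (w z)) = gform x (\<lambda>z. cnj (u z)) + of_real t * gform x (\<lambda>z. cnj (v z))"
    if "smooth_plane x" for x
    unfolding wc using gform_lincomb_left[of "\<lambda>z. cnj (u z)" "\<lambda>z. cnj (v z)" x 1 "of_real t"] that u v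
    by (simp add: smooth_plane_cnj dform_commute[of "px x"])
  have "of_real ((gnorm w)\<^sup>2) = gform w (\<lambda>z. cnj (w z))" using gform_cnj_self[OF w] by simp
  also have "\<dots> = gform u (\<lambda>z. cnj (w z)) + of_real t * gform v (\<lambda>z. cnj (w z))"
    unfolding w_def[abs_def] using gform_lincomb_left[OF u v smooth_plane_cnj[OF w], of 1 "of_real t"]
    by (simp add: w_def)
  also have "\<dots> = of_real ((gnorm u)\<^sup>2) + of_real t * gform u (\<lambda>z. cnj (v z))
      + of_real t * (cnj (gform u (\<lambda>z. cnj (v z))) + of_real t * of_real ((gnorm v)\<^sup>2))"
    unfolding r[OF u] r[OF v] gform_cnj_self[OF u] gform_cnj_self[OF v] gform_cnj_swap[OF v u] ..
  finally have "(gnorm w)\<^sup>2 = Re (of_real ((gnorm u)\<^sup>2) + of_real t * gform u (\<lambda>z. cnj (v z))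
      + of_real t * (cnj (gform u (\<lambda>z. cnj (v z))) + of_real t * of_real ((gnorm v)\<^sup>2)))"
    by (metis Re_complex_of_real)
  moreover have "w = (\<lambda>z. u z + of_real t * v z)" by (simp add: w_def[abs_def])
  ultimately show ?thesis by (simp add: power2_eq_square algebra_simps)
qed

text \<open>Boundedness by the gradient alone forces the functional to vanish on constants, which is
  the solvability condition that Neumann data have mean zero.\<close>

definition smooth_functional :: "((complex \<Rightarrow> complex) \<Rightarrow> complex) \<Rightarrow> real \<Rightarrow> bool" where
  "smooth_functional l L \<longleftrightarrow>
    (\<forall>u v a b. smooth_plane u \<longrightarrow> smooth_plane v \<longrightarrow> l (\<lambda>z. a * u z + b * v z) = a * l u + b * l v) \<and>
    (\<forall>v. smooth_plane v \<longrightarrow> norm (l v) \<le> L * gnorm v)"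

text \<open>Near-minimizers of the Dirichlet energy represent the functional approximately, so that completeness
  of the space is not needed.\<close>

lemma Riesz_approximation:
  assumes l: "smooth_functional l L" and e: "e > 0"
  obtains z where "smooth_plane z" "\<And>w. smooth_plane w \<Longrightarrow> norm (l w - gform z w) \<le> e * gnorm w"
proof -
  have lin: "l (\<lambda>z. a * u z + b * v z) = a * l u + b * l v" if "smooth_plane u" "smooth_plane v" for a b u v
    using l that by (simp add: smooth_functional_def)
  have bd: "norm (l v) \<le> L * gnorm v" if "smooth_plane v" for v
    using l that by (simp add: smooth_functional_def)
  \<comment> \<open>\<open>l\<close> is linear, while the energy pairs \<open>v\<close> with its
    conjugate; hence the conjugate inside \<open>l\<close>. The derivative of \<open>J\<close> in a
    direction \<open>u\<close> is the real part of \<open>gform v\<close> minus \<open>l\<close>,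
    both taken at the conjugate of \<open>u\<close>.\<close>
  define J where "J v = (gnorm v)\<^sup>2 / 2 - Re (l (\<lambda>z. cnj (v z)))" for v
  \<comment> \<open>Being within \<open>d\<close> of the infimum bounds the squared defect by
    \<open>2 * d\<close> times the squared norm of the test gradient; this choice makes that the
    square of \<open>e * gnorm w\<close>.\<close>
  define d where "d = e\<^sup>2 / 2"
  have d: "d > 0" using e by (simp add: d_def)
  have low: "- (L\<^sup>2 / 2) \<le> J v" if v: "smooth_plane v" for v
  proof -
    have "Re (l (\<lambda>z. cnj (v z))) \<le> norm (l (\<lambda>z. cnj (v z)))" by (rule complex_Re_le_cmod)
    also have "\<dots> \<le> L * gnorm v" using bd[OF smooth_plane_cnj[OF v]] by (simp add: gnorm_cnj[OF v])
    finally have "J v \<ge> (gnorm v)\<^sup>2 / 2 - L * gnorm v" by (simp add: J_def)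
    moreover have "0 \<le> (gnorm v - L)\<^sup>2" by simp
    ultimately show ?thesis by (simp add: power2_diff field_simps)
  qed
  define m where "m = Inf (J ` {v. smooth_plane v})"
  have bb: "bdd_below (J ` {v. smooth_plane v})" using low by (auto intro!: bdd_belowI2)
  obtain v where v: "smooth_plane v" "J v < m + d"
    using cInf_lessD[of "J ` {v. smooth_plane v}" "m + d"] d smooth_plane_id unfolding m_def by force
  have "norm (l w - gform v w) \<le> e * gnorm w" if w: "smooth_plane w" for w
  proof -
    define y where "y = gform v w - l w"
    \<comment> \<open>The phase \<open>c\<close> rotates the defect \<open>y\<close> onto the
      positive axis, so a variation with real parameter in the direction \<open>u\<close> controls
      all of \<open>y\<close> and not only its real part.\<close>
    define c where "c = (if y = 0 then 1 else cnj y / norm y)"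
    have c: "norm c = 1" "c * y = of_real (norm y)"
      using complex_norm_square[of y, symmetric] by (auto simp: c_def norm_divide power2_eq_square mult.commute)
    define u where "u z = cnj (c * w z)" for z
    have u: "smooth_plane u" unfolding u_def[abs_def] by (intro smooth_plane_cnj smooth_plane_mult smooth_plane_const w)
    have uc: "(\<lambda>z. cnj (u z)) = (\<lambda>z. c * w z)" by (simp add: u_def)
    have gu: "gnorm u = gnorm w"
      using gnorm_cnj[OF u] gnorm_cmult[OF w, of c] c by (simp add: uc)
    have g1: "gform v (\<lambda>z. cnj (u z)) = c * gform v w"
      unfolding uc using gform_lincomb_left[OF w w v(1), of c 0] by (simp add: dform_commute[of "px v"])
    have l1: "l (\<lambda>z. cnj (u z)) = c * l w" unfolding uc using lin[OF w w, of c 0] by simp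
    have "- d \<le> t * norm y + t\<^sup>2 * (gnorm w)\<^sup>2 / 2" for t :: real
    proof -
      have s: "smooth_plane (\<lambda>z. v z + of_real t * u z)" by (intro smooth_plane_add smooth_plane_mult smooth_plane_const v u)
      have "m \<le> J (\<lambda>z. v z + of_real t * u z)" unfolding m_def by (rule cInf_lower[OF _ bb]) (use s in auto)
      then have "- d \<le> J (\<lambda>z. v z + of_real t * u z) - J v" using v by simp
      also have "l (\<lambda>z. cnj (v z + of_real t * u z)) = l (\<lambda>z. cnj (v z)) + of_real t * (c * l w)"
        using lin[OF smooth_plane_cnj[OF v(1)] smooth_plane_cnj[OF u], of 1 "of_real t"] by (simp add: l1)
      then have "J (\<lambda>z. v z + of_real t * u z) - J v
          = ((gnorm v)\<^sup>2 + 2 * t * Re (c * gform v w) + t\<^sup>2 * (gnorm w)\<^sup>2) / 2 - (gnorm v)\<^sup>2 / 2 - t * Re (c * l w)"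
        unfolding J_def gnorm_add_square[OF v(1) u] g1 gu by (simp add: algebra_simps)
      also have "\<dots> = t * Re (c * y) + t\<^sup>2 * (gnorm w)\<^sup>2 / 2"
      proof -
        have ry: "Re (c * y) = Re (c * gform v w) - Re (c * l w)"
          unfolding y_def right_diff_distrib minus_complex.sel ..
        show ?thesis
          unfolding ry by (simp add: algebra_simps add_divide_distrib diff_divide_distrib del: times_complex.sel)
      qed
      finally show ?thesis by (simp add: c)
    qed
    then have "(norm y)\<^sup>2 \<le> 2 * d * (gnorm w)\<^sup>2" by (rule quadratic_lower_bound) (use d in auto)
    then have "(norm y)\<^sup>2 \<le> (e * gnorm w)\<^sup>2" by (simp add: d_def power_mult_distrib)
    then have "norm y \<le> e * gnorm w" by (rule power2_le_imp_le) (use e in simp)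
    then show ?thesis by (simp add: y_def norm_minus_commute)
  qed
  then show ?thesis using that v(1) by blast
qed

lemma dnorm_bounded_mult:
  assumes "sqd p" "sqd q" "s \<in> borel_measurable DD" "AE z in DD. norm (s z) \<le> b" "0 \<le> b"
  shows "dnorm (\<lambda>z. s z * p z) (\<lambda>z. s z * q z) \<le> b * dnorm p q"
proof -
  have "(dnorm (\<lambda>z. s z * p z) (\<lambda>z. s z * q z))\<^sup>2 \<le> (b * l2norm DD p)\<^sup>2 + (b * l2norm DD q)\<^sup>2"
    unfolding dnorm_square by (intro add_mono power_mono l2norm_bounded_mult assms l2norm_nonneg)
  also have "\<dots> = (b * dnorm p q)\<^sup>2" by (simp add: dnorm_square power_mult_distrib distrib_left)
  finally show ?thesis by (rule power2_le_imp_le) (use assms in simp)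
qed

locale elliptic =
  fixes \<sigma> :: "complex \<Rightarrow> complex" and lo B :: real
  assumes sigma_measurable: "\<sigma> \<in> borel_measurable DD"
    and sigma_bounded: "AE z in DD. norm (\<sigma> z) \<le> B"
    and sigma_coercive: "AE z in DD. lo \<le> Re (\<sigma> z)"
    and lo_pos: "lo > 0"
begin

abbreviation sform :: "(complex \<Rightarrow> complex) \<Rightarrow> (complex \<Rightarrow> complex) \<Rightarrow> (complex \<Rightarrow> complex) \<Rightarrow> (complex \<Rightarrow> complex) \<Rightarrow> complex" where
  "sform p q p' q' \<equiv> dform (\<lambda>z. \<sigma> z * p z) (\<lambda>z. \<sigma> z * q z) p' q'"

abbreviation sgform :: "(complex \<Rightarrow> complex) \<Rightarrow> (complex \<Rightarrow> complex) \<Rightarrow> complex" where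
  "sgform v w \<equiv> sform (px v) (py v) (px w) (py w)"

lemma sqd_sigma: "sqd p \<Longrightarrow> sqd (\<lambda>z. \<sigma> z * p z)"
  by (rule sq_integrable_bounded_mult[OF _ sigma_measurable sigma_bounded])

lemma sform_eq: "sform p q p' q' = (LINT z|DD. \<sigma> z * (p z * p' z + q z * q' z))"
  by (simp add: dform_def algebra_simps)

text \<open>Without conjugates the form is symmetric even for complex \<sigma>; this is the origin
  of \<open>ND_symmetric\<close>.\<close>

lemma sform_commute: "sform p q p' q' = sform p' q' p q"
  by (simp add: sform_eq mult.commute)

lemma sform_lincomb_left:
  assumes "sqd p" "sqd q" "sqd p1" "sqd q1" "sqd p'" "sqd q'"
  shows "sform (\<lambda>z. a * p z + b * p1 z) (\<lambda>z. a * q z + b * q1 z) p' q' = a * sform p q p' q' + b * sform p1 q1 p' q'"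
  using dform_lincomb_left[OF sqd_sigma sqd_sigma sqd_sigma sqd_sigma assms(5,6), OF assms(1-4), of a b]
  by (simp add: algebra_simps)

text \<open>The squared modulus is at most
  \<open>1 - 2 * \<tau> * lo + \<tau>\<^sup>2 * K\<^sup>2\<close>, minimal at
  \<open>\<tau> = lo / K\<^sup>2\<close> with value \<open>1 - lo\<^sup>2 / K\<^sup>2\<close>.
  Taking \<open>K\<close> as the maximum of \<open>B\<close> and \<open>lo\<close> makes it positive
  and this value nonnegative.\<close>

lemma contraction_constants:
  obtains \<tau> \<kappa> where "\<tau> > 0" "0 \<le> \<kappa>" "\<kappa> < 1" "AE z in DD. norm (1 - of_real \<tau> * \<sigma> z) \<le> \<kappa>"
proof -
  define K where "K = max B lo"
  have K: "K > 0" "lo \<le> K" using lo_pos by (auto simp: K_def)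
  define \<tau> where "\<tau> = lo / K\<^sup>2"
  define \<kappa> where "\<kappa> = sqrt (1 - lo\<^sup>2 / K\<^sup>2)"
  have le1: "lo\<^sup>2 / K\<^sup>2 \<le> 1" using K lo_pos by (simp add: power_mono)
  have "AE z in DD. norm (1 - of_real \<tau> * \<sigma> z) \<le> \<kappa>"
    using sigma_bounded sigma_coercive
  proof eventually_elim
    case (elim z)
    then have "norm (\<sigma> z) \<le> K" by (simp add: K_def)
    then have n2: "(norm (\<sigma> z))\<^sup>2 \<le> K\<^sup>2" by (simp add: power_mono)
    have "(norm (1 - of_real \<tau> * \<sigma> z))\<^sup>2 = 1 - 2 * \<tau> * Re (\<sigma> z) + \<tau>\<^sup>2 * (norm (\<sigma> z))\<^sup>2"
      unfolding cmod_power2 by (simp add: power2_eq_square algebra_simps)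
    also have "\<dots> \<le> 1 - 2 * \<tau> * lo + \<tau>\<^sup>2 * K\<^sup>2"
      using elim n2 lo_pos K by (intro add_mono diff_left_mono mult_left_mono) (auto simp: \<tau>_def)
    also have "\<dots> = 1 - lo\<^sup>2 / K\<^sup>2" using K by (simp add: \<tau>_def field_simps power2_eq_square)
    finally show ?case unfolding \<kappa>_def by (rule real_le_rsqrt)
  qed
  moreover have "\<tau> > 0" "0 \<le> \<kappa>" "\<kappa> < 1"
    using K lo_pos le1 by (auto simp: \<tau>_def \<kappa>_def)
  ultimately show ?thesis using that by blast
qed

lemma smooth_functional_residual:
  assumes l: "smooth_functional l L" and v: "smooth_plane v"
  obtains L' where "smooth_functional (\<lambda>w. l w - sgform v w) L'"
proof
  let ?L = "L + dnorm (\<lambda>z. \<sigma> z * px v z) (\<lambda>z. \<sigma> z * py v z)"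
  show "smooth_functional (\<lambda>w. l w - sgform v w) ?L"
    unfolding smooth_functional_def
  proof (intro conjI allI impI)
    fix u w :: "complex \<Rightarrow> complex" and a b :: complex
    assume uw: "smooth_plane u" "smooth_plane w"
    then have "l (\<lambda>z. a * u z + b * w z) = a * l u + b * l w" using l by (simp add: smooth_functional_def)
    moreover have "sform (px v) (py v) (px (\<lambda>z. a * u z + b * w z)) (py (\<lambda>z. a * u z + b * w z))
        = a * sgform v u + b * sgform v w"
      unfolding px_lincomb[OF uw] py_lincomb[OF uw]
      by (intro dform_lincomb_right sqd_sigma smooth_sqd_grad uw v)
    ultimately show "l (\<lambda>z. a * u z + b * w z) - sform (px v) (py v) (px (\<lambda>z. a * u z + b * w z)) (py (\<lambda>z. a * u z + b * w z))
        = a * (l u - sgform v u) + b * (l w - sgform v w)"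
      by (simp add: algebra_simps)
  next
    fix w assume w: "smooth_plane w"
    have "norm (l w) \<le> L * gnorm w" using l w by (simp add: smooth_functional_def)
    moreover have "norm (sgform v w) \<le> dnorm (\<lambda>z. \<sigma> z * px v z) (\<lambda>z. \<sigma> z * py v z) * gnorm w"
      by (intro dform_Cauchy_Schwarz sqd_sigma smooth_sqd_grad v w)
    ultimately show "norm (l w - sgform v w) \<le> ?L * gnorm w"
      using norm_triangle_ineq4[of "l w" "sgform v w"] by (simp add: algebra_simps)
  qed
qed

text \<open>Damped Richardson iteration: since \<open>\<bar>1 - \<tau>\<sigma>\<bar> \<le> \<kappa> < 1\<close>, correcting by \<open>\<tau>\<close> times an approximate Riesz
  representative of the residual shrinks the residual by a fixed factor.\<close>

lemma Lax_Milgram_sequence: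
  assumes l: "smooth_functional l L"
  obtains v C r where "\<And>k. smooth_plane (v k)" "0 \<le> r" "r < 1"
    "\<And>k. gnorm (\<lambda>z. v (Suc k) z - v k z) \<le> C * r ^ k"
    "\<And>k w. smooth_plane w \<Longrightarrow> norm (l w - sgform (v k) w) \<le> C * r ^ k * gnorm w"
proof -
  obtain \<tau> \<kappa> where \<tau>: "\<tau> > 0" and \<kappa>: "0 \<le> \<kappa>" "\<kappa> < 1" and con: "AE z in DD. norm (1 - of_real \<tau> * \<sigma> z) \<le> \<kappa>"
    by (rule contraction_constants)
  \<comment> \<open>The new residual has the factor \<open>\<eta> + \<kappa> * (1 + \<eta>)\<close>,
    at most \<open>\<kappa> + 2 * \<eta>\<close>; with this \<eta> the latter is \<open>r\<close>,
    halfway between \<kappa> and 1.\<close>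
  define \<eta> where "\<eta> = (1 - \<kappa>) / 4"
  define r where "r = (1 + \<kappa>) / 2"
  have r: "0 < r" "r < 1" and \<eta>: "0 < \<eta>" "\<eta> < 1" using \<kappa> by (auto simp: r_def \<eta>_def)
  define K where "K = \<bar>L\<bar> + 1"
  have K: "K > 0" by (simp add: K_def)
  define P where "P k v \<longleftrightarrow> smooth_plane v \<and> (\<forall>w. smooth_plane w \<longrightarrow>
      norm (l w - sgform v w) \<le> K * r ^ k * gnorm w)" for k v
  define Q where "Q k v v' \<longleftrightarrow> gnorm (\<lambda>z. v' z - v z) \<le> 2 * \<tau> * K * r ^ k" for k :: nat and v v' :: "complex \<Rightarrow> complex"
  have "\<exists>v. \<forall>k. P k (v k) \<and> Q k (v k) (v (Suc k))"
  proof (rule dependent_nat_choice)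
    have "norm (l w - sgform (\<lambda>_. 0) w) \<le> K * gnorm w" if "smooth_plane w" for w
    proof -
      have "norm (l w) \<le> L * gnorm w" using l that by (simp add: smooth_functional_def)
      also have "\<dots> \<le> K * gnorm w" by (intro mult_right_mono) (auto simp: K_def)
      finally show ?thesis by (simp add: dform_def)
    qed
    then show "\<exists>v. P 0 v" unfolding P_def by (intro exI[of _ "\<lambda>_. 0"]) auto
  next
    fix v k assume "P k v"
    then have v: "smooth_plane v" and res: "\<And>w. smooth_plane w \<Longrightarrow>
        norm (l w - sgform v w) \<le> K * r ^ k * gnorm w" by (auto simp: P_def)
    define R where "R = K * r ^ k"
    have R: "R > 0" using K r by (simp add: R_def)
    obtain L' where L': "smooth_functional (\<lambda>w. l w - sgform v w) L'"
      by (rule smooth_functional_residual[OF l v])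
    obtain z where z: "smooth_plane z" and zr: "\<And>w. smooth_plane w \<Longrightarrow>
        norm (l w - sgform v w - gform z w) \<le> \<eta> * R * gnorm w"
      using Riesz_approximation[OF L', of "\<eta> * R"] \<eta> R by auto
    \<comment> \<open>Testing \<open>z\<close> against its own conjugate bounds its energy by the
      residual, up to the error of the approximate representation.\<close>
    have gz: "gnorm z \<le> (1 + \<eta>) * R"
    proof (cases "gnorm z = 0")
      case False
      let ?w = "\<lambda>x. cnj (z x)"
      have w: "smooth_plane ?w" "gnorm ?w = gnorm z" using z by (auto simp: gnorm_cnj smooth_plane_cnj)
      have "(gnorm z)\<^sup>2 = norm (gform z ?w)" unfolding gform_cnj_self[OF z] by (simp add: norm_power)
      also have "\<dots> \<le> norm (l ?w - sgform v ?w)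
          + norm (l ?w - sgform v ?w - gform z ?w)"
        using norm_triangle_ineq4[of "l ?w - sgform v ?w"
            "l ?w - sgform v ?w - gform z ?w"] by simp
      also have "\<dots> \<le> R * gnorm z + \<eta> * R * gnorm z"
        using res[OF w(1)] zr[OF w(1)] unfolding w(2) R_def[symmetric] by (rule add_mono)
      finally have "gnorm z * gnorm z \<le> ((1 + \<eta>) * R) * gnorm z" by (simp add: power2_eq_square algebra_simps)
      then show ?thesis by (rule mult_right_le_imp_le) (use False in \<open>simp add: less_le\<close>)
    qed (use R \<eta> in simp)
    define v' where "v' x = 1 * v x + of_real \<tau> * z x" for x
    have v': "smooth_plane v'" unfolding v'_def[abs_def] by (intro smooth_plane_lincomb v z)
    have pv': "px v' = (\<lambda>x. 1 * px v x + of_real \<tau> * px z x)" "py v' = (\<lambda>x. 1 * py v x + of_real \<tau> * py z x)"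
      unfolding v'_def[abs_def] by (rule px_lincomb[OF v z], rule py_lincomb[OF v z])
    have "norm (l w - sgform v' w) \<le> K * r ^ Suc k * gnorm w" if w: "smooth_plane w" for w
    proof -
      have e1: "sgform v' w
          = sgform v w + of_real \<tau> * sgform z w"
        unfolding pv' using sform_lincomb_left[OF smooth_sqd_grad smooth_sqd_grad smooth_sqd_grad, OF v v z z w w, of 1 "of_real \<tau>"]
        by simp
      have e2: "gform z w - of_real \<tau> * sgform z w
          = dform (\<lambda>x. (1 - of_real \<tau> * \<sigma> x) * px z x) (\<lambda>x. (1 - of_real \<tau> * \<sigma> x) * py z x) (px w) (py w)"
        using dform_lincomb_left[OF smooth_sqd_grad[OF z] sqd_sigma[OF smooth_sqd_grad(1)[OF z]] sqd_sigma[OF smooth_sqd_grad(2)[OF z]] smooth_sqd_grad[OF w], of 1 "- of_real \<tau>"]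
        by (simp add: algebra_simps)
      have m: "(\<lambda>x. 1 - of_real \<tau> * \<sigma> x) \<in> borel_measurable DD" using sigma_measurable by simp
      have "norm (gform z w - of_real \<tau> * sgform z w) \<le> (\<kappa> * gnorm z) * gnorm w"
        unfolding e2
        by (rule order_trans[OF dform_Cauchy_Schwarz])
          (intro mult_right_mono dnorm_bounded_mult m con \<kappa> smooth_sqd_grad z w dnorm_nonneg
             sq_integrable_bounded_mult[OF _ m con])+
      also have "\<dots> \<le> \<kappa> * ((1 + \<eta>) * R) * gnorm w"
        using gz \<kappa> by (intro mult_right_mono mult_left_mono) auto
      finally have b2: "norm (gform z w - of_real \<tau> * sgform z w) \<le> \<kappa> * ((1 + \<eta>) * R) * gnorm w" .
      have "norm (l w - sgform v' w)
          \<le> norm (l w - sgform v w - gform z w)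
            + norm (gform z w - of_real \<tau> * sgform z w)"
        unfolding e1 using norm_triangle_ineq[of "l w - sgform v w - gform z w"
            "gform z w - of_real \<tau> * sgform z w"] by (simp add: algebra_simps)
      also have "\<dots> \<le> \<eta> * R * gnorm w + \<kappa> * ((1 + \<eta>) * R) * gnorm w" by (intro add_mono zr w b2)
      also have "\<dots> = (\<eta> + \<kappa> * (1 + \<eta>)) * (R * gnorm w)" by (simp add: algebra_simps)
      also have "\<dots> \<le> r * (R * gnorm w)"
      proof (rule mult_right_mono)
        have "\<kappa> * \<eta> \<le> \<eta>" using \<kappa> \<eta> by (simp add: mult_left_le_one_le)
        then have "\<eta> + \<kappa> * (1 + \<eta>) \<le> \<kappa> + 2 * \<eta>" by (simp add: algebra_simps)
        also have "\<dots> = r" by (simp add: r_def \<eta>_def field_simps)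
        finally show "\<eta> + \<kappa> * (1 + \<eta>) \<le> r" .
      qed (use R in simp)
      finally show ?thesis by (simp add: R_def mult_ac)
    qed
    then have "P (Suc k) v'" using v' by (simp add: P_def)
    moreover have "Q k v v'"
    proof -
      have "gnorm (\<lambda>x. v' x - v x) = \<tau> * gnorm z"
        using gnorm_cmult[OF z, of "of_real \<tau>"] \<tau> by (simp add: v'_def)
      also have "\<dots> \<le> \<tau> * (2 * R)"
        using gz \<eta> R \<tau> by (intro mult_left_mono order_trans[OF gz] mult_right_mono) auto
      finally show ?thesis by (simp add: Q_def R_def mult_ac)
    qed
    ultimately show "\<exists>v'. P (Suc k) v' \<and> Q k v v'" by blast
  qed
  then obtain v where PQ: "\<And>k. P k (v k)" "\<And>k. Q k (v k) (v (Suc k))" by blast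
  define C where "C = max (2 * \<tau> * K) K"
  have "gnorm (\<lambda>z. v (Suc k) z - v k z) \<le> C * r ^ k" for k
  proof -
    have "gnorm (\<lambda>z. v (Suc k) z - v k z) \<le> 2 * \<tau> * K * r ^ k" using PQ(2) by (simp add: Q_def)
    also have "\<dots> \<le> C * r ^ k" using r by (intro mult_right_mono) (auto simp: C_def)
    finally show ?thesis .
  qed
  moreover have "norm (l w - sgform (v k) w) \<le> C * r ^ k * gnorm w" if "smooth_plane w" for k w
  proof -
    have "norm (l w - sgform (v k) w) \<le> K * r ^ k * gnorm w"
      using PQ(1)[of k] that by (simp add: P_def)
    also have "\<dots> \<le> C * r ^ k * gnorm w" using r by (intro mult_right_mono) (auto simp: C_def)
    finally show ?thesis .
  qed
  moreover have "\<And>k. smooth_plane (v k)" using PQ by (simp add: P_def)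
  ultimately show ?thesis using r less_imp_le by (intro that[of v r C]) auto
qed


text \<open>\<open>neumann_sol\<close> together with the normalized trace; the integration by parts
  in \<open>H1_disk\<close> is recovered from the trace by
  \<open>trace_approx.H1_disk\<close>.\<close>

definition weak_sol :: "functional \<Rightarrow> (complex \<Rightarrow> complex) \<Rightarrow> (complex \<Rightarrow> complex) \<Rightarrow> (complex \<Rightarrow> complex) \<Rightarrow> (real \<Rightarrow> complex) \<Rightarrow> bool" where
  "weak_sol f u p q h \<longleftrightarrow> sqd u \<and> sqd p \<and> sqd q \<and> has_trace u p q h \<and> cint h = 0 \<and>
    (\<forall>v. smooth_plane v \<longrightarrow> sform p q (px v) (py v) = f (\<lambda>\<theta>. v (cis \<theta>)))"

end

section \<open>Weak derivatives and traces as limits of smooth functions\<close>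

lemma disk_test_boundary:
  assumes "\<phi> \<in> disk_test"
  shows "\<phi> (cis \<theta>) = 0"
proof (rule ccontr)
  assume "\<phi> (cis \<theta>) \<noteq> 0"
  then have "cis \<theta> \<in> closure {z. \<phi> z \<noteq> 0}" using closure_subset by fastforce
  then show False using assms by (auto simp: disk_test_def)
qed

text \<open>The divergence theorem for \<open>v * \<phi>\<close>, whose boundary values
  vanish.\<close>

lemma smooth_integration_by_parts:
  assumes v: "smooth_plane v" and \<phi>: "\<phi> \<in> disk_test"
  shows "(LINT z|DD. v z * px \<phi> z) = - (LINT z|DD. px v z * \<phi> z)"
    and "(LINT z|DD. v z * py \<phi> z) = - (LINT z|DD. py v z * \<phi> z)"
proof -
  have s: "smooth_plane \<phi>" using \<phi> by (simp add: disk_test_def)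
  have i: "integrable DD (\<lambda>z. v z * px \<phi> z)" "integrable DD (\<lambda>z. px v z * \<phi> z)"
    "integrable DD (\<lambda>z. v z * py \<phi> z)" "integrable DD (\<lambda>z. py v z * \<phi> z)"
    by (intro smooth_integrable smooth_plane_mult smooth_plane_px smooth_plane_py v s)+
  have "(LINT z|DD. px (\<lambda>z. v z * \<phi> z) z) = 0" "(LINT z|DD. py (\<lambda>z. v z * \<phi> z) z) = 0"
    using disk_px_integral[OF smooth_plane_mult[OF v s]] disk_py_integral[OF smooth_plane_mult[OF v s]]
    by (simp_all add: disk_test_boundary[OF \<phi>])
  then show "(LINT z|DD. v z * px \<phi> z) = - (LINT z|DD. px v z * \<phi> z)"
    "(LINT z|DD. v z * py \<phi> z) = - (LINT z|DD. py v z * \<phi> z)"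
    unfolding px_smooth_mult[OF v s] py_smooth_mult[OF v s] using i by (simp_all add: eq_neg_iff_add_eq_0)
qed

abbreviation sqc :: "(real \<Rightarrow> complex) \<Rightarrow> bool" where "sqc \<equiv> sq_integrable CC"

lemma continuous_sqc: "continuous_on UNIV h \<Longrightarrow> sqc h"
  unfolding sq_integrable_def
  by (auto intro!: cint_integrable continuous_intros borel_measurable_integrable)

lemma smooth_circle_sqc: "smooth_plane v \<Longrightarrow> sqc (\<lambda>\<theta>. v (cis \<theta>))"
  by (intro continuous_sqc per_test_continuous smooth_circle_per_test)

lemma L2_tendsto_integral_fixed:
  assumes "\<And>k. sq_integrable M (f k)" "sq_integrable M f'" "L2_tendsto M f f'" "sq_integrable M g"
  shows "(\<lambda>k. LINT x|M. f k x * g x) \<longlonglongrightarrow> (LINT x|M. f' x * g x)"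
  using L2_tendsto_integral_mult[of M f "\<lambda>_. g" f' g] assms L2_tendsto_const by blast

lemma dform_tendsto:
  assumes "\<And>k. sqd (p k)" "\<And>k. sqd (q k)" "sqd p'" "sqd q'" "L2_tendsto DD p p'" "L2_tendsto DD q q'"
    and "sqd a" "sqd b"
  shows "(\<lambda>k. dform (p k) (q k) a b) \<longlonglongrightarrow> dform p' q' a b"
proof -
  have "(\<lambda>k. (LINT z|DD. p k z * a z) + (LINT z|DD. q k z * b z)) \<longlonglongrightarrow> (LINT z|DD. p' z * a z) + (LINT z|DD. q' z * b z)"
    by (intro tendsto_add L2_tendsto_integral_fixed assms)
  then show ?thesis using assms by (simp add: dform_eq)
qed

text \<open>The witness hidden in \<open>has_trace\<close> is made a parameter: whatever is
  continuous in L^2 and known for the smooth \<open>v k\<close>, such as integration by parts and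
  Green's formula, then holds for the limit.\<close>

locale trace_approx =
  fixes u p q :: "complex \<Rightarrow> complex" and h :: "real \<Rightarrow> complex" and v :: "nat \<Rightarrow> complex \<Rightarrow> complex"
  assumes sq: "sqd u" "sqd p" "sqd q" "sqc h"
    and smooth: "\<And>k. smooth_plane (v k)"
    and lim: "L2_tendsto DD v u" "L2_tendsto DD (\<lambda>k. px (v k)) p" "L2_tendsto DD (\<lambda>k. py (v k)) q"
      "L2_tendsto CC (\<lambda>k \<theta>. v k (cis \<theta>)) h"
begin

lemma has_trace: "has_trace u p q h"
  unfolding has_trace_def using sq smooth lim by blast

lemma H1_disk: "H1_disk u p q"
  unfolding H1_disk_def
proof (intro conjI ballI sq)
  fix \<phi> assume \<phi>: "\<phi> \<in> disk_test"
  then have s: "smooth_plane \<phi>" by (simp add: disk_test_def)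
  have "(\<lambda>k. LINT z|DD. v k z * px \<phi> z) \<longlonglongrightarrow> (LINT z|DD. u z * px \<phi> z)"
    "(\<lambda>k. LINT z|DD. v k z * py \<phi> z) \<longlonglongrightarrow> (LINT z|DD. u z * py \<phi> z)"
    by (intro L2_tendsto_integral_fixed smooth_sq_integrable sq lim smooth smooth_sqd_grad s)+
  moreover have "(\<lambda>k. - (LINT z|DD. px (v k) z * \<phi> z)) \<longlonglongrightarrow> - (LINT z|DD. p z * \<phi> z)"
    "(\<lambda>k. - (LINT z|DD. py (v k) z * \<phi> z)) \<longlonglongrightarrow> - (LINT z|DD. q z * \<phi> z)"
    by (intro tendsto_minus L2_tendsto_integral_fixed smooth_sq_integrable sq lim smooth smooth_sqd_grad s)+
  ultimately show "(LINT z|DD. u z * px \<phi> z) = - (LINT z|DD. p z * \<phi> z)"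
    "(LINT z|DD. u z * py \<phi> z) = - (LINT z|DD. q z * \<phi> z)"
    unfolding smooth_integration_by_parts[OF smooth \<phi>] using LIMSEQ_unique by blast+
qed

lemma gnorm_tendsto: "(\<lambda>k. gnorm (v k)) \<longlonglongrightarrow> dnorm p q"
  unfolding dnorm_def
  by (intro tendsto_intros L2_tendsto_l2norm smooth_sqd_grad smooth sq lim)

lemma cint_mult_tendsto:
  "sqc g \<Longrightarrow> (\<lambda>k. cint (\<lambda>\<theta>. v k (cis \<theta>) * g \<theta>)) \<longlonglongrightarrow> cint (\<lambda>\<theta>. h \<theta> * g \<theta>)"
  by (intro L2_tendsto_integral_fixed smooth_circle_sqc smooth sq lim)

lemma pcoeff_tendsto: "(\<lambda>k. pcoeff (\<lambda>\<theta>. v k (cis \<theta>)) n) \<longlonglongrightarrow> pcoeff h n"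
  unfolding pcoeff_def
  by (intro tendsto_divide tendsto_const cint_mult_tendsto continuous_sqc continuous_on_fmode) simp

lemma Green: "dform p q (px (hmode (- n))) (py (hmode (- n))) = 2 * pi * of_int \<bar>n\<bar> * pcoeff h n"
proof (rule LIMSEQ_unique)
  show "(\<lambda>k. gform (v k) (hmode (- n))) \<longlonglongrightarrow> dform p q (px (hmode (- n))) (py (hmode (- n)))"
    by (intro dform_tendsto smooth_sqd_grad smooth sq lim smooth_hmode)
  show "(\<lambda>k. gform (v k) (hmode (- n))) \<longlonglongrightarrow> 2 * pi * of_int \<bar>n\<bar> * pcoeff h n"
    unfolding Green_hmode[OF smooth] by (auto intro!: tendsto_intros pcoeff_tendsto)
qed

end

lemma has_trace_approx:
  assumes "sqd u" "sqd p" "sqd q" "has_trace u p q h"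
  obtains v where "trace_approx u p q h v"
  using assms unfolding has_trace_def trace_approx_def by blast

lemma has_trace_lincomb:
  assumes "trace_approx u p q h v" "trace_approx u' p' q' h' v'"
  shows "trace_approx (\<lambda>z. a * u z + b * u' z) (\<lambda>z. a * p z + b * p' z) (\<lambda>z. a * q z + b * q' z)
    (\<lambda>\<theta>. a * h \<theta> + b * h' \<theta>) (\<lambda>k z. a * v k z + b * v' k z)"
proof -
  interpret A: trace_approx u p q h v by fact
  interpret B: trace_approx u' p' q' h' v' by fact
  show ?thesis
    by unfold_locales
      (auto intro!: sq_integrable_add sq_integrable_cmult A.sq B.sq smooth_plane_lincomb A.smooth B.smooth
        L2_tendsto_lincomb A.lim B.lim smooth_circle_sqc intro: smooth_sq_integrable smooth_sqd_grad
        simp: px_lincomb[OF A.smooth B.smooth] py_lincomb[OF A.smooth B.smooth])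
qed

text \<open>Only gradients are controlled, so the boundary mean is removed first: then
  \<open>trace_l2norm_le\<close> bounds the boundary values and \<open>disk_Poincare\<close> the
  functions, and all four sequences converge by \<open>l2norm_geometric_complete\<close>.\<close>

lemma trace_approx_exists:
  assumes v: "\<And>k. smooth_plane (v k)" and step: "\<And>k. gnorm (\<lambda>z. v (Suc k) z - v k z) \<le> C * r ^ k"
    and r: "0 \<le> r" "r < 1"
  obtains u p q h w where "trace_approx u p q h w" "cint h = 0" "\<And>k. px (w k) = px (v k)" "\<And>k. py (w k) = py (v k)"
proof -
  define w where "w k z = 1 * v k z + (- pcoeff (\<lambda>\<theta>. v k (cis \<theta>)) 0) * 1" for k z
  have w: "smooth_plane (w k)" for k
    unfolding w_def[abs_def] by (intro smooth_plane_lincomb v smooth_plane_const)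
  have pw: "px (w k) = px (v k)" "py (w k) = py (v k)" for k
  proof -
    have "px (\<lambda>z. 1 * v k z + c * 1) = px (v k)" "py (\<lambda>z. 1 * v k z + c * 1) = py (v k)" for c
      using px_lincomb[OF v[of k] smooth_plane_const[of 1], of 1 c] py_lincomb[OF v[of k] smooth_plane_const[of 1], of 1 c]
      by simp_all
    then show "px (w k) = px (v k)" "py (w k) = py (v k)" unfolding w_def[abs_def] by blast+
  qed
  have w0: "cint (\<lambda>\<theta>. w k (cis \<theta>)) = 0" for k
  proof -
    have "pcoeff (\<lambda>\<theta>. w k (cis \<theta>)) 0 = 0"
      unfolding w_def
      by (subst pcoeff_lincomb) (auto intro!: per_test_continuous[OF smooth_circle_per_test] v pcoeff_fmode[of 0 0, simplified]
          simp: pcoeff_fmode[of 0, simplified])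
    then show ?thesis by (simp add: pcoeff_def)
  qed
  define d where "d k z = w (Suc k) z - w k z" for k z
  have d: "smooth_plane (d k)" for k unfolding d_def[abs_def] by (intro smooth_plane_diff w)
  have pd: "px (d k) = (\<lambda>z. px (v (Suc k)) z - px (v k) z)" "py (d k) = (\<lambda>z. py (v (Suc k)) z - py (v k) z)" for k
    unfolding d_def[abs_def] px_diff[OF w w] py_diff[OF w w] pw by auto
  have gd: "gnorm (d k) \<le> C * r ^ k" for k
    using step[of k] unfolding px_diff[OF v v] py_diff[OF v v] pd .
  have d0: "cint (\<lambda>\<theta>. d k (cis \<theta>)) = 0" for k
    using w0 cint_integrable[OF per_test_continuous[OF smooth_circle_per_test[OF w]]] by (simp add: d_def)
  have td: "l2norm CC (\<lambda>\<theta>. d k (cis \<theta>)) \<le> gnorm (d k)" for k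
    by (rule trace_l2norm_le[OF d d0])
  have dd: "l2norm DD (d k) \<le> 2 * gnorm (d k)" for k
  proof -
    have "(l2norm DD (d k))\<^sup>2 \<le> (gnorm (d k))\<^sup>2 + (gnorm (d k))\<^sup>2"
      using disk_Poincare[OF d, of k] power_mono[OF td[of k] l2norm_nonneg, of 2] by linarith
    also have "\<dots> \<le> (2 * gnorm (d k))\<^sup>2" by (simp add: power_mult_distrib)
    finally show ?thesis by (rule power2_le_imp_le) simp
  qed
  have s1: "l2norm DD (\<lambda>z. px (v (Suc k)) z - px (v k) z) \<le> C * r ^ k"
    "l2norm DD (\<lambda>z. py (v (Suc k)) z - py (v k) z) \<le> C * r ^ k"
    "l2norm DD (\<lambda>z. w (Suc k) z - w k z) \<le> (2 * C) * r ^ k"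
    "l2norm CC (\<lambda>\<theta>. w (Suc k) (cis \<theta>) - w k (cis \<theta>)) \<le> C * r ^ k" for k
  proof -
    show "l2norm DD (\<lambda>z. px (v (Suc k)) z - px (v k) z) \<le> C * r ^ k"
      "l2norm DD (\<lambda>z. py (v (Suc k)) z - py (v k) z) \<le> C * r ^ k"
      using order_trans[OF l2norm_le_dnorm(1) gd[of k]] order_trans[OF l2norm_le_dnorm(2) gd[of k]] unfolding pd by auto
    have "l2norm DD (d k) \<le> (2 * C) * r ^ k" "l2norm CC (\<lambda>\<theta>. d k (cis \<theta>)) \<le> C * r ^ k"
      using dd[of k] gd[of k] td[of k] by linarith+
    then show "l2norm DD (\<lambda>z. w (Suc k) z - w k z) \<le> (2 * C) * r ^ k"
      "l2norm CC (\<lambda>\<theta>. w (Suc k) (cis \<theta>) - w k (cis \<theta>)) \<le> C * r ^ k"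
      by (simp_all add: d_def[abs_def])
  qed
  obtain u where u: "sqd u" "L2_tendsto DD w u"
    by (rule l2norm_geometric_complete[OF finite_measure_disk smooth_sq_integrable[OF w] s1(3) r])
  obtain p where p: "sqd p" "L2_tendsto DD (\<lambda>k. px (v k)) p"
    by (rule l2norm_geometric_complete[OF finite_measure_disk smooth_sqd_grad(1)[OF v] s1(1) r])
  obtain q where q: "sqd q" "L2_tendsto DD (\<lambda>k. py (v k)) q"
    by (rule l2norm_geometric_complete[OF finite_measure_disk smooth_sqd_grad(2)[OF v] s1(2) r])
  obtain h where h: "sqc h" "L2_tendsto CC (\<lambda>k \<theta>. w k (cis \<theta>)) h"
    by (rule l2norm_geometric_complete[OF finite_measure_circle smooth_circle_sqc[OF w] s1(4) r])
  have A: "trace_approx u p q h w"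
    by unfold_locales (use u p q h w in \<open>simp_all add: pw\<close>)
  interpret trace_approx u p q h w by (rule A)
  have "cint (\<lambda>\<theta>. h \<theta> * 1) = 0"
    using cint_mult_tendsto[of "\<lambda>_. 1"] w0 by (simp add: continuous_sqc LIMSEQ_const_iff)
  then show ?thesis using that[OF A _ pw] by simp
qed

text \<open>The duality of the Sobolev orders 1/2 and -1/2: \<open>trace_energy_le\<close> bounds
  the former seminorm of the boundary values by the gradient, and mode 0 drops out because
  \<open>f\<close> has mean zero.\<close>

lemma boundary_functional_bound:
  assumes f: "f \<in> Hs0 (-1/2)" and v: "smooth_plane v"
  shows "norm (f (\<lambda>\<theta>. v (cis \<theta>))) \<le> Hs_norm (-1/2) f * gnorm v"
proof -
  let ?c = "pcoeff (\<lambda>\<theta>. v (cis \<theta>))"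
  have bound: "norm (\<Sum>n\<in>F. ?c n * f (fmode n)) \<le> Hs_norm (-1/2) f * gnorm v" if F: "finite F" for F
  proof -
    have f0: "fcoeff f 0 = 0" using f by (rule Hs0_fcoeff)
    \<comment> \<open>The factors are arranged so that for \<open>n\<close> other than 0 the weights
      multiply to \<open>2 * pi\<close>, the normalization in \<open>pdist_fmode\<close>.\<close>
    define a where "a n = sqrt (2 * pi * of_int \<bar>n\<bar>) * norm (?c n)" for n
    define b where "b n = sqrt (2 * pi / wt n) * norm (fcoeff f (- n))" for n
    have t: "norm (?c n * f (fmode n)) \<le> a n * b n" for n
    proof (cases "n = 0")
      case False
      have "sqrt (2 * pi * of_int \<bar>n\<bar>) * sqrt (2 * pi / wt n) = 2 * pi"
      proof -
        have e: "2 * pi * of_int \<bar>n\<bar> * (2 * pi / wt n) = (2 * pi)\<^sup>2"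
          using False by (simp add: wt_nonzero power2_eq_square)
        show ?thesis unfolding real_sqrt_mult[symmetric] e by (subst real_sqrt_abs) simp
      qed
      then have "a n * b n = 2 * pi * (norm (?c n) * norm (fcoeff f (- n)))"
        by (simp add: a_def b_def mult_ac)
      then show ?thesis by (simp add: pdist_fmode norm_mult)
    qed (use f0 in \<open>simp add: a_def fcoeff_def\<close>)
    have "(\<Sum>n\<in>F. a n * b n)\<^sup>2 \<le> (\<Sum>n\<in>F. (a n)\<^sup>2) * (\<Sum>n\<in>F. (b n)\<^sup>2)" by (rule Cauchy_Schwarz_ineq_sum)
    also have "\<dots> \<le> (gnorm v)\<^sup>2 * (Hs_norm (-1/2) f)\<^sup>2"
    proof (rule mult_mono)
      show "(\<Sum>n\<in>F. (a n)\<^sup>2) \<le> (gnorm v)\<^sup>2"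
        using trace_energy_le[OF v F] by (simp add: a_def power_mult_distrib sum_distrib_left mult.assoc)
      have "(\<Sum>n\<in>F. (b n)\<^sup>2) = 2 * pi * (\<Sum>n\<in>F. sob_weight (-1/2) (- n) * (norm (fcoeff f (- n)))\<^sup>2)"
      proof -
        have "(b n)\<^sup>2 = 2 * pi * (sob_weight (-1/2) (- n) * (norm (fcoeff f (- n)))\<^sup>2)" for n
        proof -
          have "(sqrt (2 * pi / wt n))\<^sup>2 = 2 * pi / wt n" by (rule real_sqrt_pow2) (simp add: less_imp_le)
          then show ?thesis
            unfolding b_def power_mult_distrib by (simp add: sob_weight_wt powr_minus_divide abs_of_pos)
        qed
        then show ?thesis by (simp add: sum_distrib_left)
      qed
      also have "(\<Sum>n\<in>F. sob_weight (-1/2) (- n) * (norm (fcoeff f (- n)))\<^sup>2)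
          = (\<Sum>n\<in>uminus ` F. sob_weight (-1/2) n * (norm (fcoeff f n))\<^sup>2)"
        by (simp add: sum.reindex)
      also have "2 * pi * \<dots> \<le> (Hs_norm (-1/2) f)\<^sup>2"
        unfolding Hs_norm_square
        by (intro mult_left_mono finite_sum_le_infsum Hs_summable Hs0_Hs f) (use F in auto)
      finally show "(\<Sum>n\<in>F. (b n)\<^sup>2) \<le> (Hs_norm (-1/2) f)\<^sup>2" .
    qed (auto intro: sum_nonneg)
    also have "\<dots> = (Hs_norm (-1/2) f * gnorm v)\<^sup>2" by (simp add: power_mult_distrib)
    finally have "(\<Sum>n\<in>F. a n * b n) \<le> Hs_norm (-1/2) f * gnorm v" by (rule power2_le_imp_le) simp
    then show ?thesis using sum_norm_le[of F "\<lambda>n. ?c n * f (fmode n)" "\<lambda>n. a n * b n"] t by force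
  qed
  \<comment> \<open>The partial sums converge to the value of \<open>f\<close> by
    \<open>pdist_has_sum\<close>, and the uniform bound survives the limit.\<close>
  have "((\<lambda>F. norm (\<Sum>n\<in>F. ?c n * f (fmode n))) \<longlongrightarrow> norm (f (\<lambda>\<theta>. v (cis \<theta>)))) (finite_subsets_at_top UNIV)"
    using pdist_has_sum[OF Hs0_pdist[OF f] smooth_circle_per_test[OF v]]
    unfolding has_sum_def by (rule tendsto_norm)
  then show ?thesis
    by (rule tendsto_upperbound[OF _ eventually_finite_subsets_at_top_weakI[OF bound]]) auto
qed

section \<open>Existence, energy estimate and uniqueness of weak solutions\<close>

context elliptic
begin

lemma weak_sol_exists:
  assumes f: "f \<in> Hs0 (-1/2)"
  obtains u p q h where "weak_sol f u p q h"
proof -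
  let ?l = "\<lambda>v. f (\<lambda>\<theta>. v (cis \<theta>))"
  have "smooth_functional ?l (Hs_norm (-1/2) f)"
    unfolding smooth_functional_def
    using pdist_lincomb[OF Hs0_pdist[OF f] smooth_circle_per_test smooth_circle_per_test] boundary_functional_bound[OF f]
    by blast
  then obtain v C r where v: "\<And>k. smooth_plane (v k)" and r: "0 \<le> r" "r < 1"
    and step: "\<And>k. gnorm (\<lambda>z. v (Suc k) z - v k z) \<le> C * r ^ k"
    and res: "\<And>k w. smooth_plane w \<Longrightarrow> norm (?l w - sgform (v k) w) \<le> C * r ^ k * gnorm w"
    by (rule Lax_Milgram_sequence) (rule that)
  obtain u p q h w where T: "trace_approx u p q h w" and h0: "cint h = 0"
    and pw: "\<And>k. px (w k) = px (v k)" "\<And>k. py (w k) = py (v k)"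
    by (rule trace_approx_exists[OF v step r]) (rule that)
  interpret trace_approx u p q h w by (rule T)
  \<comment> \<open>The forms of the iterates converge to that of the limit because \<sigma> is
    bounded, and to the functional because the residuals tend to 0.\<close>
  have "sform p q (px x) (py x) = ?l x" if x: "smooth_plane x" for x
  proof (rule LIMSEQ_unique)
    show "(\<lambda>k. sgform (v k) x) \<longlonglongrightarrow> sform p q (px x) (py x)"
      using lim(2,3) unfolding pw
      by (intro dform_tendsto sqd_sigma smooth_sqd_grad v x sq L2_tendsto_bounded_mult[OF _ _ _ sigma_measurable sigma_bounded])
    have "(\<lambda>k. C * r ^ k * gnorm x) \<longlonglongrightarrow> 0"
      using tendsto_mult[OF tendsto_mult[OF tendsto_const LIMSEQ_realpow_zero[OF r]] tendsto_const, of C "gnorm x"] by simp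
    then have "(\<lambda>k. ?l x - sgform (v k) x) \<longlonglongrightarrow> 0"
      by (rule LIMSEQ_zero_bounded) (rule res[OF x])
    from tendsto_diff[OF tendsto_const[of "?l x"] this]
    show "(\<lambda>k. sgform (v k) x) \<longlonglongrightarrow> ?l x" by simp
  qed
  then show ?thesis using that[of u p q h] sq has_trace h0 by (simp add: weak_sol_def)
qed

lemma weak_sol_approx:
  assumes "weak_sol f u p q h"
  obtains v where "trace_approx u p q h v"
  using assms has_trace_approx[of u p q h] by (auto simp: weak_sol_def)

lemma weak_sol_lincomb:
  assumes "weak_sol f u p q h" "weak_sol g u' p' q' h'"
  shows "weak_sol (\<lambda>\<phi>. a * f \<phi> + b * g \<phi>) (\<lambda>z. a * u z + b * u' z) (\<lambda>z. a * p z + b * p' z) (\<lambda>z. a * q z + b * q' z)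
    (\<lambda>\<theta>. a * h \<theta> + b * h' \<theta>)"
proof -
  obtain v v' where T: "trace_approx u p q h v" "trace_approx u' p' q' h' v'"
    using assms weak_sol_approx by metis
  interpret A: trace_approx u p q h v by (rule T)
  interpret B: trace_approx u' p' q' h' v' by (rule T)
  interpret AB: trace_approx "\<lambda>z. a * u z + b * u' z" "\<lambda>z. a * p z + b * p' z" "\<lambda>z. a * q z + b * q' z"
    "\<lambda>\<theta>. a * h \<theta> + b * h' \<theta>" "\<lambda>k z. a * v k z + b * v' k z"
    by (rule has_trace_lincomb[OF T])
  have "integrable CC h" "integrable CC h'"
    by (intro sq_integrable_integrable finite_measure_circle A.sq B.sq)+
  then have "cint (\<lambda>\<theta>. a * h \<theta> + b * h' \<theta>) = 0" using assms by (simp add: weak_sol_def)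
  then show ?thesis
    using assms AB.sq AB.has_trace
    by (simp add: weak_sol_def sform_lincomb_left smooth_sqd_grad)
qed

text \<open>The weak equation is tested with the conjugate of the solution itself, reached through
  the conjugated approximants; ellipticity bounds the real part of the result below and
  \<open>boundary_functional_bound\<close> its modulus above.\<close>

lemma weak_sol_energy:
  assumes s: "weak_sol f u p q h" and f: "f \<in> Hs0 (-1/2)"
  shows "lo * dnorm p q \<le> Hs_norm (-1/2) f"
proof -
  obtain v where T: "trace_approx u p q h v" by (rule weak_sol_approx[OF s])
  interpret trace_approx u p q h v by (rule T)
  let ?pc = "\<lambda>z. cnj (p z)" and ?qc = "\<lambda>z. cnj (q z)"
  have cn: "L2_tendsto DD (\<lambda>k z. cnj (f k z)) (\<lambda>z. cnj (g z))" if "L2_tendsto DD f g" for f g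
    using that by (simp add: L2_tendsto_def flip: complex_cnj_diff)
  have "(\<lambda>k. sform (\<lambda>z. cnj (px (v k) z)) (\<lambda>z. cnj (py (v k) z)) p q) \<longlonglongrightarrow> sform ?pc ?qc p q"
    by (intro dform_tendsto sqd_sigma sq_integrable_cnj smooth_sqd_grad smooth sq
        L2_tendsto_bounded_mult[OF _ _ _ sigma_measurable sigma_bounded] cn lim)
  moreover have "sform (\<lambda>z. cnj (px (v k) z)) (\<lambda>z. cnj (py (v k) z)) p q = f (\<lambda>\<theta>. cnj (v k (cis \<theta>)))" for k
    unfolding sform_commute[of _ _ p] using s smooth_plane_cnj[OF smooth, of k]
    by (simp add: weak_sol_def px_smooth_cnj[OF smooth, symmetric] py_smooth_cnj[OF smooth, symmetric])
  ultimately have l: "(\<lambda>k. norm (f (\<lambda>\<theta>. cnj (v k (cis \<theta>))))) \<longlonglongrightarrow> norm (sform ?pc ?qc p q)"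
    by (simp add: tendsto_norm)
  have "norm (sform ?pc ?qc p q) \<le> Hs_norm (-1/2) f * dnorm p q"
  proof (rule LIMSEQ_le[OF l])
    show "(\<lambda>k. Hs_norm (-1/2) f * gnorm (v k)) \<longlonglongrightarrow> Hs_norm (-1/2) f * dnorm p q"
      by (intro tendsto_mult tendsto_const gnorm_tendsto)
    show "\<exists>N. \<forall>n\<ge>N. norm (f (\<lambda>\<theta>. cnj (v n (cis \<theta>)))) \<le> Hs_norm (-1/2) f * gnorm (v n)"
      using boundary_functional_bound[OF f smooth_plane_cnj[OF smooth]] by (auto simp: gnorm_cnj[OF smooth])
  qed
  moreover have "lo * (dnorm p q)\<^sup>2 \<le> Re (sform ?pc ?qc p q)"
  proof -
    have i: "integrable DD (\<lambda>z. \<sigma> z * ?pc z * p z + \<sigma> z * ?qc z * q z)"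
      by (intro dform_integrable sqd_sigma sq_integrable_cnj sq)
    have n: "integrable DD (\<lambda>z. (norm (p z))\<^sup>2)" "integrable DD (\<lambda>z. (norm (q z))\<^sup>2)"
      using sq by (auto simp: sq_integrable_def)
    have "lo * (dnorm p q)\<^sup>2 = (LINT z|DD. lo * ((norm (p z))\<^sup>2 + (norm (q z))\<^sup>2))"
      using n by (simp add: dnorm_square l2norm_square)
    also have "\<dots> \<le> (LINT z|DD. Re (\<sigma> z * ?pc z * p z + \<sigma> z * ?qc z * q z))"
    proof (rule integral_mono_AE)
      show "AE z in DD. lo * ((norm (p z))\<^sup>2 + (norm (q z))\<^sup>2) \<le> Re (\<sigma> z * ?pc z * p z + \<sigma> z * ?qc z * q z)"
        using sigma_coercive
      proof eventually_elim
        case (elim z)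
        have "\<sigma> z * ?pc z * p z + \<sigma> z * ?qc z * q z = \<sigma> z * of_real ((norm (p z))\<^sup>2 + (norm (q z))\<^sup>2)"
          unfolding of_real_add complex_norm_square by (simp add: algebra_simps)
        then have "Re (\<sigma> z * ?pc z * p z + \<sigma> z * ?qc z * q z) = Re (\<sigma> z) * ((norm (p z))\<^sup>2 + (norm (q z))\<^sup>2)"
          by (simp only: Re_complex_of_real Im_complex_of_real times_complex.sel mult_zero_right diff_zero)
        then show ?case using elim by (simp add: mult_right_mono)
      qed
      show "integrable DD (\<lambda>z. Re (\<sigma> z * ?pc z * p z + \<sigma> z * ?qc z * q z))" by (rule integrable_Re[OF i])
    qed (use n in auto)
    also have "\<dots> = Re (sform ?pc ?qc p q)" unfolding dform_def by (rule integral_Re[OF i])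
    finally show ?thesis .
  qed
  moreover have "Re (sform ?pc ?qc p q) \<le> norm (sform ?pc ?qc p q)" by (rule complex_Re_le_cmod)
  ultimately have *: "(lo * dnorm p q) * dnorm p q \<le> Hs_norm (-1/2) f * dnorm p q"
    by (simp add: power2_eq_square mult.assoc)
  show ?thesis
  proof (cases "dnorm p q = 0")
    case False
    then have "0 < dnorm p q" using dnorm_nonneg[of p q] by linarith
    then show ?thesis by (rule mult_right_le_imp_le[OF *])
  qed simp
qed

text \<open>The difference of two solutions has data 0, hence gradient 0 by the energy estimate;
  Green's formula kills all its boundary modes but the constant, and the normalization kills that.
  Equality is claimed for distributions because a trace is fixed only up to a null set.\<close>

lemma weak_sol_unique:
  assumes "weak_sol f u p q h" "weak_sol f u' p' q' h'"
  shows "dist_of h = dist_of h'"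
proof -
  let ?d = "\<lambda>\<theta>. 1 * h \<theta> + (- 1) * h' \<theta>"
  have s: "weak_sol (\<lambda>\<phi>. 1 * f \<phi> + (- 1) * f \<phi>) (\<lambda>z. 1 * u z + (- 1) * u' z) (\<lambda>z. 1 * p z + (- 1) * p' z)
      (\<lambda>z. 1 * q z + (- 1) * q' z) ?d"
    by (rule weak_sol_lincomb[OF assms])
  then have s0: "weak_sol (\<lambda>_. 0) (\<lambda>z. 1 * u z + (- 1) * u' z) (\<lambda>z. 1 * p z + (- 1) * p' z) (\<lambda>z. 1 * q z + (- 1) * q' z) ?d"
    by simp
  have "lo * dnorm (\<lambda>z. 1 * p z + (- 1) * p' z) (\<lambda>z. 1 * q z + (- 1) * q' z) \<le> 0"
    using weak_sol_energy[OF s0 zero_in_Hs0] by simp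
  then have e: "dnorm (\<lambda>z. 1 * p z + (- 1) * p' z) (\<lambda>z. 1 * q z + (- 1) * q' z) = 0"
    using lo_pos dnorm_nonneg by (simp add: mult_le_0_iff order.antisym)
  obtain v where T: "trace_approx (\<lambda>z. 1 * u z + (- 1) * u' z) (\<lambda>z. 1 * p z + (- 1) * p' z) (\<lambda>z. 1 * q z + (- 1) * q' z) ?d v"
    by (rule weak_sol_approx[OF s0])
  interpret trace_approx "\<lambda>z. 1 * u z + (- 1) * u' z" "\<lambda>z. 1 * p z + (- 1) * p' z" "\<lambda>z. 1 * q z + (- 1) * q' z" ?d v
    by (rule T)
  have z: "pcoeff ?d n = 0" for n
  proof (cases "n = 0")
    case True
    then show ?thesis using s0 by (simp add: weak_sol_def pcoeff_def)
  next
    case False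
    have "norm (2 * pi * of_int \<bar>n\<bar> * pcoeff ?d n) \<le> 0 * gnorm (hmode (- n))"
      unfolding Green[symmetric] e[symmetric] by (intro dform_Cauchy_Schwarz sq smooth_sqd_grad smooth_hmode)
    then show ?thesis using False by simp
  qed
  have sq': "sqc h" "sqc h'" using assms by (auto simp: weak_sol_def has_trace_def)
  then have i: "integrable CC h" "integrable CC h'"
    by (auto intro: sq_integrable_integrable finite_measure_circle)
  show ?thesis
  proof (rule pdist_eqI)
    show "dist_of h \<in> pdist" "dist_of h' \<in> pdist" using i by (auto intro: dist_of_in_pdist)
    fix n
    have "pcoeff ?d n = pcoeff h n - pcoeff h' n"
      using integrable_mult_per_test[OF i(1) fmode_in_per_test[of "- n"]] integrable_mult_per_test[OF i(2) fmode_in_per_test[of "- n"]]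
      by (simp add: pcoeff_def left_diff_distrib diff_divide_distrib)
    then show "fcoeff (dist_of h) n = fcoeff (dist_of h') n" using z by (simp add: fcoeff_dist_of)
  qed
qed

lemma neumann_sol_iff_weak_sol:
  "neumann_sol \<sigma> f u p q \<and> has_trace u p q h \<and> cint h = 0 \<longleftrightarrow> weak_sol f u p q h"
proof
  assume "neumann_sol \<sigma> f u p q \<and> has_trace u p q h \<and> cint h = 0"
  then show "weak_sol f u p q h" by (auto simp: neumann_sol_def weak_sol_def sform_eq H1_disk_def)
next
  assume s: "weak_sol f u p q h"
  obtain v where "trace_approx u p q h v" by (rule weak_sol_approx[OF s])
  then have "H1_disk u p q" by (rule trace_approx.H1_disk)
  then show "neumann_sol \<sigma> f u p q \<and> has_trace u p q h \<and> cint h = 0"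
    using s by (auto simp: neumann_sol_def weak_sol_def sform_eq)
qed

text \<open>Uniqueness resolves the definite description: any weak solution may be used to compute
  \<open>ND\<close>.\<close>

lemma ND_eq:
  assumes "weak_sol f u p q h"
  shows "ND \<sigma> f = dist_of h"
  unfolding ND_def
proof (rule the_equality)
  show "\<exists>u p q h'. neumann_sol \<sigma> f u p q \<and> has_trace u p q h' \<and> cint h' = 0 \<and> dist_of h = dist_of h'"
    using assms neumann_sol_iff_weak_sol by blast
  fix g assume "\<exists>u p q h. neumann_sol \<sigma> f u p q \<and> has_trace u p q h \<and> cint h = 0 \<and> g = dist_of h"
  then show "g = dist_of h" using weak_sol_unique[OF assms] neumann_sol_iff_weak_sol by metis
qed

end

section \<open>The relative Neumann-to-Dirichlet map\<close>

context elliptic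
begin

lemma ND_in_pdist: "f \<in> Hs0 (-1/2) \<Longrightarrow> ND \<sigma> f \<in> pdist"
proof -
  assume f: "f \<in> Hs0 (-1/2)"
  obtain u p q h where s: "weak_sol f u p q h" by (rule weak_sol_exists[OF f])
  then have "integrable CC h"
    by (auto simp: weak_sol_def has_trace_def intro: sq_integrable_integrable finite_measure_circle)
  then show ?thesis using ND_eq[OF s] by (simp add: dist_of_in_pdist)
qed

lemma weak_sol_fcoeff: "weak_sol f u p q h \<Longrightarrow> fcoeff (ND \<sigma> f) n = pcoeff h n"
  by (simp add: ND_eq fcoeff_dist_of)

lemma ND_fcoeff_0:
  assumes "f \<in> Hs0 (-1/2)"
  shows "fcoeff (ND \<sigma> f) 0 = 0"
proof -
  obtain u p q h where s: "weak_sol f u p q h" by (rule weak_sol_exists[OF assms])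
  then show ?thesis unfolding weak_sol_fcoeff[OF s] by (simp add: weak_sol_def pcoeff_def)
qed

lemma ND_lincomb:
  assumes "f \<in> Hs0 (-1/2)" "g \<in> Hs0 (-1/2)"
  shows "fcoeff (ND \<sigma> (\<lambda>\<phi>. a * f \<phi> + b * g \<phi>)) n = a * fcoeff (ND \<sigma> f) n + b * fcoeff (ND \<sigma> g) n"
proof -
  obtain u p q h where s: "weak_sol f u p q h" by (rule weak_sol_exists[OF assms(1)])
  obtain u' p' q' h' where s': "weak_sol g u' p' q' h'" by (rule weak_sol_exists[OF assms(2)])
  have "integrable CC h" "integrable CC h'"
    using s s' by (auto simp: weak_sol_def has_trace_def intro: sq_integrable_integrable finite_measure_circle)
  then have i: "integrable CC (\<lambda>\<theta>. h \<theta> * fmode (- n) \<theta>)" "integrable CC (\<lambda>\<theta>. h' \<theta> * fmode (- n) \<theta>)"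
    by (auto intro: integrable_mult_per_test fmode_in_per_test)
  show ?thesis
    unfolding weak_sol_fcoeff[OF s] weak_sol_fcoeff[OF s'] weak_sol_fcoeff[OF weak_sol_lincomb[OF s s', of a b]]
    using i by (simp add: pcoeff_def distrib_right mult.assoc add_divide_distrib)
qed

text \<open>The form of the two solutions is computed twice, each time testing the equation of one
  with the smooth approximants of the other; it is symmetric, so the results agree. The signs arise
  because the \<open>n\<close>-th coefficient is a pairing with \<open>fmode (- n)\<close>.\<close>

lemma ND_symmetric:
  assumes "m \<noteq> 0" "n \<noteq> 0"
  shows "fcoeff (ND \<sigma> (dist_of (fmode m))) n = fcoeff (ND \<sigma> (dist_of (fmode (- n)))) (- m)"
proof -
  have *: "sform p' q' p q = 2 * pi * pcoeff h n"
    if "weak_sol (dist_of (fmode m)) u p q h" "weak_sol (dist_of (fmode (- n))) u' p' q' h'" for m n u p q h u' p' q' h'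
  proof -
    note hyps = that
    obtain v where T: "trace_approx u p q h v" by (rule weak_sol_approx[OF hyps(1)])
    interpret trace_approx u p q h v by (rule T)
    have sq': "sqd p'" "sqd q'" using hyps(2) by (auto simp: weak_sol_def)
    have "(\<lambda>k. dform (px (v k)) (py (v k)) (\<lambda>z. \<sigma> z * p' z) (\<lambda>z. \<sigma> z * q' z)) \<longlonglongrightarrow> dform p q (\<lambda>z. \<sigma> z * p' z) (\<lambda>z. \<sigma> z * q' z)"
      by (intro dform_tendsto smooth_sqd_grad smooth sq lim sqd_sigma sq')
    moreover have "dform (px (v k)) (py (v k)) (\<lambda>z. \<sigma> z * p' z) (\<lambda>z. \<sigma> z * q' z) = cint (\<lambda>\<theta>. v k (cis \<theta>) * fmode (- n) \<theta>)" for k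
      using hyps(2) smooth_circle_per_test[OF smooth] smooth
      by (simp add: dform_commute[of "px (v k)"] weak_sol_def dist_of_def mult.commute)
    moreover have "(\<lambda>k. cint (\<lambda>\<theta>. v k (cis \<theta>) * fmode (- n) \<theta>)) \<longlonglongrightarrow> cint (\<lambda>\<theta>. h \<theta> * fmode (- n) \<theta>)"
      by (intro cint_mult_tendsto continuous_sqc continuous_on_fmode)
    ultimately have "dform p q (\<lambda>z. \<sigma> z * p' z) (\<lambda>z. \<sigma> z * q' z) = cint (\<lambda>\<theta>. h \<theta> * fmode (- n) \<theta>)"
      using LIMSEQ_unique by auto
    then show ?thesis by (simp add: dform_commute[of p q] pcoeff_def)
  qed
  obtain u p q h where s: "weak_sol (dist_of (fmode m)) u p q h" by (rule weak_sol_exists[OF fmode_in_Hs0[OF assms(1)]])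
  have "- n \<noteq> 0" using assms(2) by simp
  obtain u' p' q' h' where s': "weak_sol (dist_of (fmode (- n))) u' p' q' h'"
    by (rule weak_sol_exists[OF fmode_in_Hs0[OF \<open>- n \<noteq> 0\<close>]])
  have "2 * pi * pcoeff h n = 2 * pi * pcoeff h' (- m)"
    using *[OF s s'] *[of "- n" u' p' q' h' "- m" u p q h] s s' by (simp add: sform_commute[of p q])
  then show ?thesis unfolding weak_sol_fcoeff[OF s] weak_sol_fcoeff[OF s'] by simp
qed

lemma sqd_one_minus_sigma: "sqd p \<Longrightarrow> sqd (\<lambda>z. (1 - \<sigma> z) * p z)"
  using sq_integrable_diff[OF _ sqd_sigma, of p p] by (simp add: left_diff_distrib)

text \<open>Green's formula and the weak equation are both tested with \<open>hmode (- n)\<close>,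
  and the difference of the two forms carries the factor \<open>1 - \<sigma>\<close>. The term with
  \<open>fcoeff f n\<close> does not depend on \<sigma> and cancels in the relative map.\<close>

lemma weak_sol_coeff:
  assumes s: "weak_sol f u p q h"
  shows "2 * pi * of_int \<bar>n\<bar> * pcoeff h n
      = 2 * pi * fcoeff f n + dform p q (\<lambda>z. (1 - \<sigma> z) * px (hmode (- n)) z) (\<lambda>z. (1 - \<sigma> z) * py (hmode (- n)) z)"
proof -
  let ?a = "px (hmode (- n))" and ?b = "py (hmode (- n))"
  obtain v where T: "trace_approx u p q h v" by (rule weak_sol_approx[OF s])
  interpret trace_approx u p q h v by (rule T)
  have "dform p q ?a ?b = dform p q (\<lambda>z. 1 * (\<sigma> z * ?a z) + 1 * ((1 - \<sigma> z) * ?a z)) (\<lambda>z. 1 * (\<sigma> z * ?b z) + 1 * ((1 - \<sigma> z) * ?b z))"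
    by (simp add: algebra_simps)
  also have "\<dots> = 1 * dform p q (\<lambda>z. \<sigma> z * ?a z) (\<lambda>z. \<sigma> z * ?b z)
      + 1 * dform p q (\<lambda>z. (1 - \<sigma> z) * ?a z) (\<lambda>z. (1 - \<sigma> z) * ?b z)"
    by (intro dform_lincomb_right sqd_sigma sqd_one_minus_sigma smooth_sqd_grad smooth_hmode sq)
  also have "dform p q (\<lambda>z. \<sigma> z * ?a z) (\<lambda>z. \<sigma> z * ?b z) = sform p q ?a ?b"
    by (simp add: dform_def mult_ac)
  also have "\<dots> = 2 * pi * fcoeff f n"
    using s by (simp add: weak_sol_def hmode_cis fcoeff_def)
  finally show ?thesis unfolding Green by simp
qed

end

section \<open>Smoothing operators, and the relative map as one of them\<close>

interpretation unit_conductivity: elliptic "\<lambda>_. 1" 1 1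
  by unfold_locales auto

text \<open>The properties of the relative map on which the discretization estimate rests: a Fourier
  matrix decaying exponentially in both indices. The vanishing row 0 keeps outputs in the zero-mean
  spaces.\<close>

locale smoothing =
  fixes \<upsilon> :: "int \<Rightarrow> int \<Rightarrow> complex" and K q :: real
  assumes matrix_decay: "\<And>n m. norm (\<upsilon> n m) \<le> K * q ^ nat \<bar>n\<bar> * q ^ nat \<bar>m\<bar>"
    and matrix_0: "\<And>m. \<upsilon> 0 m = 0"
    and q: "0 < q" "q < 1"
begin

lemma K_nonneg: "0 \<le> K"
  using order_trans[OF norm_ge_zero matrix_decay[of 0 0]] by simp

text \<open>The value off the union of the \<open>Hs0 t\<close> repeats the last clause of
  \<open>relND\<close>, so that the two can be equal as total functions.\<close>

definition op :: "functional \<Rightarrow> functional" where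
  "op f = (if f \<in> (\<Union>t. Hs0 t) then dist_coeffs (\<lambda>n. \<Sum>\<^sub>\<infinity>m. \<upsilon> n m * fcoeff f m) else (\<lambda>_. 0))"

lemma geometric_sob_summable: "(\<lambda>n. sob_weight s n * (q ^ nat \<bar>n\<bar>)\<^sup>2) summable_on UNIV"
proof -
  have "(q ^ nat \<bar>n\<bar>)\<^sup>2 = (q\<^sup>2) ^ nat \<bar>n\<bar>" for n by (simp add: power_mult[symmetric] mult.commute)
  moreover have "0 < q\<^sup>2" "q\<^sup>2 < 1" using q by (auto simp: power_less_one_iff abs_square_less_1)
  ultimately show ?thesis using summable_geometric_wt[of "q\<^sup>2" "2 * s"] by (simp add: sob_weight_wt)
qed

lemma geometric_coeff_summable:
  assumes "f \<in> Hs s"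
  shows "(\<lambda>m. q ^ nat \<bar>m\<bar> * norm (fcoeff f m)) summable_on UNIV"
    and "(\<Sum>\<^sub>\<infinity>m. q ^ nat \<bar>m\<bar> * norm (fcoeff f m)) \<le> sqrt (\<Sum>\<^sub>\<infinity>n. sob_weight (- s) n * (q ^ nat \<bar>n\<bar>)\<^sup>2) * Hs_norm s f"
  using Hs_duality[OF assms geometric_sob_summable] q by auto

lemma op_summable:
  assumes "f \<in> Hs s"
  shows "(\<lambda>m. norm (\<upsilon> n m * fcoeff f m)) summable_on UNIV"
    and "norm (\<Sum>\<^sub>\<infinity>m. \<upsilon> n m * fcoeff f m) \<le> K * q ^ nat \<bar>n\<bar> * (\<Sum>\<^sub>\<infinity>m. q ^ nat \<bar>m\<bar> * norm (fcoeff f m))"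
proof -
  have b: "norm (\<upsilon> n m * fcoeff f m) \<le> K * q ^ nat \<bar>n\<bar> * (q ^ nat \<bar>m\<bar> * norm (fcoeff f m))" for m
    unfolding norm_mult mult.assoc[symmetric] by (intro mult_right_mono matrix_decay) simp
  have c: "(\<lambda>m. K * q ^ nat \<bar>n\<bar> * (q ^ nat \<bar>m\<bar> * norm (fcoeff f m))) summable_on UNIV"
    by (intro summable_on_cmult_right geometric_coeff_summable[OF assms])
  show s: "(\<lambda>m. norm (\<upsilon> n m * fcoeff f m)) summable_on UNIV"
    by (rule summable_on_comparison_test[OF c b]) simp
  have "norm (\<Sum>\<^sub>\<infinity>m. \<upsilon> n m * fcoeff f m) \<le> (\<Sum>\<^sub>\<infinity>m. norm (\<upsilon> n m * fcoeff f m))"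
    by (rule norm_infsum_bound[OF s])
  also have "\<dots> \<le> (\<Sum>\<^sub>\<infinity>m. K * q ^ nat \<bar>n\<bar> * (q ^ nat \<bar>m\<bar> * norm (fcoeff f m)))"
    by (rule infsum_mono[OF s c b])
  also have "\<dots> = K * q ^ nat \<bar>n\<bar> * (\<Sum>\<^sub>\<infinity>m. q ^ nat \<bar>m\<bar> * norm (fcoeff f m))"
    by (rule infsum_cmult_right')
  finally show "norm (\<Sum>\<^sub>\<infinity>m. \<upsilon> n m * fcoeff f m) \<le> K * q ^ nat \<bar>n\<bar> * (\<Sum>\<^sub>\<infinity>m. q ^ nat \<bar>m\<bar> * norm (fcoeff f m))" .
qed

lemma
  assumes "f \<in> Hs0 t"
  shows op_in_pdist: "op f \<in> pdist"
    and fcoeff_op: "fcoeff (op f) n = (\<Sum>\<^sub>\<infinity>m. \<upsilon> n m * fcoeff f m)"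
proof -
  let ?S = "\<Sum>\<^sub>\<infinity>m. q ^ nat \<bar>m\<bar> * norm (fcoeff f m)"
  have S: "0 \<le> ?S" using q by (intro infsum_nonneg) auto
  have b: "norm (\<Sum>\<^sub>\<infinity>m. \<upsilon> n m * fcoeff f m) \<le> (K * ?S) * wt n ^ 0" for n
  proof -
    have "K * q ^ nat \<bar>n\<bar> * ?S \<le> K * 1 * ?S"
      using q S K_nonneg by (intro mult_right_mono mult_left_mono) (auto simp: power_le_one)
    then show ?thesis using op_summable(2)[OF Hs0_Hs[OF assms], of n] by simp
  qed
  have e: "op f = dist_coeffs (\<lambda>n. \<Sum>\<^sub>\<infinity>m. \<upsilon> n m * fcoeff f m)" using assms by (auto simp: op_def)
  show "op f \<in> pdist" "fcoeff (op f) n = (\<Sum>\<^sub>\<infinity>m. \<upsilon> n m * fcoeff f m)"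
    unfolding e by (rule dist_coeffs_in_pdist[OF b], rule fcoeff_dist_coeffs[OF b])
qed

lemma norm_fcoeff_op_le:
  assumes "f \<in> Hs0 t"
  shows "norm (fcoeff (op f) n) \<le> K * q ^ nat \<bar>n\<bar> * (\<Sum>\<^sub>\<infinity>m. q ^ nat \<bar>m\<bar> * norm (fcoeff f m))"
  unfolding fcoeff_op[OF assms] by (rule op_summable[OF Hs0_Hs[OF assms]])

lemma op_lincomb:
  assumes "f \<in> Hs0 t" "g \<in> Hs0 t"
  shows "op (\<lambda>\<phi>. a * f \<phi> + b * g \<phi>) = (\<lambda>\<phi>. a * op f \<phi> + b * op g \<phi>)"
proof (rule pdist_eqI)
  show "op (\<lambda>\<phi>. a * f \<phi> + b * g \<phi>) \<in> pdist" by (rule op_in_pdist[OF Hs0_comb[OF assms]])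
  show "(\<lambda>\<phi>. a * op f \<phi> + b * op g \<phi>) \<in> pdist" by (intro pdist_comb op_in_pdist[OF assms(1)] op_in_pdist[OF assms(2)])
  fix n
  have s: "(\<lambda>m. \<upsilon> n m * fcoeff f m) summable_on UNIV" "(\<lambda>m. \<upsilon> n m * fcoeff g m) summable_on UNIV"
    using op_summable(1)[OF Hs0_Hs[OF assms(1)]] op_summable(1)[OF Hs0_Hs[OF assms(2)]] by (auto intro: abs_summable_summable)
  have "(\<Sum>\<^sub>\<infinity>m. \<upsilon> n m * fcoeff (\<lambda>\<phi>. a * f \<phi> + b * g \<phi>) m)
      = (\<Sum>\<^sub>\<infinity>m. a * (\<upsilon> n m * fcoeff f m) + b * (\<upsilon> n m * fcoeff g m))"
    by (simp add: fcoeff_lincomb algebra_simps)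
  also have "\<dots> = a * (\<Sum>\<^sub>\<infinity>m. \<upsilon> n m * fcoeff f m) + b * (\<Sum>\<^sub>\<infinity>m. \<upsilon> n m * fcoeff g m)"
    by (subst infsum_add) (auto intro!: summable_on_cmult_right s simp: infsum_cmult_right')
  finally show "fcoeff (op (\<lambda>\<phi>. a * f \<phi> + b * g \<phi>)) n = fcoeff (\<lambda>\<phi>. a * op f \<phi> + b * op g \<phi>) n"
    unfolding fcoeff_op[OF Hs0_comb[OF assms]] fcoeff_lincomb fcoeff_op[OF assms(1)] fcoeff_op[OF assms(2)] .
qed

text \<open>The factor \<open>q ^ nat \<bar>m\<bar>\<close> absorbs input of any order by
  \<open>Hs_duality\<close>, and \<open>q ^ nat \<bar>n\<bar>\<close> gives output of any order by
  \<open>Hs_from_decay\<close>.\<close>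

lemma op_in_bops: "op \<in> bops t r"
proof -
  define S where "S = sqrt (\<Sum>\<^sub>\<infinity>n. sob_weight (- t) n * (q ^ nat \<bar>n\<bar>)\<^sup>2)"
  define R where "R = sqrt (2 * pi * (\<Sum>\<^sub>\<infinity>n. sob_weight r n * (q ^ nat \<bar>n\<bar>)\<^sup>2))"
  have S: "0 \<le> S" by (auto simp: S_def intro: infsum_nonneg)
  have "op f \<in> Hs0 r \<and> Hs_norm r (op f) \<le> (R * (K * S)) * Hs_norm t f" if f: "f \<in> Hs0 t" for f
  proof -
    have b: "norm (fcoeff (op f) n) \<le> (K * S * Hs_norm t f) * q ^ nat \<bar>n\<bar>" for n
    proof -
      have "norm (fcoeff (op f) n) \<le> K * q ^ nat \<bar>n\<bar> * (\<Sum>\<^sub>\<infinity>m. q ^ nat \<bar>m\<bar> * norm (fcoeff f m))"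
        by (rule norm_fcoeff_op_le[OF f])
      also have "\<dots> \<le> K * q ^ nat \<bar>n\<bar> * (S * Hs_norm t f)"
        unfolding S_def using K_nonneg q by (intro mult_left_mono geometric_coeff_summable Hs0_Hs f) auto
      finally show ?thesis by (simp add: mult_ac)
    qed
    have "0 \<le> K * S * Hs_norm t f" "\<And>n. 0 \<le> q ^ nat \<bar>n\<bar>" using K_nonneg S q by auto
    from Hs_from_decay[OF op_in_pdist[OF f] b geometric_sob_summable this]
    have "op f \<in> Hs r" "Hs_norm r (op f) \<le> R * (K * S * Hs_norm t f)"
      by (simp_all add: R_def)
    moreover have "fcoeff (op f) 0 = 0" unfolding fcoeff_op[OF f] by (simp add: matrix_0)
    ultimately show ?thesis by (simp add: Hs0_def mult_ac)
  qed
  then show ?thesis unfolding bops_def mem_Collect_eq using op_lincomb by blast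
qed

end

text \<open>By \<open>bounded_functional_expansion\<close> each output coefficient is determined by
  the images of the modes. This is the uniqueness behind \<open>relND\<close>: two bounded
  extensions agree on every \<open>Hs0 t\<close>.\<close>

lemma bops_determined_by_fmode:
  assumes U: "U \<in> bops t 0" and V: "V \<in> bops t 0"
    and e: "\<And>m. m \<noteq> 0 \<Longrightarrow> U (dist_of (fmode m)) = V (dist_of (fmode m))" and f: "f \<in> Hs0 t"
  shows "U f = V f"
proof (rule pdist_eqI)
  have D: "W g \<in> Hs0 0" if "W \<in> bops t 0" "g \<in> Hs0 t" for W g using that by (simp add: bops_def)
  show "U f \<in> pdist" "V f \<in> pdist" using D[OF U f] D[OF V f] by (auto intro: Hs0_pdist)
  fix n
  have ex: "((\<lambda>m. fcoeff f m * fcoeff (W (dist_of (fmode m))) n) has_sum fcoeff (W f) n) UNIV" if W: "W \<in> bops t 0" for W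
  proof -
    obtain C where C: "\<And>g. g \<in> Hs0 t \<Longrightarrow> Hs_norm 0 (W g) \<le> C * Hs_norm t g" using W unfolding bops_def by blast
    show ?thesis
    proof (rule bounded_functional_expansion[OF _ _ f])
      fix g h a b assume "g \<in> Hs0 t" "h \<in> Hs0 t"
      then have "W (\<lambda>\<phi>. a * g \<phi> + b * h \<phi>) = (\<lambda>\<phi>. a * W g \<phi> + b * W h \<phi>)" using W unfolding bops_def by blast
      then show "fcoeff (W (\<lambda>\<phi>. a * g \<phi> + b * h \<phi>)) n = a * fcoeff (W g) n + b * fcoeff (W h) n"
        by (simp add: fcoeff_lincomb)
    next
      fix g assume g: "g \<in> Hs0 t"
      show "norm (fcoeff (W g) n) \<le> C * Hs_norm t g"
        using norm_fcoeff_le[OF Hs0_Hs[OF D[OF W g]], of n] C[OF g] by simp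
    qed
  qed
  have "fcoeff f m * fcoeff (U (dist_of (fmode m))) n = fcoeff f m * fcoeff (V (dist_of (fmode m))) n" for m
    using e[of m] Hs0_fcoeff[OF f] by (cases "m = 0") auto
  with ex[OF U] have "((\<lambda>m. fcoeff f m * fcoeff (V (dist_of (fmode m))) n) has_sum fcoeff (U f) n) UNIV" by (simp only:)
  then show "fcoeff (U f) n = fcoeff (V f) n" using ex[OF V] by (rule has_sum_unique)
qed

locale inclusion = elliptic +
  fixes \<rho> :: real
  assumes \<rho>: "0 < \<rho>" "\<rho> < 1"
    and sigma_1: "AE z in DD. \<rho> < norm z \<longrightarrow> \<sigma> z = 1"
begin

definition relative :: "functional \<Rightarrow> functional" where
  "relative f = (\<lambda>\<phi>. ND \<sigma> f \<phi> - ND (\<lambda>_. 1) f \<phi>)"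

lemma relative_in_pdist: "f \<in> Hs0 (-1/2) \<Longrightarrow> relative f \<in> pdist"
  using pdist_comb[OF ND_in_pdist unit_conductivity.ND_in_pdist, of f f 1 "- 1"] by (simp add: relative_def)

lemma fcoeff_relative: "fcoeff (relative f) n = fcoeff (ND \<sigma> f) n - fcoeff (ND (\<lambda>_. 1) f) n"
  by (simp add: relative_def fcoeff_def diff_divide_distrib)

text \<open>Almost everywhere that \<open>1 - \<sigma>\<close> does not vanish,
  \<open>norm z\<close> is at most \<rho>. The factor 2 counts the two components,
  \<open>1 / \<rho>\<close> raises the exponent from |n| - 1 to |n|, and |n| is kept apart to cancel
  against the one in Green's formula.\<close>

lemma dnorm_hmode_inclusion:
  "dnorm (\<lambda>z. (1 - \<sigma> z) * px (hmode n) z) (\<lambda>z. (1 - \<sigma> z) * py (hmode n) z)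
    \<le> of_int \<bar>n\<bar> * (2 * (1 + \<bar>B\<bar>) * l2norm DD (\<lambda>_. 1) / \<rho> * \<rho> ^ nat \<bar>n\<bar>)"
proof (cases "n = 0")
  case True
  then have "px (hmode n) = (\<lambda>_. 0)" "py (hmode n) = (\<lambda>_. 0)"
    using norm_grad_hmode[of n] by (auto simp: fun_eq_iff)
  then show ?thesis using True by (simp add: dnorm_def l2norm_def)
next
  case False
  define b where "b = (1 + \<bar>B\<bar>) * (of_int \<bar>n\<bar> * \<rho> ^ (nat \<bar>n\<bar> - 1))"
  have b0: "0 \<le> b" using \<rho> by (simp add: b_def)
  have bound: "AE z in DD. norm ((1 - \<sigma> z) * g z) \<le> b"
    if g: "\<And>z. norm (g z) = of_int \<bar>n\<bar> * norm z ^ (nat \<bar>n\<bar> - 1)" for g :: "complex \<Rightarrow> complex"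
    using sigma_1 sigma_bounded
  proof eventually_elim
    case (elim z)
    show ?case
    proof (cases "\<rho> < norm z")
      case False
      have "norm (1 - \<sigma> z) \<le> 1 + \<bar>B\<bar>" using norm_triangle_ineq4[of 1 "\<sigma> z"] elim(2) by simp
      then show ?thesis unfolding norm_mult b_def g
        using False by (intro mult_mono mult_left_mono power_mono) auto
    qed (use elim b0 in simp)
  qed
  have meas: "(\<lambda>z. (1 - \<sigma> z) * g z) \<in> borel_measurable DD" if "smooth_plane g" for g
    using sigma_measurable continuous_measurable_disk[OF smooth_plane_continuous[OF that]] by simp
  have l: "l2norm DD (\<lambda>z. (1 - \<sigma> z) * g z) \<le> b * l2norm DD (\<lambda>_. 1)"
    if "smooth_plane g" "\<And>z. norm (g z) = of_int \<bar>n\<bar> * norm z ^ (nat \<bar>n\<bar> - 1)" for g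
    using l2norm_bounded_mult[OF sq_integrable_const[OF finite_measure_disk, of 1] meas[OF that(1)] bound[OF that(2)] b0] by simp
  have "dnorm (\<lambda>z. (1 - \<sigma> z) * px (hmode n) z) (\<lambda>z. (1 - \<sigma> z) * py (hmode n) z)
      \<le> l2norm DD (\<lambda>z. (1 - \<sigma> z) * px (hmode n) z) + l2norm DD (\<lambda>z. (1 - \<sigma> z) * py (hmode n) z)"
    unfolding dnorm_def by (rule sqrt_sum_squares_le_sum) auto
  also have "\<dots> \<le> b * l2norm DD (\<lambda>_. 1) + b * l2norm DD (\<lambda>_. 1)"
    by (intro add_mono l smooth_plane_px smooth_plane_py smooth_hmode norm_grad_hmode)
  also have "\<dots> = of_int \<bar>n\<bar> * (2 * (1 + \<bar>B\<bar>) * l2norm DD (\<lambda>_. 1) / \<rho> * \<rho> ^ nat \<bar>n\<bar>)"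
  proof -
    have "nat \<bar>n\<bar> = Suc (nat \<bar>n\<bar> - 1)" using False by simp
    then have "\<rho> ^ nat \<bar>n\<bar> = \<rho> * \<rho> ^ (nat \<bar>n\<bar> - 1)" by (metis power_Suc)
    then show ?thesis using \<rho> by (simp add: b_def field_simps)
  qed
  finally show ?thesis .
qed

text \<open>The constant of \<open>dnorm_hmode_inclusion\<close> divided by the ellipticity constant
  of \<open>weak_sol_energy\<close>.\<close>

definition relative_const :: real where
  "relative_const = 2 * (1 + \<bar>B\<bar>) * l2norm DD (\<lambda>_. 1) / \<rho> / lo"

lemma relative_const_nonneg: "0 \<le> relative_const"
  using \<rho> lo_pos by (simp add: relative_const_def)

text \<open>Subtracting \<open>weak_sol_coeff\<close> for the two conductivities leaves the integral
  with \<open>1 - \<sigma>\<close>, bounded by the energy of the solution times the small gradient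
  on the inclusion; the factors |n| cancel.\<close>

lemma norm_fcoeff_relative_le:
  assumes f: "f \<in> Hs0 (-1/2)"
  shows "norm (fcoeff (relative f) n) \<le> relative_const * \<rho> ^ nat \<bar>n\<bar> * Hs_norm (-1/2) f"
proof (cases "n = 0")
  case True
  then show ?thesis
    using ND_fcoeff_0[OF f] unit_conductivity.ND_fcoeff_0[OF f] relative_const_nonneg by (simp add: fcoeff_relative)
next
  case False
  obtain u p q h where s: "weak_sol f u p q h" by (rule weak_sol_exists[OF f])
  obtain u' p' q' h' where s': "unit_conductivity.weak_sol f u' p' q' h'" by (rule unit_conductivity.weak_sol_exists[OF f])
  define E where "E = dform p q (\<lambda>z. (1 - \<sigma> z) * px (hmode (- n)) z) (\<lambda>z. (1 - \<sigma> z) * py (hmode (- n)) z)"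
  have "2 * pi * of_int \<bar>n\<bar> * pcoeff h' n = 2 * pi * fcoeff f n"
    using unit_conductivity.weak_sol_coeff[OF s', of n] by (simp add: dform_def)
  then have "2 * pi * of_int \<bar>n\<bar> * fcoeff (relative f) n = E"
    using weak_sol_coeff[OF s, of n]
    by (simp add: fcoeff_relative weak_sol_fcoeff[OF s] unit_conductivity.weak_sol_fcoeff[OF s'] E_def right_diff_distrib)
  then have "2 * pi * of_int \<bar>n\<bar> * norm (fcoeff (relative f) n) = norm E"
    by (auto simp: norm_mult)
  also have "norm E \<le> dnorm p q * dnorm (\<lambda>z. (1 - \<sigma> z) * px (hmode (- n)) z) (\<lambda>z. (1 - \<sigma> z) * py (hmode (- n)) z)"
    unfolding E_def using s
    by (intro dform_Cauchy_Schwarz sqd_one_minus_sigma smooth_sqd_grad smooth_hmode) (auto simp: weak_sol_def)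
  also have "\<dots> \<le> (Hs_norm (-1/2) f / lo) * (of_int \<bar>- n\<bar> * (2 * (1 + \<bar>B\<bar>) * l2norm DD (\<lambda>_. 1) / \<rho> * \<rho> ^ nat \<bar>- n\<bar>))"
    using weak_sol_energy[OF s f] lo_pos
    by (intro mult_mono dnorm_hmode_inclusion) (auto simp: field_simps)
  also have "\<dots> = of_int \<bar>n\<bar> * (relative_const * \<rho> ^ nat \<bar>n\<bar> * Hs_norm (-1/2) f)"
    by (simp add: relative_const_def mult_ac)
  finally have "of_int \<bar>n\<bar> * (2 * pi * norm (fcoeff (relative f) n)) \<le> of_int \<bar>n\<bar> * (relative_const * \<rho> ^ nat \<bar>n\<bar> * Hs_norm (-1/2) f)"
    by (simp add: mult_ac)
  then have "2 * pi * norm (fcoeff (relative f) n) \<le> relative_const * \<rho> ^ nat \<bar>n\<bar> * Hs_norm (-1/2) f"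
    using False by (subst (asm) mult_le_cancel_left_pos) auto
  moreover have "norm (fcoeff (relative f) n) \<le> 2 * pi * norm (fcoeff (relative f) n)"
    using mult_right_mono[of 1 "2 * pi" "norm (fcoeff (relative f) n)"] pi_ge_two by simp
  ultimately show ?thesis by simp
qed

text \<open>Column 0 is set to 0 because a nonzero constant is not admissible Neumann data; the 0 in
  row 0 agrees with traces having mean zero.\<close>

definition \<upsilon> :: "int \<Rightarrow> int \<Rightarrow> complex" where
  "\<upsilon> n m = (if n = 0 \<or> m = 0 then 0 else fcoeff (relative (dist_of (fmode m))) n)"

text \<open>The constant 3 is a crude bound for the square root of \<open>2 * pi\<close>; what
  matters is that it does not depend on \<open>m\<close>.\<close>

lemma Hs_norm_fmode_le: "Hs_norm (-1/2) (dist_of (fmode m)) \<le> 3"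
proof -
  have "(\<Sum>\<^sub>\<infinity>n. sob_weight (-1/2) n * (norm (fcoeff (dist_of (fmode m)) n))\<^sup>2) = sob_weight (-1/2) m"
    by (rule infsumI, rule has_sum_finite_neutralI[of "{m}"]) (auto simp: fcoeff_fmode)
  also have "\<dots> \<le> 1"
    using powr_mono[of "- 1" 0 "wt m"] by (simp add: sob_weight_wt)
  finally have "2 * pi * (\<Sum>\<^sub>\<infinity>n. sob_weight (-1/2) n * (norm (fcoeff (dist_of (fmode m)) n))\<^sup>2) \<le> 2 * pi * 1"
    by (rule mult_left_mono) simp
  also have "\<dots> \<le> 3\<^sup>2" using pi_less_4 by simp
  finally have "2 * pi * (\<Sum>\<^sub>\<infinity>n. sob_weight (-1/2) n * (norm (fcoeff (dist_of (fmode m)) n))\<^sup>2) \<le> 3\<^sup>2" .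
  then show ?thesis unfolding Hs_norm_def by (rule real_le_lsqrt[rotated]) simp
qed

lemma \<upsilon>_decay_row: "norm (\<upsilon> n m) \<le> 3 * relative_const * \<rho> ^ nat \<bar>n\<bar>"
proof (cases "n = 0 \<or> m = 0")
  case False
  then have "norm (\<upsilon> n m) \<le> relative_const * \<rho> ^ nat \<bar>n\<bar> * Hs_norm (-1/2) (dist_of (fmode m))"
    using norm_fcoeff_relative_le[OF fmode_in_Hs0] by (simp add: \<upsilon>_def)
  also have "\<dots> \<le> relative_const * \<rho> ^ nat \<bar>n\<bar> * 3"
    using relative_const_nonneg \<rho> by (intro mult_left_mono Hs_norm_fmode_le) auto
  finally show ?thesis by simp
qed (use relative_const_nonneg \<rho> in \<open>auto simp: \<upsilon>_def\<close>)

lemma \<upsilon>_symmetric: "\<upsilon> n m = \<upsilon> (- m) (- n)"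
  using ND_symmetric[of m n] unit_conductivity.ND_symmetric[of m n] by (simp add: \<upsilon>_def fcoeff_relative)

text \<open>The estimate by \<open>\<rho>\<^sup>\<bar>\<^sup>n\<^sup>\<bar>\<close> alone transposes to one by \<open>\<rho>\<^sup>\<bar>\<^sup>m\<^sup>\<bar>\<close> by symmetry; the geometric mean of the two decays in both
  indices.\<close>

sublocale smoothing \<upsilon> "3 * relative_const" "sqrt \<rho>"
proof
  fix n m
  define c where "c = 3 * relative_const"
  have c: "0 \<le> c" using relative_const_nonneg by (simp add: c_def)
  have "norm (\<upsilon> n m) * norm (\<upsilon> n m) \<le> (c * \<rho> ^ nat \<bar>n\<bar>) * (c * \<rho> ^ nat \<bar>m\<bar>)"
    using \<upsilon>_decay_row[of n m] \<upsilon>_decay_row[of "- m" "- n"] c \<rho>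
    unfolding \<upsilon>_symmetric[of n m, symmetric] c_def by (intro mult_mono) auto
  also have "\<dots> = (c * sqrt \<rho> ^ nat \<bar>n\<bar> * sqrt \<rho> ^ nat \<bar>m\<bar>)\<^sup>2"
  proof -
    have "(sqrt \<rho> ^ k)\<^sup>2 = \<rho> ^ k" for k
      using \<rho> by (simp add: power_mult[symmetric] mult.commute[of k] power_mult)
    then show ?thesis by (simp add: power_mult_distrib power2_eq_square mult_ac)
  qed
  finally show "norm (\<upsilon> n m) \<le> 3 * relative_const * sqrt \<rho> ^ nat \<bar>n\<bar> * sqrt \<rho> ^ nat \<bar>m\<bar>"
    unfolding c_def[symmetric] power2_eq_square[of "norm (\<upsilon> n m)", symmetric]
    by (rule power2_le_imp_le) (use c \<rho> in auto)
qed (use \<rho> in \<open>auto simp: \<upsilon>_def\<close>)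

text \<open>The coefficients of \<open>relative f\<close> are bounded functionals of
  \<open>f\<close> and so expand over the modes, which gives the matrix series that defines
  \<open>op\<close>.\<close>

lemma op_eq_relative:
  assumes f: "f \<in> Hs0 (-1/2)"
  shows "op f = relative f"
proof (rule pdist_eqI)
  show "op f \<in> pdist" "relative f \<in> pdist" by (rule op_in_pdist[OF f], rule relative_in_pdist[OF f])
  fix n
  have "((\<lambda>m. fcoeff f m * fcoeff (relative (dist_of (fmode m))) n) has_sum fcoeff (relative f) n) UNIV"
  proof (rule bounded_functional_expansion[OF _ _ f])
    show "fcoeff (relative (\<lambda>\<phi>. a * g \<phi> + b * h \<phi>)) n = a * fcoeff (relative g) n + b * fcoeff (relative h) n"
      if "g \<in> Hs0 (-1/2)" "h \<in> Hs0 (-1/2)" for g h a b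
      using that by (simp add: fcoeff_relative ND_lincomb unit_conductivity.ND_lincomb algebra_simps)
    show "norm (fcoeff (relative g) n) \<le> (relative_const * \<rho> ^ nat \<bar>n\<bar>) * Hs_norm (-1/2) g" if "g \<in> Hs0 (-1/2)" for g
      by (rule norm_fcoeff_relative_le[OF that])
  qed
  moreover have "fcoeff f m * fcoeff (relative (dist_of (fmode m))) n = \<upsilon> n m * fcoeff f m" for m
    using Hs0_fcoeff[OF f] ND_fcoeff_0[OF fmode_in_Hs0] unit_conductivity.ND_fcoeff_0[OF fmode_in_Hs0]
    by (cases "m = 0") (auto simp: \<upsilon>_def fcoeff_relative)
  ultimately have "((\<lambda>m. \<upsilon> n m * fcoeff f m) has_sum fcoeff (relative f) n) UNIV" by simp
  then show "fcoeff (op f) n = fcoeff (relative f) n" unfolding fcoeff_op[OF f] by (rule infsumI)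
qed

text \<open>Existence is \<open>op\<close> itself; uniqueness holds because the competitors agree on
  the modes, which lie in \<open>Hs0 (-1/2)\<close>.\<close>

lemma relND_eq_op: "relND \<sigma> = op"
  unfolding relND_def
proof (rule the_equality)
  show "(\<forall>f\<in>Hs0 (-1/2). op f = (\<lambda>\<phi>. ND \<sigma> f \<phi> - ND (\<lambda>_. 1) f \<phi>)) \<and> (\<forall>t r. op \<in> bops t r) \<and>
      (\<forall>f. f \<notin> (\<Union>t. Hs0 t) \<longrightarrow> op f = (\<lambda>_. 0))"
    using op_eq_relative op_in_bops by (simp add: relative_def op_def)
  fix U assume U: "(\<forall>f\<in>Hs0 (-1/2). U f = (\<lambda>\<phi>. ND \<sigma> f \<phi> - ND (\<lambda>_. 1) f \<phi>)) \<and> (\<forall>t r. U \<in> bops t r) \<and>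
      (\<forall>f. f \<notin> (\<Union>t. Hs0 t) \<longrightarrow> U f = (\<lambda>_. 0))"
  show "U = op"
  proof
    fix f
    show "U f = op f"
    proof (cases "f \<in> (\<Union>t. Hs0 t)")
      case True
      then obtain t where f: "f \<in> Hs0 t" by blast
      show ?thesis
      proof (rule bops_determined_by_fmode[OF _ op_in_bops _ f])
        show "U \<in> bops t 0" using U by blast
        fix m :: int assume "m \<noteq> 0"
        then show "U (dist_of (fmode m)) = op (dist_of (fmode m))"
          using U op_eq_relative[OF fmode_in_Hs0] fmode_in_Hs0[of m "-1/2"] by (simp add: relative_def)
      qed
    next
      case False
      then show ?thesis using U by (simp add: op_def)
    qed
  qed
qed

end

section \<open>Discretization\<close>

lemma has_sum_finite_sum:
  fixes f :: "'i \<Rightarrow> 'a \<Rightarrow> complex"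
  assumes "finite A" "\<And>i. i \<in> A \<Longrightarrow> (f i has_sum s i) B"
  shows "((\<lambda>x. \<Sum>i\<in>A. f i x) has_sum (\<Sum>i\<in>A. s i)) B"
  using assms by (induction A) (auto intro!: has_sum_add)

lemma complex_abs_summable_subset:
  fixes c :: "'a \<Rightarrow> complex"
  assumes "(\<lambda>n. norm (c n)) summable_on UNIV"
  shows "c summable_on A" "(\<lambda>n. norm (c n)) summable_on A"
proof -
  show "(\<lambda>n. norm (c n)) summable_on A" using assms by (rule summable_on_subset) simp
  then show "c summable_on A" by (rule abs_summable_summable)
qed

lemma norm_infsum_subset_le:
  fixes c :: "'a \<Rightarrow> complex"
  assumes "(\<lambda>n. norm (c n)) summable_on UNIV"
  shows "norm (infsum c A) \<le> (\<Sum>\<^sub>\<infinity>n. norm (c n))"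
proof -
  have "norm (infsum c A) \<le> (\<Sum>\<^sub>\<infinity>n\<in>A. norm (c n))"
    by (rule norm_infsum_bound[OF complex_abs_summable_subset(2)[OF assms]])
  also have "\<dots> \<le> (\<Sum>\<^sub>\<infinity>n. norm (c n))"
    by (rule infsum_mono2[OF complex_abs_summable_subset(2)[OF assms] assms]) auto
  finally show ?thesis .
qed

lemma cont_rep_eq_fseries:
  assumes g: "g \<in> pdist" and c: "(\<lambda>n. norm (fcoeff g n)) summable_on UNIV"
  shows "cont_rep g = fseries (fcoeff g)"
  unfolding cont_rep_def
proof (rule the_equality)
  let ?h = "fseries (fcoeff g)"
  have "dist_of ?h = g"
  proof (rule pdist_eqI[OF _ g])
    show "dist_of ?h \<in> pdist" by (intro dist_of_in_pdist cint_integrable continuous_on_fseries c)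
    show "fcoeff (dist_of ?h) n = fcoeff g n" for n by (simp add: fcoeff_dist_of pcoeff_fseries[OF c])
  qed
  then show "continuous_on UNIV ?h \<and> (\<forall>\<theta>. ?h (\<theta> + 2 * pi) = ?h \<theta>) \<and> dist_of ?h = g"
    using continuous_on_fseries[OF c] fseries_periodic[OF c] by simp
  fix h assume h: "continuous_on UNIV h \<and> (\<forall>\<theta>. h (\<theta> + 2 * pi) = h \<theta>) \<and> dist_of h = g"
  have "fseries (fcoeff g) = h"
    by (rule fourier_series_eq) (use h c in \<open>auto simp: fcoeff_dist_of pcoeff_def\<close>)
  then show "h = ?h" by simp
qed

section \<open>Aliasing of Fourier coefficients on the equidistant grid\<close>

definition period :: "nat \<Rightarrow> int" where
  "period M = 2 * int M + 1"

lemma period_pos: "0 < period M"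
  by (simp add: period_def)

lemma period_nonzero: "complex_of_int (period M) \<noteq> 0"
  using period_pos[of M] by simp

lemma period_real: "real_of_int (period M) = 2 * real M + 1" "complex_of_int (period M) = 2 * of_nat M + 1"
  by (simp_all add: period_def)

text \<open>Discrete orthogonality. Shifting the node index by one multiplies the sum by the root of
  unity \<omega> and, by periodicity of the terms, only permutes them; so the sum is 0 unless
  \<open>\<omega> = 1\<close>.\<close>

lemma node_sum: "(\<Sum>m\<in>{- int M..int M}. fmode k (node M m)) = (if period M dvd k then of_int (period M) else 0)"
proof (cases "period M dvd k")
  case True
  then obtain j where j: "k = period M * j" by auto
  have "fmode k (node M m) = 1" for m
  proof -
    have "real_of_int k * node M m = 2 * pi * of_int (j * m)"
      unfolding j node_def period_real(1)[symmetric] using period_nonzero[of M] by simp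
    then show ?thesis unfolding fmode_eq_cis by (simp only: cis_multiple_2pi[OF Ints_of_int])
  qed
  then show ?thesis using True by (simp add: period_def)
next
  case False
  define \<omega> where "\<omega> = cis (2 * pi * of_int k / of_int (period M))"
  define e where "e m = fmode k (node M m)" for m
  have e_cis: "e m = cis (of_int m * (2 * pi * of_int k / of_int (period M)))" for m
    unfolding e_def fmode_eq_cis node_def period_real(1)[symmetric] by (simp add: mult_ac)
  have step: "\<omega> * e m = e (m + 1)" for m
    unfolding e_cis \<omega>_def cis_mult by (simp add: algebra_simps add_divide_distrib)
  have "e (int M + 1) = e (- int M)"
  proof -
    have eq: "of_int (int M + 1) * (2 * pi * of_int k / of_int (period M))
        = of_int (- int M) * (2 * pi * of_int k / of_int (period M)) + 2 * pi * of_int k"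
      using period_nonzero[of M] by (simp add: period_def field_simps)
    show ?thesis
      unfolding e_cis eq cis_mult[symmetric] using cis_multiple_2pi[of "of_int k"] by simp
  qed
  then have "(\<Sum>m\<in>{- int M..int M}. e (m + 1)) = (\<Sum>m\<in>{- int M..int M}. e m)"
  proof -
    have "(\<Sum>m\<in>{- int M..int M}. e (m + 1)) = (\<Sum>m\<in>{- int M + 1..int M + 1}. e m)"
      by (rule sum.reindex_bij_witness[of _ "\<lambda>m. m - 1" "\<lambda>m. m + 1"]) auto
    also have "{- int M + 1..int M + 1} = insert (int M + 1) ({- int M..int M} - {- int M})" by auto
    also have "(\<Sum>m\<in>\<dots>. e m) = e (int M + 1) + (\<Sum>m\<in>{- int M..int M} - {- int M}. e m)"
      by (subst sum.insert) auto
    also have "\<dots> = (\<Sum>m\<in>{- int M..int M}. e m)"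
      unfolding \<open>e (int M + 1) = e (- int M)\<close> by (rule sum.remove[symmetric]) auto
    finally show ?thesis .
  qed
  then have "\<omega> * (\<Sum>m\<in>{- int M..int M}. e m) = (\<Sum>m\<in>{- int M..int M}. e m)"
    unfolding sum_distrib_left step .
  then have "(\<omega> - 1) * (\<Sum>m\<in>{- int M..int M}. e m) = 0"
    unfolding left_diff_distrib by simp
  moreover have "\<omega> \<noteq> 1"
  proof
    assume "\<omega> = 1"
    then have "exp (\<i> * of_real (2 * pi * of_int k / of_int (period M))) = 1" by (simp add: \<omega>_def cis_conv_exp)
    then obtain j :: int where "2 * pi * of_int k / of_int (period M) = of_int (2 * j) * pi"
      unfolding exp_eq_1 by auto
    then have "real_of_int k = of_int (period M * j)" using period_nonzero[of M] by (simp add: field_simps)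
    then have "k = period M * j" by (simp only: of_int_eq_iff)
    then show False using False by simp
  qed
  ultimately show ?thesis using False by (simp add: e_def)
qed

text \<open>Sampling cannot tell apart frequencies that are congruent modulo
  \<open>period M\<close>; this is the coefficient seen on the grid.\<close>

definition aliased :: "nat \<Rightarrow> (int \<Rightarrow> complex) \<Rightarrow> int \<Rightarrow> complex" where
  "aliased M c n = infsum c {k. period M dvd k - n}"

lemma sampled_fseries:
  assumes c: "(\<lambda>n. norm (c n)) summable_on UNIV"
  shows "(\<Sum>m\<in>{- int M..int M}. fseries c (node M m) * fmode (- n) (node M m)) = of_int (period M) * aliased M c n"
proof -
  have "((\<lambda>k. \<Sum>m\<in>{- int M..int M}. c k * fmode k (node M m) * fmode (- n) (node M m)) has_sum
      (\<Sum>m\<in>{- int M..int M}. fseries c (node M m) * fmode (- n) (node M m))) UNIV"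
    by (intro has_sum_finite_sum has_sum_cmult_left fseries_has_sum c) auto
  moreover have "(\<Sum>m\<in>{- int M..int M}. c k * fmode k (node M m) * fmode (- n) (node M m))
      = (if period M dvd k - n then of_int (period M) * c k else 0)" for k
    using node_sum[where M = M and k = "k - n"] by (simp add: mult.assoc fmode_mult flip: sum_distrib_left)
  ultimately have h1: "((\<lambda>k. if period M dvd k - n then of_int (period M) * c k else 0) has_sum
      (\<Sum>m\<in>{- int M..int M}. fseries c (node M m) * fmode (- n) (node M m))) UNIV" by simp
  have h2: "((\<lambda>k. if period M dvd k - n then of_int (period M) * c k else 0) has_sum of_int (period M) * aliased M c n) UNIV
      \<longleftrightarrow> ((\<lambda>k. of_int (period M) * c k) has_sum of_int (period M) * aliased M c n) {k. period M dvd k - n}"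
    by (rule has_sum_cong_neutral) auto
  have h3: "((\<lambda>k. of_int (period M) * c k) has_sum of_int (period M) * aliased M c n) {k. period M dvd k - n}"
    unfolding aliased_def by (rule has_sum_cmult_right[OF has_sum_infsum[OF complex_abs_summable_subset(1)[OF c]]])
  show ?thesis by (rule has_sum_unique[OF h1 h2[THEN iffD2, OF h3]])
qed

lemma norm_aliased_le:
  "(\<lambda>n. norm (c n)) summable_on UNIV \<Longrightarrow> norm (aliased M c n) \<le> (\<Sum>\<^sub>\<infinity>n. norm (c n))"
  unfolding aliased_def by (rule norm_infsum_subset_le)

lemma aliased_lincomb:
  assumes "(\<lambda>n. norm (c n)) summable_on UNIV" "(\<lambda>n. norm (d n)) summable_on UNIV"
  shows "aliased M (\<lambda>k. a * c k + b * d k) n = a * aliased M c n + b * aliased M d n"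
proof -
  have "(\<lambda>k. a * c k) summable_on {k. period M dvd k - n}" "(\<lambda>k. b * d k) summable_on {k. period M dvd k - n}"
    by (intro summable_on_cmult_right complex_abs_summable_subset(1) assms)+
  from infsum_add[OF this] show ?thesis by (simp add: aliased_def infsum_cmult_right')
qed

lemma aliased_periodic:
  assumes "period M dvd n - n'"
  shows "aliased M c n = aliased M c n'"
proof -
  have "period M dvd k - n \<longleftrightarrow> period M dvd k - n'" for k
    using dvd_add_right_iff[OF assms, of "k - n"] by simp
  then show ?thesis by (simp add: aliased_def)
qed

lemma aliased_remainder:
  assumes c: "(\<lambda>n. norm (c n)) summable_on UNIV"
  shows "norm (aliased M c n - c n) \<le> (\<Sum>\<^sub>\<infinity>k\<in>{k. period M dvd k - n} - {n}. norm (c k))"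
proof -
  have "insert n ({k. period M dvd k - n} - {n}) = {k. period M dvd k - n}" by auto
  then have "aliased M c n = c n + infsum c ({k. period M dvd k - n} - {n})"
    using infsum_insert[OF complex_abs_summable_subset(1)[OF c], of n "{k. period M dvd k - n} - {n}"]
    by (simp add: aliased_def)
  then show ?thesis using norm_infsum_bound[OF complex_abs_summable_subset(2)[OF c]] by simp
qed

text \<open>A comb of Dirac deltas at the nodes has as coefficients the discrete Fourier transform
  of its weights, which is periodic in \<open>n\<close> and has no decay.\<close>

lemma
  assumes g: "g \<in> pdist" and c: "(\<lambda>n. norm (fcoeff g n)) summable_on UNIV"
  shows FM_in_pdist: "FM M g \<in> pdist"
    and fcoeff_FM: "fcoeff (FM M g) n = aliased M (fcoeff g) n"
proof -
  have e: "FM M g = (\<lambda>\<phi>. \<Sum>m\<in>{- int M..int M}. (of_real (2 * pi / (2 * real M + 1)) * fseries (fcoeff g) (node M m)) * dirac (node M m) \<phi>)"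
    unfolding FM_def cont_rep_eq_fseries[OF g c] sum_distrib_left by (simp add: mult.assoc)
  show "FM M g \<in> pdist" unfolding e by (intro pdist_finite_sum dirac_in_pdist) auto
  have "fcoeff (FM M g) n = (\<Sum>m\<in>{- int M..int M}. (1 / of_int (period M)) * (fseries (fcoeff g) (node M m) * fmode (- n) (node M m)))"
    unfolding e fcoeff_finite_sum fcoeff_dirac by (intro sum.cong refl) (simp add: period_real)
  also have "\<dots> = aliased M (fcoeff g) n"
    unfolding sum_distrib_left[symmetric] sampled_fseries[OF c] using period_nonzero[of M] by simp
  finally show "fcoeff (FM M g) n = aliased M (fcoeff g) n" .
qed

lemma
  assumes g: "g \<in> pdist" and c: "(\<lambda>n. norm (fcoeff g n)) summable_on UNIV"
  shows GM_in_pdist: "GM M g \<in> pdist"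
    and fcoeff_GM: "fcoeff (GM M g) n = (if n = 0 then fcoeff g 0 - aliased M (fcoeff g) 0 else fcoeff g n)"
proof -
  have "1 / (2 * of_nat M + 1) * (\<Sum>m\<in>{- int M..int M}. cont_rep g (node M m)) = aliased M (fcoeff g) 0"
    using sampled_fseries[OF c, of M 0] period_nonzero[of M]
    by (simp add: cont_rep_eq_fseries[OF g c] flip: period_real)
  then have e: "GM M g = (\<lambda>\<phi>. 1 * g \<phi> + (- 1) * dist_of (\<lambda>_. aliased M (fcoeff g) 0) \<phi>)"
    unfolding GM_def by simp
  have "dist_of (\<lambda>_. aliased M (fcoeff g) 0) \<in> pdist"
    by (intro dist_of_in_pdist cint_integrable continuous_intros)
  then show "GM M g \<in> pdist" unfolding e by (intro pdist_comb g)
  have "pcoeff (\<lambda>_. a) n = (if n = 0 then a else 0)" for a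
    using pcoeff_lincomb[of "fmode 0" "fmode 0" a 0 n] pcoeff_fmode[of 0 n]
    by (auto intro: continuous_intros)
  then show "fcoeff (GM M g) n = (if n = 0 then fcoeff g 0 - aliased M (fcoeff g) 0 else fcoeff g n)"
    unfolding e fcoeff_lincomb by (auto simp: fcoeff_dist_of)
qed

lemma
  assumes g: "g \<in> pdist" and c: "(\<lambda>n. norm (fcoeff g n)) summable_on UNIV"
  shows FM_GM_in_pdist: "FM M (GM M g) \<in> pdist"
    and fcoeff_FM_GM: "fcoeff (FM M (GM M g)) n = (if period M dvd n then 0 else aliased M (fcoeff g) n)"
proof -
  let ?a = "aliased M (fcoeff g) 0"
  \<comment> \<open>\<open>d\<close> holds the coefficients of the sample mean that
    \<open>GM\<close> subtracts; aliasing spreads its only entry over all multiples of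
    \<open>period M\<close>, where it cancels the aliased coefficients of \<open>g\<close>.\<close>
  define d where "d k = (if k = 0 then ?a else 0)" for k :: int
  have d: "(\<lambda>n. norm (d n)) summable_on UNIV"
    by (rule finite_nonzero_values_imp_summable_on, rule finite_subset[of _ "{0}"]) (auto simp: d_def)
  have e: "fcoeff (GM M g) = (\<lambda>k. 1 * fcoeff g k + (- 1) * d k)"
    by (auto simp: fcoeff_GM[OF g c] d_def)
  have c': "(\<lambda>n. norm (fcoeff (GM M g) n)) summable_on UNIV"
  proof (rule summable_on_comparison_test)
    show "(\<lambda>n. norm (fcoeff g n) + norm (d n)) summable_on UNIV" by (intro summable_on_add c d)
    show "norm (fcoeff (GM M g) n) \<le> norm (fcoeff g n) + norm (d n)" for n
      unfolding e using norm_triangle_ineq4[of "fcoeff g n" "d n"] by simp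
  qed simp
  show "FM M (GM M g) \<in> pdist" by (rule FM_in_pdist[OF GM_in_pdist[OF g c] c'])
  have "aliased M d n = (if period M dvd n then ?a else 0)"
  proof -
    have "infsum d {k. period M dvd k - n} = infsum d (if period M dvd n then {0} else {})"
      by (rule infsum_cong_neutral) (auto simp: d_def)
    then show ?thesis by (auto simp: aliased_def[of M d] d_def)
  qed
  moreover have "aliased M (fcoeff g) n = ?a" if "period M dvd n" using that by (intro aliased_periodic) simp
  ultimately show "fcoeff (FM M (GM M g)) n = (if period M dvd n then 0 else aliased M (fcoeff g) n)"
    unfolding fcoeff_FM[OF GM_in_pdist[OF g c] c'] e aliased_lincomb[OF c d] by auto
qed

lemma fcoeff_QM:
  assumes g: "g \<in> pdist" and c: "(\<lambda>n. norm (fcoeff g n)) summable_on UNIV"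
  shows "fcoeff (QM M g) n = (if \<bar>n\<bar> \<le> int M then aliased M (fcoeff g) n else 0)"
proof -
  let ?I = "{- int M..int M}"
  have d: "dirichlet_basis M m \<theta> = (\<Sum>k\<in>?I. (1 / of_int (period M) * fmode (- k) (node M m)) * fmode k \<theta>)" for m \<theta>
    unfolding dirichlet_basis_def period_real(2)[symmetric] sum_distrib_left
    by (intro sum.cong refl) (simp add: fmode_def right_diff_distrib exp_diff exp_minus divide_inverse)
  \<comment> \<open>Exchanging the sums over nodes and frequencies shows the interpolant as a
    trigonometric polynomial of degree at most \<open>M\<close> whose coefficients are the discrete
    Fourier transform of the samples.\<close>
  define b where "b k = (\<Sum>m\<in>?I. 1 / of_int (period M) * (fseries (fcoeff g) (node M m) * fmode (- k) (node M m)))" for k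
  have "QM M g = dist_of (\<lambda>\<theta>. \<Sum>k\<in>?I. b k * fmode k \<theta>)"
    unfolding QM_def cont_rep_eq_fseries[OF g c] d b_def sum_distrib_left sum_distrib_right
    by (subst sum.swap) (simp add: mult_ac)
  then have "fcoeff (QM M g) n = pcoeff (\<lambda>\<theta>. \<Sum>k\<in>?I. b k * fmode k \<theta>) n" by (simp add: fcoeff_dist_of)
  also have "\<dots> = (\<Sum>k\<in>?I. b k * pcoeff (fmode k) n)"
  proof -
    have "integrable CC (\<lambda>\<theta>. fmode k \<theta> * fmode (- n) \<theta>)" for k
      by (intro cint_integrable continuous_intros)
    then show ?thesis by (simp add: pcoeff_def sum_distrib_right mult.assoc sum_divide_distrib)
  qed
  also have "\<dots> = (if \<bar>n\<bar> \<le> int M then b n else 0)"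
    by (auto simp: pcoeff_fmode if_distrib sum.delta cong: if_cong)
  also have "b n = aliased M (fcoeff g) n"
    unfolding b_def sum_distrib_left[symmetric] sampled_fseries[OF c] using period_nonzero[of M] by simp
  finally show ?thesis .
qed

text \<open>The series in \<open>Pdiam\<close> is \<open>dist_coeffs\<close> of the sequence with
  entry 0 removed; the bound \<open>C\<close> is the growth condition under which its coefficients
  are recovered.\<close>

lemma
  assumes "\<And>n. norm (fcoeff h n) \<le> C"
  shows Pdiam_in_pdist: "Pdiam h \<in> pdist"
    and fcoeff_Pdiam: "fcoeff (Pdiam h) n = (if n = 0 then 0 else fcoeff h n)"
proof -
  define c where "c n = (if n = 0 then 0 else fcoeff h n)" for n
  have C: "0 \<le> C" using order_trans[OF norm_ge_zero assms] .
  have b: "norm (c n) \<le> C * wt n ^ 0" for n using assms C by (simp add: c_def)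
  have "Pdiam h = dist_coeffs c"
  proof
    fix \<phi>
    show "Pdiam h \<phi> = dist_coeffs c \<phi>"
    proof (cases "\<phi> \<in> per_test")
      case True
      have "dist_of (fmode n) \<phi> = 2 * pi * pcoeff \<phi> (- n)" for n
        using True by (simp add: dist_of_def pcoeff_def mult.commute)
      then have "Pdiam h \<phi> = (\<Sum>\<^sub>\<infinity>n. 2 * pi * (c n * pcoeff \<phi> (- n)))"
        unfolding Pdiam_def by (intro infsum_cong_neutral) (auto simp: c_def)
      then show ?thesis using True by (simp add: dist_coeffs_def infsum_cmult_right')
    qed (simp add: Pdiam_def dist_coeffs_def dist_of_def)
  qed
  note P = this
  show "Pdiam h \<in> pdist" unfolding P by (rule dist_coeffs_in_pdist[OF b])
  show "fcoeff (Pdiam h) n = (if n = 0 then 0 else fcoeff h n)"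
    unfolding P fcoeff_dist_coeffs[OF b] c_def ..
qed

lemma Hs0_antimono:
  assumes "g \<in> Hs0 s" "t \<le> s"
  shows "g \<in> Hs0 t"
proof -
  have "g \<in> Hs t"
  proof (rule HsI[OF Hs0_pdist[OF assms(1)]])
    show "(\<lambda>n. sob_weight t n * (norm (fcoeff g n))\<^sup>2) summable_on UNIV"
      by (rule summable_on_comparison_test[OF Hs_summable[OF Hs0_Hs[OF assms(1)]]])
        (use assms(2) in \<open>auto simp: sob_weight_wt intro!: mult_right_mono powr_mono\<close>)
  qed
  then show ?thesis using assms(1) by (simp add: Hs0_def)
qed

text \<open>A nonzero \<open>j\<close> moves the frequency to \<open>n + period M * j\<close>, of
  modulus at least \<open>(1/2 + M) * \<bar>j\<bar>\<close>: \<open>period M\<close> is twice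
  \<open>1/2 + M\<close>, and half of the shift pays for \<open>\<bar>n\<bar> \<le> M\<close>. This
  is where the rate and its base 1/2 + M come from.\<close>

lemma aliased_weights_le:
  assumes s: "s > 1/2" and n: "\<bar>n\<bar> \<le> int M"
  shows "(\<Sum>\<^sub>\<infinity>k\<in>{k. period M dvd k - n} - {n}. sob_weight (- s) k)
    \<le> ((1/2 + real M) powr (- s))\<^sup>2 * (\<Sum>\<^sub>\<infinity>j. wt j powr (- 2 * s))"
proof -
  define N where "N = period M"
  have N: "N \<noteq> 0" "real_of_int N = 2 * real M + 1" using period_pos[of M] by (auto simp: N_def period_real)
  have A: "{k. N dvd k - n} - {n} = (\<lambda>j. n + N * j) ` (- {0})"
    using N by (auto simp: dvd_def image_iff algebra_simps)
  have inj: "inj_on (\<lambda>j. n + N * j) (- {0})" using N by (auto simp: inj_on_def)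
  have sw: "(\<lambda>j. wt j powr (- 2 * s)) summable_on UNIV" using summable_wt_powr[of "2 * s"] s by simp
  have le: "sob_weight (- s) (n + N * j) \<le> ((1/2 + real M) powr (- s))\<^sup>2 * wt j powr (- 2 * s)" if "j \<noteq> 0" for j
  proof -
    have "\<bar>real_of_int n\<bar> \<le> real M" using n by linarith
    moreover have "1 \<le> \<bar>real_of_int j\<bar>" using that by linarith
    ultimately have "(1/2 + real M) * \<bar>real_of_int j\<bar> \<le> \<bar>real_of_int N * of_int j\<bar> - \<bar>real_of_int n\<bar>"
    proof -
      have "\<bar>real_of_int N * of_int j\<bar> = 2 * ((1/2 + real M) * \<bar>real_of_int j\<bar>)" by (simp add: N(2) abs_mult)
      moreover have "real M * 1 \<le> (1/2 + real M) * \<bar>real_of_int j\<bar>" using \<open>1 \<le> \<bar>real_of_int j\<bar>\<close> by (intro mult_mono) auto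
      ultimately show ?thesis using \<open>\<bar>real_of_int n\<bar> \<le> real M\<close> by linarith
    qed
    also have "\<dots> \<le> \<bar>real_of_int (n + N * j)\<bar>" by simp
    also have "\<dots> \<le> wt (n + N * j)" by (rule abs_le_wt)
    finally have "(1/2 + real M) * wt j \<le> wt (n + N * j)" using that by (simp add: wt_nonzero)
    then have "wt (n + N * j) powr (- 2 * s) \<le> ((1/2 + real M) * wt j) powr (- 2 * s)"
      using s by (intro powr_mono2') (auto intro!: mult_pos_pos)
    also have "\<dots> = ((1/2 + real M) powr (- s))\<^sup>2 * wt j powr (- 2 * s)"
      by (simp add: powr_mult less_imp_le power2_eq_square flip: powr_add)
    finally show ?thesis by (simp add: sob_weight_wt)
  qed
  have sr: "(\<lambda>j. ((1/2 + real M) powr (- s))\<^sup>2 * wt j powr (- 2 * s)) summable_on (- {0})"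
    by (intro summable_on_cmult_right summable_on_subset[OF sw]) simp
  have "(\<Sum>\<^sub>\<infinity>k\<in>{k. N dvd k - n} - {n}. sob_weight (- s) k) = (\<Sum>\<^sub>\<infinity>j\<in>- {0}. sob_weight (- s) (n + N * j))"
    unfolding A by (subst infsum_reindex[OF inj]) (simp add: o_def)
  also have "\<dots> \<le> (\<Sum>\<^sub>\<infinity>j\<in>- {0}. ((1/2 + real M) powr (- s))\<^sup>2 * wt j powr (- 2 * s))"
    by (rule infsum_mono[OF summable_on_comparison_test[OF sr]]) (use sr le in auto)
  also have "\<dots> = ((1/2 + real M) powr (- s))\<^sup>2 * (\<Sum>\<^sub>\<infinity>j\<in>- {0}. wt j powr (- 2 * s))"
    by (rule infsum_cmult_right')
  also have "\<dots> \<le> ((1/2 + real M) powr (- s))\<^sup>2 * (\<Sum>\<^sub>\<infinity>j. wt j powr (- 2 * s))"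
    by (intro mult_left_mono infsum_mono2 sw summable_on_subset[OF sw]) auto
  finally show ?thesis by (simp add: N_def)
qed

lemma period_dvd_small: "\<bar>n\<bar> \<le> int M \<Longrightarrow> n \<noteq> 0 \<Longrightarrow> \<not> period M dvd n"
  using dvd_imp_le_int[of n "period M"] by (auto simp: period_def)

lemma aliased_mode_large:
  assumes "\<bar>n\<bar> \<le> int M" "period M dvd k - n" "k \<noteq> n"
  shows "int M < \<bar>k\<bar>"
  using dvd_imp_le_int[of "k - n" "period M"] assms by (auto simp: period_def)

section \<open>The error estimate for smoothing operators\<close>

context smoothing
begin

definition discretization_error :: "nat \<Rightarrow> functional \<Rightarrow> functional" where
  "discretization_error M g = (\<lambda>\<phi>. op g \<phi> - Pdiam (QM M (op (FM M (GM M g)))) \<phi>)"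

context
  fixes s :: real
  assumes s: "s > 1/2"
begin

text \<open>Up to normalization, the norm of the embedding of \<open>Hs s\<close> into absolutely
  summable Fourier series; \<open>s > 1/2\<close> makes the sum converge.\<close>

definition Z :: real where "Z = sqrt (\<Sum>\<^sub>\<infinity>j. wt j powr (- 2 * s))"

lemma Z_nonneg: "0 \<le> Z" by (auto simp: Z_def intro: infsum_nonneg)

lemma Hs_coeff_summable:
  assumes g: "g \<in> Hs0 s"
  shows "(\<lambda>n. norm (fcoeff g n)) summable_on UNIV"
    and "(\<Sum>\<^sub>\<infinity>n. norm (fcoeff g n)) \<le> Z * Hs_norm s g"
proof -
  have w: "(\<lambda>n. sob_weight (- s) n * 1\<^sup>2) summable_on UNIV"
    using summable_wt_powr[of "2 * s"] s by (simp add: sob_weight_wt)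
  show "(\<lambda>n. norm (fcoeff g n)) summable_on UNIV" "(\<Sum>\<^sub>\<infinity>n. norm (fcoeff g n)) \<le> Z * Hs_norm s g"
    using Hs_duality[OF Hs0_Hs[OF g] w] by (simp_all add: Z_def sob_weight_wt)
qed

text \<open>The tail over the residue class is estimated by \<open>Hs_duality\<close> with the
  weights of \<open>aliased_weights_le\<close>. This is the one error term that is not exponentially
  small in \<open>M\<close>.\<close>

lemma aliased_coeff_le:
  assumes g: "g \<in> Hs0 s" and n: "\<bar>n\<bar> \<le> int M"
  shows "norm (aliased M (fcoeff g) n - fcoeff g n) \<le> Z * (1/2 + real M) powr (- s) * Hs_norm s g"
proof -
  let ?A = "{k. period M dvd k - n} - {n}"
  have w: "(\<lambda>n. sob_weight (- s) n * 1\<^sup>2) summable_on ?A"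
    using summable_on_subset[OF summable_wt_powr[of "2 * s"], of ?A] s by (simp add: sob_weight_wt)
  have "norm (aliased M (fcoeff g) n - fcoeff g n) \<le> (\<Sum>\<^sub>\<infinity>k\<in>?A. 1 * norm (fcoeff g k))"
    using aliased_remainder[OF Hs_coeff_summable(1)[OF g]] by simp
  also have "\<dots> \<le> sqrt (\<Sum>\<^sub>\<infinity>k\<in>?A. sob_weight (- s) k * 1\<^sup>2) * Hs_norm s g"
    by (rule Hs_duality(2)[OF Hs0_Hs[OF g] w]) simp
  also have "\<dots> \<le> sqrt (((1/2 + real M) powr (- s))\<^sup>2 * (\<Sum>\<^sub>\<infinity>j. wt j powr (- 2 * s))) * Hs_norm s g"
    using aliased_weights_le[OF s n] by (intro mult_right_mono real_sqrt_le_mono) auto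
  also have "\<dots> = Z * (1/2 + real M) powr (- s) * Hs_norm s g"
    by (simp add: real_sqrt_mult Z_def)
  finally show ?thesis .
qed

text \<open>The coefficients of the Dirac comb are merely bounded, so the order has to be below
  -1/2; -1 is a convenient choice.\<close>

lemma
  assumes g: "g \<in> Hs0 s"
  shows norm_fcoeff_FM_GM_le: "norm (fcoeff (FM M (GM M g)) n) \<le> Z * Hs_norm s g"
    and FM_GM_in_Hs0: "FM M (GM M g) \<in> Hs0 (-1)"
proof -
  note c = Hs_coeff_summable[OF g]
  have zn: "0 \<le> Z * Hs_norm s g" using Z_nonneg by simp
  show b: "norm (fcoeff (FM M (GM M g)) n) \<le> Z * Hs_norm s g" for n
    using norm_aliased_le[OF c(1), of M n] c(2) zn by (simp add: fcoeff_FM_GM[OF Hs0_pdist[OF g] c(1)])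
  have "FM M (GM M g) \<in> Hs (-1)"
  proof (rule Hs_from_decay(1)[OF FM_GM_in_pdist[OF Hs0_pdist[OF g] c(1)], where e = "\<lambda>_. 1"])
    show "(\<lambda>n. sob_weight (-1) n * 1\<^sup>2) summable_on UNIV"
      using summable_wt_powr[of 2] by (simp add: sob_weight_wt)
  qed (use b zn in auto)
  then show "FM M (GM M g) \<in> Hs0 (-1)"
    by (simp add: Hs0_def fcoeff_FM_GM[OF Hs0_pdist[OF g] c(1)])
qed

lemma Hs0_s_subset_neg: "g \<in> Hs0 s \<Longrightarrow> g \<in> Hs0 (-1)"
  using s by (rule_tac Hs0_antimono) auto

lemma op_coeff_abs_summable:
  assumes "f \<in> Hs0 t"
  shows "(\<lambda>n. norm (fcoeff (op f) n)) summable_on UNIV"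
proof -
  let ?T = "\<Sum>\<^sub>\<infinity>m. q ^ nat \<bar>m\<bar> * norm (fcoeff f m)"
  have "(\<lambda>n. (K * ?T) * (wt n powr 0 * q ^ nat \<bar>n\<bar>)) summable_on UNIV"
    by (intro summable_on_cmult_right summable_geometric_wt q)
  then show ?thesis
    by (rule summable_on_comparison_test) (use norm_fcoeff_op_le[OF assms] in \<open>auto simp: mult_ac\<close>)
qed

lemma
  assumes g: "g \<in> Hs0 s"
  shows discretization_error_in_pdist: "discretization_error M g \<in> pdist"
    and fcoeff_discretization_error: "fcoeff (discretization_error M g) n
      = fcoeff (op g) n - (if n \<noteq> 0 \<and> \<bar>n\<bar> \<le> int M then aliased M (fcoeff (op (FM M (GM M g)))) n else 0)"
proof -
  let ?h = "op (FM M (GM M g))"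
  have h: "?h \<in> pdist" "(\<lambda>n. norm (fcoeff ?h n)) summable_on UNIV"
    by (rule op_in_pdist[OF FM_GM_in_Hs0[OF g]], rule op_coeff_abs_summable[OF FM_GM_in_Hs0[OF g]])
  have Q: "fcoeff (QM M ?h) n = (if \<bar>n\<bar> \<le> int M then aliased M (fcoeff ?h) n else 0)" for n
    by (rule fcoeff_QM[OF h])
  have b: "norm (fcoeff (QM M ?h) n) \<le> (\<Sum>\<^sub>\<infinity>n. norm (fcoeff ?h n))" for n
    using norm_aliased_le[OF h(2)] by (auto simp: Q intro: infsum_nonneg)
  have e: "discretization_error M g = (\<lambda>\<phi>. 1 * op g \<phi> + (- 1) * Pdiam (QM M ?h) \<phi>)"
    by (simp add: discretization_error_def)
  show "discretization_error M g \<in> pdist"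
    unfolding e by (intro pdist_comb op_in_pdist[OF g] Pdiam_in_pdist[OF b])
  show "fcoeff (discretization_error M g) n
      = fcoeff (op g) n - (if n \<noteq> 0 \<and> \<bar>n\<bar> \<le> int M then aliased M (fcoeff ?h) n else 0)"
    unfolding e fcoeff_lincomb fcoeff_Pdiam[OF b] Q by simp
qed

lemma FM_GM_lincomb:
  assumes "g \<in> Hs0 s" "h \<in> Hs0 s"
  shows "FM M (GM M (\<lambda>\<phi>. a * g \<phi> + b * h \<phi>)) = (\<lambda>\<phi>. a * FM M (GM M g) \<phi> + b * FM M (GM M h) \<phi>)"
proof (rule pdist_eqI)
  note c = Hs0_comb[OF assms, of a b]
  show "FM M (GM M (\<lambda>\<phi>. a * g \<phi> + b * h \<phi>)) \<in> pdist" using FM_GM_in_Hs0[OF c] by (rule Hs0_pdist)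
  show "(\<lambda>\<phi>. a * FM M (GM M g) \<phi> + b * FM M (GM M h) \<phi>) \<in> pdist"
    by (intro pdist_comb Hs0_pdist[OF FM_GM_in_Hs0] assms)
  show "fcoeff (FM M (GM M (\<lambda>\<phi>. a * g \<phi> + b * h \<phi>))) n = fcoeff (\<lambda>\<phi>. a * FM M (GM M g) \<phi> + b * FM M (GM M h) \<phi>) n" for n
    unfolding fcoeff_FM_GM[OF Hs0_pdist[OF c] Hs_coeff_summable(1)[OF c]] fcoeff_lincomb
      fcoeff_FM_GM[OF Hs0_pdist[OF assms(1)] Hs_coeff_summable(1)[OF assms(1)]]
      fcoeff_FM_GM[OF Hs0_pdist[OF assms(2)] Hs_coeff_summable(1)[OF assms(2)]]
    using aliased_lincomb[OF Hs_coeff_summable(1)[OF assms(1)] Hs_coeff_summable(1)[OF assms(2)], where M = M and a = a and b = b and n = n]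
    by (simp add: fcoeff_lincomb[abs_def])
qed

lemma discretization_error_lincomb:
  assumes "g \<in> Hs0 s" "h \<in> Hs0 s"
  shows "discretization_error M (\<lambda>\<phi>. a * g \<phi> + b * h \<phi>)
    = (\<lambda>\<phi>. a * discretization_error M g \<phi> + b * discretization_error M h \<phi>)"
proof (rule pdist_eqI)
  note c = Hs0_comb[OF assms, of a b]
  note F = FM_GM_in_Hs0[OF assms(1)] FM_GM_in_Hs0[OF assms(2)]
  show "discretization_error M (\<lambda>\<phi>. a * g \<phi> + b * h \<phi>) \<in> pdist" by (rule discretization_error_in_pdist[OF c])
  show "(\<lambda>\<phi>. a * discretization_error M g \<phi> + b * discretization_error M h \<phi>) \<in> pdist"
    by (intro pdist_comb discretization_error_in_pdist assms)
  show "fcoeff (discretization_error M (\<lambda>\<phi>. a * g \<phi> + b * h \<phi>)) n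
      = fcoeff (\<lambda>\<phi>. a * discretization_error M g \<phi> + b * discretization_error M h \<phi>) n" for n
  proof -
    have o: "op (FM M (GM M (\<lambda>\<phi>. a * g \<phi> + b * h \<phi>))) = (\<lambda>\<phi>. a * op (FM M (GM M g)) \<phi> + b * op (FM M (GM M h)) \<phi>)"
      unfolding FM_GM_lincomb[OF assms] by (rule op_lincomb[OF F])
    show ?thesis
      unfolding fcoeff_discretization_error[OF c] o op_lincomb[OF assms] fcoeff_lincomb
        fcoeff_discretization_error[OF assms(1)] fcoeff_discretization_error[OF assms(2)]
      using aliased_lincomb[OF op_coeff_abs_summable[OF F(1)] op_coeff_abs_summable[OF F(2)], where M = M and a = a and b = b and n = n]
      by (simp add: fcoeff_lincomb[abs_def] algebra_simps)
  qed
qed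

text \<open>Writing \<open>q = p\<^sup>3\<close>, one factor \<open>p\<close> keeps the coefficients summable, one controls the output frequency and the
  third yields the rate in \<open>M\<close>.\<close>

lemma discretization_error_decay:
  obtains C p where "0 < p" "p < 1" "0 \<le> C"
    "\<And>M g n. M \<ge> 1 \<Longrightarrow> g \<in> Hs0 s \<Longrightarrow>
      norm (fcoeff (discretization_error M g) n) \<le> (C * (1/2 + real M) powr (- s) * Hs_norm s g) * p ^ nat \<bar>n\<bar>"
proof -
  define p where "p = root 3 q"
  have p: "0 < p" "p < 1" "p ^ 3 = q" using q by (auto simp: p_def)
  have qk: "q ^ k = p ^ k * p ^ k * p ^ k" for k
    unfolding p(3)[symmetric] by (simp add: power_mult[symmetric] mult.commute[of 3] power3_eq_cube power_mult_distrib flip: power_mult)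
  have pm: "p ^ j \<le> p ^ i" if "i \<le> j" for i j :: nat using p that by (intro power_decreasing) auto
  have p1: "p ^ k \<le> 1" "0 \<le> p ^ k" for k using p by (auto intro: power_le_one)
  have qp: "q ^ k \<le> p ^ k" for k
    unfolding qk using p1[of k] by (intro mult_le_one order_trans[OF mult_left_le_one_le] mult_nonneg_nonneg) (auto simp: mult_le_one mult_left_le_one_le)
  obtain C0 where C0: "\<And>n. wt n powr s * p ^ nat \<bar>n\<bar> \<le> C0" using geometric_wt_bound[OF p(1,2)] by blast
  \<comment> \<open>For \<open>M \<ge> 1\<close> one has \<open>1/2 + M \<le> 2 * M\<close>, which
    costs the factor \<open>2 powr s\<close>; the constant \<open>C0\<close> plays off
    \<open>M powr s\<close> against \<open>p ^ M\<close>.\<close>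
  define C1 where "C1 = 2 powr s * C0"
  have C1: "0 \<le> C1" unfolding C1_def using order_trans[OF _ C0[of 0]] p by (simp add: less_imp_le)
  have pM: "p ^ M \<le> C1 * (1/2 + real M) powr (- s)" if "M \<ge> 1" for M
  proof -
    have w: "wt (int M) = real M" using that by (simp add: wt_nonzero)
    have "(1/2 + real M) powr s \<le> (2 * real M) powr s" using that s by (intro powr_mono2) auto
    also have "\<dots> = 2 powr s * wt (int M) powr s" using that by (simp add: powr_mult w)
    finally have "(1/2 + real M) powr s * p ^ M \<le> 2 powr s * (wt (int M) powr s * p ^ M)"
      using p1(2)[of M] by (simp add: mult_right_mono flip: mult.assoc)
    also have "\<dots> \<le> C1" unfolding C1_def using C0[of "int M"] by (intro mult_left_mono) auto
    finally show ?thesis by (simp add: powr_minus field_simps)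
  qed
  have sp: "(\<lambda>n::int. p ^ nat \<bar>n\<bar>) summable_on UNIV" using summable_geometric_wt[OF p(1,2), of 0] by simp
  define G where "G = (\<Sum>\<^sub>\<infinity>n::int. p ^ nat \<bar>n\<bar>)"
  have G: "0 \<le> G" unfolding G_def using p1 by (intro infsum_nonneg) auto
  have weighted_sum: "(\<Sum>\<^sub>\<infinity>m. q ^ nat \<bar>m\<bar> * norm (fcoeff f m)) \<le> b * G"
    if f: "f \<in> Hs0 t" and b: "\<And>m. q ^ nat \<bar>m\<bar> * norm (fcoeff f m) \<le> b * p ^ nat \<bar>m\<bar>" for f t b
  proof -
    have "(\<Sum>\<^sub>\<infinity>m. q ^ nat \<bar>m\<bar> * norm (fcoeff f m)) \<le> (\<Sum>\<^sub>\<infinity>m. b * p ^ nat \<bar>m\<bar>)"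
      by (rule infsum_mono[OF geometric_coeff_summable(1)[OF Hs0_Hs[OF f]] summable_on_cmult_right[OF sp] b])
    then show ?thesis by (simp add: G_def infsum_cmult_right')
  qed
  \<comment> \<open>The summands stand for the input error \<open>g - FM M (GM M g)\<close> sent
    through \<open>op\<close>, for the aliasing of the output by \<open>QM\<close>, and for the
    output modes beyond \<open>M\<close> that \<open>QM\<close> discards.\<close>
  define C where "C = K * (Z * (1 + 2 * C1) * G) + K * (Z * G) * (G * C1) + K * (Z * G) * C1"
  have Cnn: "0 \<le> C" using K_nonneg Z_nonneg G C1 by (simp add: C_def)
  have "norm (fcoeff (discretization_error M g) n) \<le> (C * (1/2 + real M) powr (- s) * Hs_norm s g) * p ^ nat \<bar>n\<bar>"
    if M: "M \<ge> 1" and g: "g \<in> Hs0 s" for M g n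
  proof -
    define E where "E = (1/2 + real M) powr (- s)"
    define H where "H = Hs_norm s g"
    have EH: "0 \<le> E" "0 \<le> H" by (simp_all add: E_def H_def)
    note pM' = pM[OF M, folded E_def]
    let ?f = "FM M (GM M g)"
    note f = FM_GM_in_Hs0[OF g, of M]
    have fb: "norm (fcoeff ?f m) \<le> Z * H" for m unfolding H_def by (rule norm_fcoeff_FM_GM_le[OF g])
    have gb: "norm (fcoeff g m) \<le> Z * H" for m
    proof -
      have "norm (fcoeff g m) = (\<Sum>\<^sub>\<infinity>k\<in>{m}. norm (fcoeff g k))" by simp
      also have "\<dots> \<le> (\<Sum>\<^sub>\<infinity>k. norm (fcoeff g k))"
        by (rule infsum_mono2) (auto intro: Hs_coeff_summable[OF g])
      also have "\<dots> \<le> Z * H" unfolding H_def by (rule Hs_coeff_summable[OF g])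
      finally show ?thesis .
    qed
    have ZH: "0 \<le> Z * H" using Z_nonneg EH by simp
    have wb: "(\<Sum>\<^sub>\<infinity>m. q ^ nat \<bar>m\<bar> * norm (fcoeff h m)) \<le> Z * H * G" if "h \<in> Hs0 t" "\<And>m. norm (fcoeff h m) \<le> Z * H" for h t
    proof (rule weighted_sum[OF that(1)])
      fix m
      have "q ^ nat \<bar>m\<bar> * norm (fcoeff h m) \<le> p ^ nat \<bar>m\<bar> * (Z * H)"
        using q by (intro mult_mono qp that(2)) (auto simp: p1)
      then show "q ^ nat \<bar>m\<bar> * norm (fcoeff h m) \<le> Z * H * p ^ nat \<bar>m\<bar>" by (simp add: mult_ac)
    qed
    \<comment> \<open>The input error is considered in \<open>Hs0 (-1)\<close> only, since its high
      modes are merely bounded.\<close>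
    define r where "r = (\<lambda>\<phi>. 1 * g \<phi> + (- 1) * ?f \<phi>)"
    have r: "r \<in> Hs0 (-1)" unfolding r_def by (rule Hs0_comb[OF Hs0_s_subset_neg[OF g] f])
    have rc: "fcoeff r m = fcoeff g m - fcoeff ?f m" for m unfolding r_def fcoeff_lincomb by simp
    have rsum: "(\<Sum>\<^sub>\<infinity>m. q ^ nat \<bar>m\<bar> * norm (fcoeff r m)) \<le> (Z * H * E * (1 + 2 * C1)) * G"
    proof (rule weighted_sum[OF r])
      fix m
      show "q ^ nat \<bar>m\<bar> * norm (fcoeff r m) \<le> (Z * H * E * (1 + 2 * C1)) * p ^ nat \<bar>m\<bar>"
      proof (cases "\<bar>m\<bar> \<le> int M")
        case True
        \<comment> \<open>Low modes: the error is pure aliasing, and at \<open>m = 0\<close> both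
          terms vanish.\<close>
        have "norm (fcoeff r m) \<le> Z * H * E"
        proof (cases "m = 0")
          case True
          then show ?thesis using Hs0_fcoeff[OF g] Hs0_fcoeff[OF f] ZH EH by (simp add: rc)
        next
          case False
          then have "fcoeff ?f m = aliased M (fcoeff g) m"
            using period_dvd_small[OF True] by (simp add: fcoeff_FM_GM[OF Hs0_pdist[OF g] Hs_coeff_summable(1)[OF g]])
          then show ?thesis using aliased_coeff_le[OF g True] by (simp add: rc E_def H_def norm_minus_commute mult_ac)
        qed
        also have "\<dots> \<le> Z * H * E * (1 + 2 * C1)" using ZH EH C1 by (simp add: mult_left_le distrib_left)
        finally have "q ^ nat \<bar>m\<bar> * norm (fcoeff r m) \<le> p ^ nat \<bar>m\<bar> * (Z * H * E * (1 + 2 * C1))"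
          by (intro mult_mono qp) (auto simp: p1)
        then show ?thesis by (simp add: mult_ac)
      next
        case False
        \<comment> \<open>High modes: the coefficient itself is not small; a factor
          \<open>p ^ nat \<bar>m\<bar>\<close> of the matrix decay, at most \<open>p ^ M\<close>,
          supplies the rate.\<close>
        have "norm (fcoeff r m) \<le> 2 * (Z * H)"
          unfolding rc using norm_triangle_ineq4[of "fcoeff g m" "fcoeff ?f m"] fb[of m] gb[of m] by linarith
        moreover have "q ^ nat \<bar>m\<bar> \<le> p ^ nat \<bar>m\<bar> * (C1 * E)"
        proof -
          have "q ^ nat \<bar>m\<bar> \<le> p ^ nat \<bar>m\<bar> * p ^ nat \<bar>m\<bar> * 1"
            unfolding qk by (intro mult_left_mono p1) (auto simp: p1)
          also have "\<dots> \<le> p ^ nat \<bar>m\<bar> * (C1 * E)"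
            unfolding mult_1_right by (intro mult_left_mono p1 order_trans[OF pm pM']) (use False in auto)
          finally show ?thesis .
        qed
        ultimately have "q ^ nat \<bar>m\<bar> * norm (fcoeff r m) \<le> (p ^ nat \<bar>m\<bar> * (C1 * E)) * (2 * (Z * H))"
          using C1 EH p1 by (intro mult_mono) auto
        also have "\<dots> = (Z * H * E * (2 * C1)) * p ^ nat \<bar>m\<bar>" by (simp add: mult_ac)
        also have "\<dots> \<le> (Z * H * E * (1 + 2 * C1)) * p ^ nat \<bar>m\<bar>"
          using ZH EH p1 by (intro mult_right_mono mult_left_mono) auto
        finally show ?thesis .
      qed
    qed
    have r_op: "norm (fcoeff (op g) n - fcoeff (op ?f) n) \<le> K * (Z * (1 + 2 * C1) * G) * (E * H * p ^ nat \<bar>n\<bar>)"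
    proof -
      have "fcoeff (op r) n = fcoeff (op g) n - fcoeff (op ?f) n"
        unfolding r_def op_lincomb[OF Hs0_s_subset_neg[OF g] f] fcoeff_lincomb by simp
      then have "norm (fcoeff (op g) n - fcoeff (op ?f) n) \<le> K * q ^ nat \<bar>n\<bar> * (\<Sum>\<^sub>\<infinity>m. q ^ nat \<bar>m\<bar> * norm (fcoeff r m))"
        using norm_fcoeff_op_le[OF r, of n] by simp
      also have "\<dots> \<le> K * p ^ nat \<bar>n\<bar> * ((Z * H * E * (1 + 2 * C1)) * G)"
        using K_nonneg q by (intro mult_mono mult_left_mono qp rsum) (auto intro!: mult_nonneg_nonneg infsum_nonneg simp: p1)
      finally show ?thesis by (simp add: mult_ac)
    qed
    have fop: "norm (fcoeff (op ?f) k) \<le> K * (Z * G) * H * q ^ nat \<bar>k\<bar>" for k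
    proof -
      have "norm (fcoeff (op ?f) k) \<le> K * q ^ nat \<bar>k\<bar> * (\<Sum>\<^sub>\<infinity>m. q ^ nat \<bar>m\<bar> * norm (fcoeff ?f m))"
        by (rule norm_fcoeff_op_le[OF f])
      also have "\<dots> \<le> K * q ^ nat \<bar>k\<bar> * (Z * H * G)"
        using K_nonneg q by (intro mult_left_mono wb[OF f] fb) auto
      finally show ?thesis by (simp add: mult_ac)
    qed
    have KZG: "0 \<le> K * (Z * G)" using K_nonneg Z_nonneg G by simp
    have nn: "0 \<le> E * H * p ^ nat \<bar>n\<bar>" using EH p1 by simp
    consider "n = 0" | "n \<noteq> 0" "\<bar>n\<bar> \<le> int M" | "int M < \<bar>n\<bar>" by linarith
    then have "norm (fcoeff (discretization_error M g) n) \<le> C * (E * H * p ^ nat \<bar>n\<bar>)"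
    proof cases
      case 1
      have "fcoeff (op g) 0 = 0" unfolding fcoeff_op[OF g] by (simp add: matrix_0)
      then show ?thesis using 1 Cnn nn by (simp add: fcoeff_discretization_error[OF g])
    next
      case 2
      let ?A = "{k. period M dvd k - n} - {n}"
      have "norm (aliased M (fcoeff (op ?f)) n - fcoeff (op ?f) n) \<le> (\<Sum>\<^sub>\<infinity>k\<in>?A. norm (fcoeff (op ?f) k))"
        by (rule aliased_remainder[OF op_coeff_abs_summable[OF f]])
      also have "\<dots> \<le> (\<Sum>\<^sub>\<infinity>k\<in>?A. (K * (Z * G) * C1 * (E * H * p ^ nat \<bar>n\<bar>)) * p ^ nat \<bar>k\<bar>)"
      proof (rule infsum_mono)
        show "(\<lambda>k. norm (fcoeff (op ?f) k)) summable_on ?A"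
          by (rule complex_abs_summable_subset(2)[OF op_coeff_abs_summable[OF f]])
        show "(\<lambda>k. (K * (Z * G) * C1 * (E * H * p ^ nat \<bar>n\<bar>)) * p ^ nat \<bar>k\<bar>) summable_on ?A"
          by (intro summable_on_cmult_right summable_on_subset[OF sp]) simp
        fix k assume "k \<in> ?A"
        then have k: "int M < \<bar>k\<bar>" using aliased_mode_large[OF 2(2)] by blast
        \<comment> \<open>As \<open>\<bar>k\<bar> > M \<ge> \<bar>n\<bar>\<close>, one factor stays
          for the sum over \<open>k\<close>, one is weakened to
          \<open>p ^ nat \<bar>n\<bar>\<close>, and one to \<open>p ^ M\<close>.\<close>
        have "q ^ nat \<bar>k\<bar> \<le> p ^ nat \<bar>k\<bar> * p ^ nat \<bar>n\<bar> * (C1 * E)"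
          unfolding qk using 2 k
          by (intro mult_mono pm order_trans[OF pm pM'] mult_nonneg_nonneg) (auto simp: p1)
        then have "K * (Z * G) * H * q ^ nat \<bar>k\<bar> \<le> K * (Z * G) * H * (p ^ nat \<bar>k\<bar> * p ^ nat \<bar>n\<bar> * (C1 * E))"
          using KZG EH by (intro mult_left_mono) auto
        then show "norm (fcoeff (op ?f) k) \<le> (K * (Z * G) * C1 * (E * H * p ^ nat \<bar>n\<bar>)) * p ^ nat \<bar>k\<bar>"
          using fop[of k] by (simp add: mult_ac)
      qed
      also have "\<dots> = (K * (Z * G) * C1 * (E * H * p ^ nat \<bar>n\<bar>)) * (\<Sum>\<^sub>\<infinity>k\<in>?A. p ^ nat \<bar>k\<bar>)"
        by (rule infsum_cmult_right')
      also have "\<dots> \<le> (K * (Z * G) * C1 * (E * H * p ^ nat \<bar>n\<bar>)) * G"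
        unfolding G_def using KZG[unfolded G_def] C1 nn
        by (intro mult_left_mono infsum_mono2 sp summable_on_subset[OF sp]) (auto simp: p1)
      finally have al: "norm (aliased M (fcoeff (op ?f)) n - fcoeff (op ?f) n) \<le> K * (Z * G) * (G * C1) * (E * H * p ^ nat \<bar>n\<bar>)"
        by (simp add: mult_ac)
      \<comment> \<open>The coefficient of the intermediate \<open>op ?f\<close> is inserted,
        separating the input error from the output aliasing.\<close>
      have e: "fcoeff (discretization_error M g) n
          = (fcoeff (op g) n - fcoeff (op ?f) n) - (aliased M (fcoeff (op ?f)) n - fcoeff (op ?f) n)"
        using 2 by (simp add: fcoeff_discretization_error[OF g])
      have "norm (fcoeff (discretization_error M g) n)
          \<le> K * (Z * (1 + 2 * C1) * G) * (E * H * p ^ nat \<bar>n\<bar>) + K * (Z * G) * (G * C1) * (E * H * p ^ nat \<bar>n\<bar>)"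
        unfolding e using norm_triangle_ineq4[of "fcoeff (op g) n - fcoeff (op ?f) n" "aliased M (fcoeff (op ?f)) n - fcoeff (op ?f) n"] r_op al
        by linarith
      also have "\<dots> \<le> C * (E * H * p ^ nat \<bar>n\<bar>)"
        unfolding distrib_right[symmetric] C_def using KZG C1 nn by (intro mult_right_mono) auto
      finally show ?thesis .
    next
      case 3
      have "norm (fcoeff (op g) n) \<le> K * q ^ nat \<bar>n\<bar> * (\<Sum>\<^sub>\<infinity>m. q ^ nat \<bar>m\<bar> * norm (fcoeff g m))"
        by (rule norm_fcoeff_op_le[OF g])
      also have "\<dots> \<le> K * q ^ nat \<bar>n\<bar> * (Z * H * G)"
        using K_nonneg q by (intro mult_left_mono wb[OF g] gb) auto
      also have "\<dots> \<le> K * (p ^ nat \<bar>n\<bar> * (C1 * E)) * (Z * H * G)"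
      proof -
        have "q ^ nat \<bar>n\<bar> \<le> p ^ nat \<bar>n\<bar> * p ^ nat \<bar>n\<bar> * 1"
          unfolding qk by (intro mult_left_mono p1) (auto simp: p1)
        also have "\<dots> \<le> p ^ nat \<bar>n\<bar> * (C1 * E)"
          unfolding mult_1_right by (intro mult_left_mono p1 order_trans[OF pm pM']) (use 3 in auto)
        finally show ?thesis using K_nonneg ZH G by (intro mult_right_mono mult_left_mono) auto
      qed
      also have "\<dots> = K * (Z * G) * C1 * (E * H * p ^ nat \<bar>n\<bar>)" by (simp add: mult_ac)
      also have "\<dots> \<le> C * (E * H * p ^ nat \<bar>n\<bar>)"
        unfolding C_def using K_nonneg Z_nonneg G C1 nn by (intro mult_right_mono) auto
      finally show ?thesis using 3 by (simp add: fcoeff_discretization_error[OF g])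
    qed
    then show ?thesis by (simp add: E_def H_def mult_ac)
  qed
  then show ?thesis using that[of p C] p Cnn by blast
qed

lemma discretization_error_bound:
  "\<exists>C>0. \<forall>M\<ge>1. discretization_error M \<in> bops s 0 \<and>
      op_norm s 0 (discretization_error M) \<le> C * (1/2 + real M) powr (- s)"
proof -
  obtain C p where p: "0 < p" "p < 1" and C: "0 \<le> C" and
    dec: "\<And>M g n. M \<ge> 1 \<Longrightarrow> g \<in> Hs0 s \<Longrightarrow>
      norm (fcoeff (discretization_error M g) n) \<le> (C * (1/2 + real M) powr (- s) * Hs_norm s g) * p ^ nat \<bar>n\<bar>"
    by (rule discretization_error_decay) (rule that)
  have e: "(\<lambda>n. sob_weight 0 n * (p ^ nat \<bar>n\<bar>)\<^sup>2) summable_on UNIV"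
  proof -
    have "(p ^ nat \<bar>n\<bar>)\<^sup>2 = (p\<^sup>2) ^ nat \<bar>n\<bar>" for n by (simp add: power_mult[symmetric] mult.commute)
    moreover have "0 < p\<^sup>2" "p\<^sup>2 < 1" using p by (auto simp: power_less_one_iff abs_square_less_1)
    ultimately show ?thesis using summable_geometric_wt[of "p\<^sup>2" 0] by (simp add: sob_weight_wt)
  qed
  define R where "R = sqrt (2 * pi * (\<Sum>\<^sub>\<infinity>n. sob_weight 0 n * (p ^ nat \<bar>n\<bar>)\<^sup>2))"
  have R: "0 \<le> R" by (auto simp: R_def intro!: mult_nonneg_nonneg infsum_nonneg)
  \<comment> \<open>Adding 1 to \<open>R * C\<close> makes the constant strictly positive, as the
    theorem demands.\<close>
  have main: "discretization_error M g \<in> Hs0 0 \<and>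
      Hs_norm 0 (discretization_error M g) \<le> ((R * C + 1) * (1/2 + real M) powr (- s)) * Hs_norm s g"
    if M: "M \<ge> 1" and g: "g \<in> Hs0 s" for M g
  proof -
    let ?K = "C * (1/2 + real M) powr (- s) * Hs_norm s g"
    have "0 \<le> ?K" "\<And>n. 0 \<le> p ^ nat \<bar>n\<bar>" using C p by auto
    note D = Hs_from_decay[OF discretization_error_in_pdist[OF g, of M] dec[OF M g] e this, folded R_def]
    have "fcoeff (op g) 0 = 0" unfolding fcoeff_op[OF g] by (simp add: matrix_0)
    then have "discretization_error M g \<in> Hs0 0"
      using D(1) by (simp add: Hs0_def fcoeff_discretization_error[OF g])
    moreover have "R * ?K \<le> ((R * C + 1) * (1/2 + real M) powr (- s)) * Hs_norm s g"
      by (simp add: algebra_simps)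
    ultimately show ?thesis using D(2) by linarith
  qed
  have "discretization_error M \<in> bops s 0" if "M \<ge> 1" for M
    unfolding bops_def mem_Collect_eq using main[OF that] discretization_error_lincomb by blast
  moreover have "op_norm s 0 (discretization_error M) \<le> (R * C + 1) * (1/2 + real M) powr (- s)" if "M \<ge> 1" for M
    unfolding op_norm_def
  proof (rule cSUP_least)
    show "{g \<in> Hs0 s. Hs_norm s g \<le> 1} \<noteq> {}" using zero_in_Hs0[of s] by force
    fix g assume g: "g \<in> {g \<in> Hs0 s. Hs_norm s g \<le> 1}"
    then have "Hs_norm 0 (discretization_error M g) \<le> ((R * C + 1) * (1/2 + real M) powr (- s)) * Hs_norm s g"
      using main[OF that] by blast
    also have "\<dots> \<le> ((R * C + 1) * (1/2 + real M) powr (- s)) * 1"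
      using g R C by (intro mult_left_mono) auto
    finally show "Hs_norm 0 (discretization_error M g) \<le> (R * C + 1) * (1/2 + real M) powr (- s)" by simp
  qed
  moreover have "0 < R * C + 1" using R C by (simp add: add_nonneg_pos)
  ultimately show ?thesis by blast
qed

end

end

text \<open>Every point of the disk outside the essential support has a neighbourhood where
  \<open>g\<close> vanishes almost everywhere. Uncountably many null sets cannot be united, so the
  Lindelof property reduces the cover to a countable one; compactness keeps the support away from
  the circle.\<close>

lemma compact_ess_supp_disk:
  assumes "compact (ess_supp disk g)"
  obtains \<rho> where "0 < \<rho>" "\<rho> < 1" "AE z in DD. \<rho> < norm z \<longrightarrow> g z = 0"
proof -
  let ?K = "ess_supp disk g"
  obtain \<rho> where \<rho>: "0 < \<rho>" "\<rho> < 1" "\<And>z. z \<in> ?K \<Longrightarrow> norm z \<le> \<rho>"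
  proof (cases "?K = {}")
    case True
    then show ?thesis using that[of "1/2"] by auto
  next
    case False
    then obtain x where x: "x \<in> ?K" "\<And>z. z \<in> ?K \<Longrightarrow> norm z \<le> norm x"
      using continuous_attains_sup[OF assms, of norm] continuous_on_norm_id by blast
    then have "norm x < 1" by (simp add: ess_supp_def)
    \<comment> \<open>The maximum with 1/2 keeps \<rho> positive when the support is the origin
      alone.\<close>
    then show ?thesis
      by (intro that[of "max (1/2) (norm x)"]) (use x(2) in \<open>auto intro: le_max_iff_disj[THEN iffD2]\<close>)
  qed
  define F where "F = {U. open U \<and> (AE w in lebesgue_on (disk \<inter> U). g w = 0)}"
  obtain F' where F': "F' \<subseteq> F" "countable F'" "\<Union> F' = \<Union> F"
    by (rule Lindelof[of F]) (auto simp: F_def)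
  have "AE w in DD. w \<in> U \<longrightarrow> g w = 0" if "U \<in> F'" for U
  proof -
    have U: "open U" "AE w in lebesgue_on (disk \<inter> U). g w = 0" using that F'(1) by (auto simp: F_def)
    then have "disk \<inter> U \<in> sets lebesgue" by auto
    then have "AE w in lebesgue. w \<in> disk \<inter> U \<longrightarrow> g w = 0"
      using U(2) by (subst (asm) AE_restrict_space_iff) auto
    then have "AE w in lebesgue. w \<in> disk \<longrightarrow> (w \<in> U \<longrightarrow> g w = 0)" by eventually_elim auto
    then show ?thesis by (subst AE_restrict_space_iff) auto
  qed
  then have "AE w in DD. \<forall>U\<in>F'. w \<in> U \<longrightarrow> g w = 0" by (subst AE_ball_countable[OF F'(2)]) blast
  moreover have "AE w in DD. w \<in> disk" using AE_space[of DD] by simp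
  ultimately have "AE z in DD. \<rho> < norm z \<longrightarrow> g z = 0"
  proof eventually_elim
    case (elim z)
    show ?case
    proof
      assume "\<rho> < norm z"
      then have "z \<notin> ?K" using \<rho>(3) by force
      then obtain U where "open U" "z \<in> U" "AE w in lebesgue_on (disk \<inter> U). g w = 0"
        using elim(2) unfolding ess_supp_def by blast
      then have "z \<in> \<Union> F'" unfolding F'(3) by (auto simp: F_def)
      then show "g z = 0" using elim(1) by blast
    qed
  qed
  then show ?thesis using that \<rho> by blast
qed

theorem theorem5p1:
  fixes \<sigma> :: "complex \<Rightarrow> complex" and lo hi :: real
  assumes "Linf disk \<sigma>"
    and "compact (ess_supp disk (\<lambda>z. \<sigma> z - 1))"
    and "lo > 0" and "hi > 0"
    and "AE z in lebesgue_on disk. lo \<le> Re (\<sigma> z) \<and> Re (\<sigma> z) \<le> hi"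
  shows "\<forall>s::real. s > 1/2 \<longrightarrow> (\<exists>C::real. C > 0 \<and> (\<forall>M::nat. M \<ge> 1 \<longrightarrow>
           (let A = (\<lambda>g \<phi>. relND \<sigma> g \<phi> - Pdiam (QM M (relND \<sigma> (FM M (GM M g)))) \<phi>)
            in A \<in> bops s 0 \<and> op_norm s 0 A \<le> C * (1/2 + real M) powr (- s))))"
proof -
  obtain B where B: "AE z in DD. norm (\<sigma> z) \<le> B" and meas: "\<sigma> \<in> borel_measurable DD"
    using assms(1) by (auto simp: Linf_def)
  obtain \<rho> where \<rho>: "0 < \<rho>" "\<rho> < 1" "AE z in DD. \<rho> < norm z \<longrightarrow> \<sigma> z - 1 = 0"
    by (rule compact_ess_supp_disk[OF assms(2)])
  have "AE z in DD. \<rho> < norm z \<longrightarrow> \<sigma> z = 1" "AE z in DD. lo \<le> Re (\<sigma> z)"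
    using \<rho>(3) assms(5) by (eventually_elim, simp)+
  then interpret inclusion \<sigma> lo B \<rho>
    using meas B \<rho> assms(3) by unfold_locales auto
  have "(\<lambda>g \<phi>. op g \<phi> - Pdiam (QM M (op (FM M (GM M g)))) \<phi>) = discretization_error M" for M
    by (simp add: discretization_error_def fun_eq_iff)
  then show ?thesis
    unfolding relND_eq_op Let_def using discretization_error_bound by auto
qed

end
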